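(* Let $X$ be a space with subspaces $Y_1$ and $Y_2$ which are CW complexes, and let $s\ge 0$ be an integer. If $\pi_j(X)=0$ for all $j\le s$, then $$\mathrm{TC}_X(Y_1\times Y_2)<\frac{\dim(Y_1)+\dim(Y_2)+1}{s+1}+1.$$
   Context: $I=[0,1]$. For a space $X$, $P(X)$ is the space of all continuous maps $\sigma\colon I\to X$ with the compact-open topology. For $A\subseteq X\times X$, $P_X(A)\subseteq P(X)$ is the subspace of paths $\sigma$ with $(\sigma(0),\sigma(1))\in A$, and $\mathrm{TC}_X(A)$ is the smallest integer $k$ such that $A$ has a cover by sets $U_1,\dots,U_k$ open in $A$ for which there are continuous maps $s_i\colon U_i\to P_X(A)$ with $s_i(x,y)(0)=x$ and $s_i(x,y)(1)=y$ for all $(x,y)\in U_i$; if no such $k$ exists, $\mathrm{TC}_X(A)=\infty$. $\dim(Y_j)$ is the dimension of $Y_j$ as a CW complex. The condition $\pi_0(X)=0$ means $X$ is path-connected.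
   Formalization: The CW complexes Y_1 and Y_2 are assumed finite-dimensional; with an infinite dimension the strict inequality can fail, e.g. s=0 and X=Y_1=Y_2=RP^∞, where it would read ∞<∞. *)

theory Defs
  imports "HOL-Analysis.Analysis"
begin

text \<open>
  A path is a function on the reals that is \<^const>\<open>extensional\<close> on the unit interval, so that
  the elements of the path space are exactly the continuous maps from the unit interval to \<open>X\<close>.
\<close>

definition paths :: "'a topology \<Rightarrow> (real \<Rightarrow> 'a) set" where
  "paths X = {\<sigma> \<in> extensional {0..1}. pathin X \<sigma>}"

text \<open>The compact-open topology, given by its standard subbase.\<close>

definition path_space :: "'a topology \<Rightarrow> (real \<Rightarrow> 'a) topology" where
  "path_space X =
     topology_generated_by
       {{\<sigma> \<in> paths X. \<sigma> ` K \<subseteq> U} | K U. K \<subseteq> {0..1} \<and> compact K \<and> openin X U}"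

lemma topspace_path_space [simp]: "topspace (path_space X) = paths X"
proof -
  have "paths X \<in> {{\<sigma> \<in> paths X. \<sigma> ` K \<subseteq> U} | K U. K \<subseteq> {0..1} \<and> compact K \<and> openin X U}"
    by (rule CollectI, rule exI[of _ "{}"], rule exI[of _ "{}"]) auto
  then show ?thesis
    unfolding path_space_def by auto
qed

definition path_space_over :: "'a topology \<Rightarrow> ('a \<times> 'a) set \<Rightarrow> (real \<Rightarrow> 'a) topology" where
  "path_space_over X A = subtopology (path_space X) {\<sigma>. (\<sigma> 0, \<sigma> 1) \<in> A}"

definition has_motion_planner :: "'a topology \<Rightarrow> ('a \<times> 'a) set \<Rightarrow> ('a \<times> 'a) set \<Rightarrow> bool" where
  "has_motion_planner X A U \<longleftrightarrow>
     (\<exists>s. continuous_map (subtopology (prod_topology X X) U) (path_space_over X A) s \<and>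
          (\<forall>(x, y) \<in> U. s (x, y) 0 = x \<and> s (x, y) 1 = y))"

text \<open>The infimum of the empty set in \<^typ>\<open>enat\<close> is \<open>\<infinity>\<close>; otherwise it is the minimum.\<close>

definition TC :: "'a topology \<Rightarrow> ('a \<times> 'a) set \<Rightarrow> enat" where
  "TC X A = Inf {enat k | k. \<exists>U :: nat \<Rightarrow> ('a \<times> 'a) set.
      (\<forall>i<k. openin (subtopology (prod_topology X X) A) (U i) \<and> has_motion_planner X A (U i)) \<and>
      (\<Union>i<k. U i) = A}"

definition disc :: "nat \<Rightarrow> (nat \<Rightarrow> real) set" where
  "disc n = {x \<in> topspace (Euclidean_space n). (\<Sum>i<n. x i ^ 2) \<le> 1}"

definition open_disc :: "nat \<Rightarrow> (nat \<Rightarrow> real) set" where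
  "open_disc n = {x \<in> topspace (Euclidean_space n). (\<Sum>i<n. x i ^ 2) < 1}"

text \<open>For \<open>n = 0\<close> the disc is a point and its boundary is empty.\<close>

definition disc_boundary :: "nat \<Rightarrow> (nat \<Rightarrow> real) set" where
  "disc_boundary n = {x \<in> topspace (Euclidean_space n). (\<Sum>i<n. x i ^ 2) = 1}"

text \<open>
  The open cells are recorded as subsets of the space; each has a dimension and a characteristic
  map, and the last two fields are relevant only on the members of \<open>cells\<close>.
\<close>

record 'a cw_data =
  cells :: "'a set set"
  cell_dim :: "'a set \<Rightarrow> nat"
  char_map :: "'a set \<Rightarrow> (nat \<Rightarrow> real) \<Rightarrow> 'a"

text \<open>
  Whitehead's intrinsic definition. In the last clause \<open>Y closure_of e\<close> is the closed cell, which is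
  the image of the closed disc under the characteristic map because \<open>Y\<close> is Hausdorff.
\<close>

definition cw_complex :: "'a topology \<Rightarrow> 'a cw_data \<Rightarrow> bool" where
  "cw_complex Y C \<longleftrightarrow>
     Hausdorff_space Y \<and>
     \<Union>(cells C) = topspace Y \<and>
     disjoint (cells C) \<and>
     (\<forall>e \<in> cells C.
        continuous_map (subtopology (Euclidean_space (cell_dim C e)) (disc (cell_dim C e))) Y
          (char_map C e) \<and>
        homeomorphic_map (subtopology (Euclidean_space (cell_dim C e)) (open_disc (cell_dim C e)))
          (subtopology Y e) (char_map C e) \<and>
        (\<exists>F. finite F \<and> F \<subseteq> cells C \<and> (\<forall>f \<in> F. cell_dim C f < cell_dim C e) \<and>
             char_map C e ` disc_boundary (cell_dim C e) \<subseteq> \<Union>F)) \<and>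
     (\<forall>S \<subseteq> topspace Y. (\<forall>e \<in> cells C. closedin Y (S \<inter> Y closure_of e)) \<longrightarrow> closedin Y S)"

text \<open>The dimension is \<open>\<infinity>\<close> if cell dimensions are unbounded, and \<open>0\<close> for the empty complex.\<close>

definition cw_dim :: "'a cw_data \<Rightarrow> enat" where
  "cw_dim C = (SUP e \<in> cells C. enat (cell_dim C e))"

definition cube :: "nat \<Rightarrow> (nat \<Rightarrow> real) set" where
  "cube n = {x \<in> topspace (Euclidean_space n). \<forall>i<n. 0 \<le> x i \<and> x i \<le> 1}"

definition cube_boundary :: "nat \<Rightarrow> (nat \<Rightarrow> real) set" where
  "cube_boundary n = {x \<in> cube n. \<exists>i<n. x i = 0 \<or> x i = 1}"

definition spheroids :: "nat \<Rightarrow> 'a topology \<Rightarrow> 'a \<Rightarrow> ((nat \<Rightarrow> real) \<Rightarrow> 'a) set" where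
  "spheroids n X x =
     {f. continuous_map (subtopology (Euclidean_space n) (cube n)) X f \<and>
         (\<forall>t \<in> cube_boundary n. f t = x)}"

definition spheroid_homotopy ::
    "nat \<Rightarrow> 'a topology \<Rightarrow> 'a \<Rightarrow> (((nat \<Rightarrow> real) \<Rightarrow> 'a) \<times> ((nat \<Rightarrow> real) \<Rightarrow> 'a)) set" where
  "spheroid_homotopy n X x =
     {(f, g). homotopic_with (\<lambda>h. \<forall>t \<in> cube_boundary n. h t = x)
                (subtopology (Euclidean_space n) (cube n)) X f g}"

lemma equiv_spheroid_homotopy: "equiv (spheroids n X x) (spheroid_homotopy n X x)"
proof (rule equivI)
  show "spheroid_homotopy n X x \<subseteq> spheroids n X x \<times> spheroids n X x"
    by (auto simp: spheroid_homotopy_def spheroids_def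
        dest: homotopic_with_imp_continuous_maps homotopic_with_imp_property)
  show "refl_on (spheroids n X x) (spheroid_homotopy n X x)"
    by (auto simp: refl_on_def spheroid_homotopy_def spheroids_def)
  show "sym (spheroid_homotopy n X x)"
    by (auto simp: sym_def spheroid_homotopy_def homotopic_with_sym)
  show "trans (spheroid_homotopy n X x)"
    unfolding spheroid_homotopy_def by (rule transI) (clarify, rule homotopic_with_trans)
qed

text \<open>
  The underlying set of the \<open>n\<close>-th homotopy group at the base point \<open>x\<close>; for \<open>n = 0\<close> it is the set
  of path components. The group is trivial if and only if this set has exactly one element, so the
  group operation is not needed here.
\<close>

definition homotopy_group :: "nat \<Rightarrow> 'a topology \<Rightarrow> 'a \<Rightarrow> ((nat \<Rightarrow> real) \<Rightarrow> 'a) set set" where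
  "homotopy_group n X x = spheroids n X x // spheroid_homotopy n X x"

definition homotopy_group_vanishes :: "nat \<Rightarrow> 'a topology \<Rightarrow> bool" where
  "homotopy_group_vanishes n X \<longleftrightarrow> (\<forall>x \<in> topspace X. is_singleton (homotopy_group n X x))"

lemma homotopy_group_vanishes_iff:
  "homotopy_group_vanishes n X \<longleftrightarrow>
     (\<forall>x \<in> topspace X. \<forall>f \<in> spheroids n X x. \<forall>g \<in> spheroids n X x.
        homotopic_with (\<lambda>h. \<forall>t \<in> cube_boundary n. h t = x)
          (subtopology (Euclidean_space n) (cube n)) X f g)"
proof -
  have "is_singleton (homotopy_group n X x) \<longleftrightarrow>
      (\<forall>f \<in> spheroids n X x. \<forall>g \<in> spheroids n X x. (f, g) \<in> spheroid_homotopy n X x)"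
    if x: "x \<in> topspace X" for x
  proof
    note eq = equiv_spheroid_homotopy[of n X x]
    show "\<forall>f \<in> spheroids n X x. \<forall>g \<in> spheroids n X x. (f, g) \<in> spheroid_homotopy n X x"
      if "is_singleton (homotopy_group n X x)"
    proof (intro ballI)
      fix f g assume fg: "f \<in> spheroids n X x" "g \<in> spheroids n X x"
      then have "spheroid_homotopy n X x `` {f} \<in> homotopy_group n X x"
        "spheroid_homotopy n X x `` {g} \<in> homotopy_group n X x"
        by (auto simp: homotopy_group_def quotientI)
      with that have "spheroid_homotopy n X x `` {f} = spheroid_homotopy n X x `` {g}"
        by (metis is_singleton_def singletonD)
      then show "(f, g) \<in> spheroid_homotopy n X x"
        using eq_equiv_class[OF _ eq] fg by metis
    qed
    assume all: "\<forall>f \<in> spheroids n X x. \<forall>g \<in> spheroids n X x. (f, g) \<in> spheroid_homotopy n X x"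
    have c: "(\<lambda>_. x) \<in> spheroids n X x"
      using x by (simp add: spheroids_def)
    have "homotopy_group n X x = {spheroid_homotopy n X x `` {\<lambda>_. x}}"
    proof
      show "homotopy_group n X x \<subseteq> {spheroid_homotopy n X x `` {\<lambda>_. x}}"
      proof
        fix c assume "c \<in> homotopy_group n X x"
        then obtain f where "f \<in> spheroids n X x" "c = spheroid_homotopy n X x `` {f}"
          unfolding homotopy_group_def by (rule quotientE)
        moreover from this all \<open>(\<lambda>_. x) \<in> spheroids n X x\<close>
        have "(f, \<lambda>_. x) \<in> spheroid_homotopy n X x"
          by blast
        ultimately show "c \<in> {spheroid_homotopy n X x `` {\<lambda>_. x}}"
          using equiv_class_eq[OF eq] by simp
      qed
      show "{spheroid_homotopy n X x `` {\<lambda>_. x}} \<subseteq> homotopy_group n X x"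
        using c by (simp add: homotopy_group_def quotientI)
    qed
    then show "is_singleton (homotopy_group n X x)"
      by simp
  qed
  then show ?thesis
    by (simp add: homotopy_group_vanishes_def spheroid_homotopy_def)
qed

lemma cube_0: "cube 0 = {\<lambda>_. 0}"
  by (auto simp: cube_def topspace_Euclidean_space)

lemma cube_boundary_0: "cube_boundary 0 = {}"
  by (simp add: cube_boundary_def)

lemma homotopy_group_vanishes_0:
  "homotopy_group_vanishes 0 X \<longleftrightarrow> path_connected_space X"
proof
  let ?o = "\<lambda>_::nat. 0::real"
  let ?P = "subtopology (Euclidean_space 0) (cube 0)"
  have tP: "topspace ?P = {?o}"
    by (auto simp: cube_0 topspace_Euclidean_space)
  show "path_connected_space X" if v: "homotopy_group_vanishes 0 X"
    unfolding path_connected_space_def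
  proof (intro ballI)
    fix x y assume xy: "x \<in> topspace X" "y \<in> topspace X"
    have "(\<lambda>_. x) \<in> spheroids 0 X x" "(\<lambda>_. y) \<in> spheroids 0 X x"
      using xy by (auto simp: spheroids_def cube_boundary_0)
    then have "homotopic_with (\<lambda>h. \<forall>t \<in> cube_boundary 0. h t = x) ?P X (\<lambda>_. x) (\<lambda>_. y)"
      using v xy unfolding homotopy_group_vanishes_iff by blast
    then obtain h where h:
      "continuous_map (prod_topology (subtopology euclideanreal {0..1}) ?P) X h"
      "\<And>t. h (0, t) = x" "\<And>t. h (1, t) = y"
      unfolding homotopic_with_def by auto
    have "pathin X (h \<circ> (\<lambda>r. (r, ?o)))"
      unfolding pathin_def
      by (rule continuous_map_compose[OF _ h(1)])
         (simp add: continuous_map_pairwise o_def cube_0 topspace_Euclidean_space)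
    with h show "\<exists>g. pathin X g \<and> g 0 = x \<and> g 1 = y"
      by (intro exI[of _ "h \<circ> (\<lambda>r. (r, ?o))"]) simp
  qed
  show "homotopy_group_vanishes 0 X" if pc: "path_connected_space X"
    unfolding homotopy_group_vanishes_iff
  proof (intro ballI)
    fix x f g assume "x \<in> topspace X" "f \<in> spheroids 0 X x" "g \<in> spheroids 0 X x"
    then have "f ?o \<in> topspace X" "g ?o \<in> topspace X"
      using tP by (auto simp: spheroids_def dest!: continuous_map_image_subset_topspace)
    then obtain p where p: "pathin X p" "p 0 = f ?o" "p 1 = g ?o"
      using pc unfolding path_connected_space_def by metis
    have "continuous_map (prod_topology (subtopology euclideanreal {0..1}) ?P) X (p \<circ> fst)"
      using p(1) unfolding pathin_def
      by (intro continuous_map_compose[OF continuous_map_fst])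
    then show "homotopic_with (\<lambda>h. \<forall>t \<in> cube_boundary 0. h t = x) ?P X f g"
      using p by (subst homotopic_with) (auto simp: cube_0 cube_boundary_0 intro!: exI[of _ "p \<circ> fst"])
  qed
qed

end

theory Submission
  imports Defs
begin

text \<open>
  Put \<open>q = s + 1\<close>. On a CW complex \<open>Y\<close> of dimension \<open>n\<close> in \<open>X\<close> we construct \<open>k = n div q + 1\<close>
  functions \<open>f i\<close> with maximum \<open>1\<close> at every point, together with homotopies in \<open>X\<close> that contract
  \<open>{f i > 0}\<close> to a base point: a section of the \<open>k\<close>-fold fibrewise join of the path fibration. It is
  extended cell by cell, which is possible because the join of \<open>k\<close> loop spaces is
  \<open>(k q - 2)\<close>-connected. For the extension over a disc of dimension \<open>n < k q\<close>, cover the disc by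
  \<open>n + 1\<close> families of disjoint small convex bricks and give \<open>q\<close> families to each index; \<open>q\<close> families
  form a set of dimension at most \<open>s\<close>, so by \<open>s\<close>-connectedness the null-homotopy given near the
  boundary extends over them, while the old functions are faded out and bump functions of the new
  open sets are faded in.

  For two complexes, with \<open>k1\<close> and \<open>k2\<close> functions, sort the points of \<open>Y1 \<times> Y2\<close> by the sets \<open>R\<close> of
  indices for which the smallest value over \<open>R\<close> exceeds all other values. Sets \<open>R\<close> of equal size
  give disjoint open sets, the sizes from \<open>2\<close> to \<open>k1 + k2\<close> suffice, and
  \<open>n1 div q + n2 div q \<le> (n1 + n2) div q\<close>. Only continuous functions on the factors are used, so it
  does not matter that \<open>Y1 \<times> Y2\<close> need not be a CW complex in the product topology.
\<close>


section \<open>Gluing along a homotopy\<close>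

text \<open>The maximum, and not the sum, is normalised because over \<open>Y1 \<times> Y2\<close>
  the joint list of functions then takes its top value \<open>1\<close> at an index of each factor.
  The set of maximal indices therefore has at least two elements and meets both lists, so size one
  never occurs and one planner is saved. The obstacle in the extension over a disc is that
  homotopies given on the boundary must be kept on the nose, while the null-homotopies found over
  different bricks have no reason to agree where the bricks overlap. They must be connected rel ends
  before they can be glued. This raises the dimension of the cubes to be filled by one, and over the
  overlap the number of brick families drops by one. The sum of the two numbers is what
  \<open>s\<close>-connectedness bounds: comparing null-homotopies means filling squares over the
  \<open>s\<close> remaining families, and \<open>s + 2\<close> is just within reach. Hence one
  index can absorb \<open>s + 1\<close> families.\<close>

lemma continuous_map_top_of_set_compose:
  assumes "continuous_map (top_of_set T) X g" "continuous_on S f" "f ` S \<subseteq> T"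
    and "\<And>x. x \<in> S \<Longrightarrow> h x = g (f x)"
  shows "continuous_map (top_of_set S) X h"
proof -
  have "continuous_map (top_of_set S) (top_of_set T) f"
    using assms(2,3) by (auto simp: continuous_map_in_subtopology)
  then have "continuous_map (top_of_set S) X (g \<circ> f)"
    using assms(1) by (rule continuous_map_compose)
  then show ?thesis
    by (rule continuous_map_eq) (use assms(4) in auto)
qed

lemma continuous_map_top_of_set_subset:
  assumes "continuous_map (top_of_set T) X g" "S \<subseteq> T" "\<And>x. x \<in> S \<Longrightarrow> h x = g x"
  shows "continuous_map (top_of_set S) X h"
  by (rule continuous_map_top_of_set_compose[OF assms(1), of S "\<lambda>x. x"]) (use assms in auto)

lemma continuous_map_top_of_set_cases_le:
  fixes p q :: "'b::topological_space \<Rightarrow> real"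
  assumes "continuous_on S p" "continuous_on S q"
    and "continuous_map (top_of_set {x \<in> S. p x \<le> q x}) X f"
    and "continuous_map (top_of_set {x \<in> S. q x \<le> p x}) X g"
    and "\<And>x. x \<in> S \<Longrightarrow> p x = q x \<Longrightarrow> f x = g x"
  shows "continuous_map (top_of_set S) X (\<lambda>x. if p x \<le> q x then f x else g x)"
proof (rule continuous_map_cases_le)
  have "S \<inter> {x. x \<in> topspace (top_of_set S) \<and> p x \<le> q x} = {x \<in> S. p x \<le> q x}"
    "S \<inter> {x. x \<in> topspace (top_of_set S) \<and> q x \<le> p x} = {x \<in> S. q x \<le> p x}"
    by auto
  then show "continuous_map (subtopology (top_of_set S) {x \<in> topspace (top_of_set S). p x \<le> q x}) X f"
    "continuous_map (subtopology (top_of_set S) {x \<in> topspace (top_of_set S). q x \<le> p x}) X g"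
    using assms(3,4) by (simp_all add: subtopology_subtopology)
qed (use assms in auto)

lemma openin_top_of_set_product:
  assumes "openin (top_of_set S) U"
  shows "openin (top_of_set (S \<times> Q)) (U \<times> Q)"
  using assms by (auto simp: openin_Times)

lemma infdist_eq_0_iff_relclosed:
  assumes "closedin (top_of_set S) A" "A \<noteq> {}" "x \<in> S"
  shows "infdist x A = 0 \<longleftrightarrow> x \<in> A"
proof -
  obtain C where C: "closed C" "A = S \<inter> C"
    using assms(1) by (auto simp: closedin_closed)
  then have "closure A \<subseteq> C" by (simp add: closure_minimal)
  then show ?thesis
    using C assms closure_subset[of A] in_closure_iff_infdist_zero[of A x] by auto
qed

text \<open>A Urysohn function built from the distances to \<open>Z - V\<close> and
  \<open>V - Z\<close> supplies the time at which \<open>K\<close> is read. By the last conclusion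
  every value over the overlap is a value of \<open>K\<close>, so whatever \<open>K\<close> keeps
  fixed, such as boundary data, stays fixed in \<open>G\<close>.\<close>

lemma glue_along_homotopy:
  fixes Z V :: "'b::metric_space set" and Q :: "'c::topological_space set"
  assumes oZ: "openin (top_of_set (Z \<union> V)) Z" and oV: "openin (top_of_set (Z \<union> V)) V"
    and h: "continuous_map (top_of_set (Z \<times> Q)) X h"
    and e: "continuous_map (top_of_set (V \<times> Q)) X e"
    and K: "continuous_map (top_of_set ((Z \<inter> V) \<times> Q \<times> {0..1::real})) X K"
    and K0: "\<And>x t. x \<in> Z \<inter> V \<Longrightarrow> t \<in> Q \<Longrightarrow> K (x, t, 0) = h (x, t)"
    and K1: "\<And>x t. x \<in> Z \<inter> V \<Longrightarrow> t \<in> Q \<Longrightarrow> K (x, t, 1) = e (x, t)"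
  obtains G where "continuous_map (top_of_set ((Z \<union> V) \<times> Q)) X G"
    "\<And>x t. x \<in> Z - V \<Longrightarrow> t \<in> Q \<Longrightarrow> G (x, t) = h (x, t)"
    "\<And>x t. x \<in> V - Z \<Longrightarrow> t \<in> Q \<Longrightarrow> G (x, t) = e (x, t)"
    "\<And>x t. x \<in> Z \<inter> V \<Longrightarrow> t \<in> Q \<Longrightarrow> \<exists>r\<in>{0..1}. G (x, t) = K (x, t, r)"
proof (cases "Z - V = {} \<or> V - Z = {}")
  \<comment> \<open>\<open>infdist\<close> to the empty set is \<open>0\<close>, so the quotient of
    distances used below would not separate the two sides; here \<open>e\<close> or \<open>h\<close>
    alone is the answer.\<close>
  case True
  then show thesis
  proof
    assume "Z - V = {}"
    then have "Z \<union> V = V" by auto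
    with e K1 \<open>Z - V = {}\<close> show thesis by (intro that[of e]) (auto intro!: bexI[of _ 1])
  next
    assume "V - Z = {}"
    then have "Z \<union> V = Z" by auto
    with h K0 \<open>V - Z = {}\<close> show thesis by (intro that[of h]) (auto intro!: bexI[of _ 0])
  qed
next
  case False
  define S where "S = Z \<union> V"
  define a where "a x = infdist x (Z - V)" for x
  define b where "b x = infdist x (V - Z)" for x
  have clA: "closedin (top_of_set S) (Z - V)" and clB: "closedin (top_of_set S) (V - Z)"
  proof -
    have "Z - V = (Z \<union> V) - V" "V - Z = (Z \<union> V) - Z" by auto
    then show "closedin (top_of_set S) (Z - V)" "closedin (top_of_set S) (V - Z)"
      using oZ oV unfolding S_def by (metis closedin_diff closedin_topspace topspace_euclidean_subtopology)+
  qed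
  have a0: "a x = 0 \<longleftrightarrow> x \<in> Z - V" and b0: "b x = 0 \<longleftrightarrow> x \<in> V - Z" if "x \<in> S" for x
    using False that infdist_eq_0_iff_relclosed[OF clA] infdist_eq_0_iff_relclosed[OF clB]
    by (simp_all add: a_def b_def)
  have pos: "a x + b x > 0" if "x \<in> S" for x
    using a0[OF that] b0[OF that] infdist_nonneg[of x "Z - V"] infdist_nonneg[of x "V - Z"]
    by (auto simp: a_def b_def add_nonneg_eq_0_iff order_less_le)
  have ca: "continuous_on S a" and cb: "continuous_on S b"
    unfolding a_def b_def by (intro continuous_intros)+
  define \<phi> where "\<phi> x = a x / (a x + b x)" for x
  have c\<phi>: "continuous_on S \<phi>"
    unfolding \<phi>_def using pos by (intro continuous_intros ca cb) (auto simp: less_le)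
  have \<phi>0: "\<phi> x = 0" if "x \<in> Z - V" for x
    using that a0[of x] by (auto simp: \<phi>_def S_def)
  have \<phi>1: "\<phi> x = 1" if "x \<in> V - Z" for x
    using that b0[of x] pos[of x] by (auto simp: \<phi>_def S_def)
  \<comment> \<open>The plateaus \<open>l = 0\<close> for \<open>\<phi> \<le> 1/3\<close> and
    \<open>l = 1\<close> for \<open>\<phi> \<ge> 2/3\<close> make \<open>G\<close> coincide with
    \<open>h\<close> and \<open>e\<close> on open sets around \<open>Z - V\<close> and
    \<open>V - Z\<close>, so that three open pieces can be pasted.\<close>
  define l where "l x = max 0 (min 1 (3 * \<phi> x - 1))" for x
  have cl: "continuous_on S l"
    unfolding l_def by (intro continuous_intros c\<phi>)
  have l01: "l x \<in> {0..1}" for x by (auto simp: l_def)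
  define T where "T i = (if i = (0::nat) then {x \<in> S. \<phi> x < 1/3} else if i = 1 then {x \<in> S. \<phi> x > 2/3}
    else Z \<inter> V)" for i
  define f where "f i = (if i = (0::nat) then h else if i = 1 then e else (\<lambda>(x,t). K (x, t, l x)))" for i
  define G where "G = (\<lambda>(x,t). if x \<in> Z \<inter> V then K (x, t, l x) else if x \<in> Z then h (x, t) else e (x,t))"
  have T0: "T 0 \<subseteq> Z" and T1: "T 1 \<subseteq> V"
    using \<phi>0 \<phi>1 by (auto simp: T_def S_def; force)+
  have T2: "T 2 = Z \<inter> V" by (simp add: T_def)
  have oT: "openin (top_of_set S) (T i)" if "i \<in> {0,1,2}" for i
  proof -
    have "openin (top_of_set S) (S \<inter> \<phi> -` {..<1/3})" "openin (top_of_set S) (S \<inter> \<phi> -` {2/3<..})"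
      using c\<phi> by (auto simp: continuous_openin_preimage_gen)
    moreover have "S \<inter> \<phi> -` {..<1/3} = T 0" "S \<inter> \<phi> -` {2/3<..} = T 1" by (auto simp: T_def)
    moreover have "openin (top_of_set S) (T 2)" using oZ oV by (auto simp: T2 S_def)
    ultimately show ?thesis using that by auto
  qed
  have G: "continuous_map (top_of_set (S \<times> Q)) X G"
  proof (rule pasting_lemma[where I = "{0,1,2::nat}" and T = "\<lambda>i. T i \<times> Q" and f = f])
    show "openin (top_of_set (S \<times> Q)) (T i \<times> Q)" if "i \<in> {0,1,2}" for i
      by (rule openin_top_of_set_product) (rule oT[OF that])
    show "continuous_map (subtopology (top_of_set (S \<times> Q)) (T i \<times> Q)) X (f i)" if "i \<in> {0,1,2}" for i
    proof -
      have sub: "T i \<subseteq> S" using oT[OF that] by (rule openin_imp_subset)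
      then have "(S \<times> Q) \<inter> (T i \<times> Q) = T i \<times> Q" by auto
      moreover have "continuous_map (top_of_set (T i \<times> Q)) X (f i)"
      proof -
        consider "i = 0" | "i = 1" | "i = 2" using \<open>i \<in> {0, 1, 2}\<close> by blast
        then show ?thesis
        proof cases
          case 1
          with T0 show ?thesis by (intro continuous_map_top_of_set_subset[OF h]) (auto simp: f_def)
        next
          case 2
          with T1 show ?thesis by (intro continuous_map_top_of_set_subset[OF e]) (auto simp: f_def)
        next
          case 3
          have "continuous_on (T 2 \<times> Q) (\<lambda>(x,t). (x, t, l x))"
            unfolding case_prod_unfold
            by (intro continuous_intros continuous_on_compose2[OF cl]) (auto simp: T2 S_def)
          then show ?thesis unfolding 3
            by (rule continuous_map_top_of_set_compose[OF K]) (use l01 in \<open>auto simp: T2 f_def\<close>)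
        qed
      qed
      ultimately show ?thesis by (simp add: subtopology_subtopology)
    qed
    show "f i x = f j x" if "i \<in> {0, 1, 2}" "j \<in> {0, 1, 2}"
      "x \<in> topspace (top_of_set (S \<times> Q)) \<inter> T i \<times> Q \<inter> T j \<times> Q" for i j x
    proof -
      obtain y t where x: "x = (y, t)" by force
      have "f 0 (y,t) = f 2 (y,t)" if "y \<in> T 0 \<inter> T 2" "t \<in> Q"
        using that K0[of y t] by (auto simp: T_def f_def l_def)
      moreover have "f 1 (y,t) = f 2 (y,t)" if "y \<in> T 1 \<inter> T 2" "t \<in> Q"
        using that K1[of y t] by (auto simp: T_def f_def l_def)
      moreover have "T 0 \<inter> T 1 = {}" by (auto simp: T_def)
      ultimately show ?thesis using that unfolding x by auto
    qed
    show "\<exists>j. j \<in> {0, 1, 2} \<and> x \<in> T j \<times> Q \<and> G x = f j x" if x: "x \<in> topspace (top_of_set (S \<times> Q))" for x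
    proof -
      obtain y t where y: "x = (y, t)" "y \<in> S" "t \<in> Q" using x by force
      consider "y \<in> Z \<inter> V" | "y \<in> Z - V" | "y \<in> V - Z" using y by (auto simp: S_def)
      then show ?thesis
      proof cases
        case 1 then show ?thesis using y by (intro exI[of _ 2]) (auto simp: T2 f_def G_def)
      next
        case 2 then show ?thesis using y \<phi>0[OF 2] by (intro exI[of _ 0]) (auto simp: T_def f_def G_def)
      next
        case 3 then show ?thesis using y \<phi>1[OF 3] by (intro exI[of _ 1]) (auto simp: T_def f_def G_def)
      qed
    qed
  qed
  show thesis
    by (rule that[of G]) (use G l01 in \<open>auto simp: G_def S_def intro!: bexI[of _ "l _"]\<close>)
qed

section \<open>Filling cubes over families of bricks\<close>

definition segment_closed :: "(nat \<Rightarrow> real) set \<Rightarrow> bool" where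
  "segment_closed B \<longleftrightarrow>
     (\<forall>x\<in>B. \<forall>y\<in>B. \<forall>r\<in>{0..1}. (\<lambda>i. (1 - r) * x i + r * y i) \<in> B)"

definition brick_family :: "(nat \<Rightarrow> real) set \<Rightarrow> (nat \<Rightarrow> real) set set \<Rightarrow> bool" where
  "brick_family Z F \<longleftrightarrow> disjoint F \<and> (\<forall>B\<in>F. openin (top_of_set Z) B \<and> segment_closed B)"

text \<open>The base-point-free form of connectedness, with an index shift: \<open>p = j + 1\<close>
  corresponds to the \<open>j\<close>-th homotopy group, and for \<open>p = 0\<close> the boundary
  is empty, so that the condition says that \<open>X\<close> is nonempty.\<close>

definition fills_cubes :: "nat \<Rightarrow> 'a topology \<Rightarrow> bool" where
  "fills_cubes p X \<longleftrightarrow>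
     (\<forall>g. continuous_map (top_of_set (cube_boundary p)) X g \<longrightarrow>
       (\<exists>G. continuous_map (top_of_set (cube p)) X G \<and> (\<forall>t\<in>cube_boundary p. G t = g t)))"

text \<open>The parameter space lets null-homotopies over \<open>Z\<close> (\<open>p = 1\<close>)
  and homotopies rel ends between them (\<open>p = 2\<close>) be produced by one and the same
  induction.\<close>

definition fills_cubes_over :: "nat \<Rightarrow> 'a topology \<Rightarrow> (nat \<Rightarrow> real) set \<Rightarrow> bool" where
  "fills_cubes_over p X Z \<longleftrightarrow>
     (\<forall>g. continuous_map (top_of_set (Z \<times> cube_boundary p)) X g \<longrightarrow>
       (\<exists>G. continuous_map (top_of_set (Z \<times> cube p)) X G \<and>
            (\<forall>x\<in>Z. \<forall>t\<in>cube_boundary p. G (x, t) = g (x, t))))"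

section \<open>The cube as the unit ball of the sup norm around its centre\<close>

primrec sup_norm :: "nat \<Rightarrow> (nat \<Rightarrow> real) \<Rightarrow> real" where
  "sup_norm 0 v = 0"
| "sup_norm (Suc p) v = max (sup_norm p v) \<bar>v p\<bar>"

lemma sup_norm_nonneg [simp]: "0 \<le> sup_norm p v"
  by (induction p) auto

lemma sup_norm_ge: "i < p \<Longrightarrow> \<bar>v i\<bar> \<le> sup_norm p v"
  by (induction p) (auto simp: less_Suc_eq le_max_iff_disj)

lemma sup_norm_le_iff: "0 \<le> c \<Longrightarrow> sup_norm p v \<le> c \<longleftrightarrow> (\<forall>i<p. \<bar>v i\<bar> \<le> c)"
  by (induction p) (auto simp: less_Suc_eq)

lemma sup_norm_less_iff: "0 < c \<Longrightarrow> sup_norm p v < c \<longleftrightarrow> (\<forall>i<p. \<bar>v i\<bar> < c)"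
  by (induction p) (auto simp: less_Suc_eq)

lemma sup_norm_cong: "(\<And>i. i < p \<Longrightarrow> v i = w i) \<Longrightarrow> sup_norm p v = sup_norm p w"
  by (induction p) auto

lemma sup_norm_scale: "sup_norm p (\<lambda>i. c * v i) = \<bar>c\<bar> * sup_norm p v"
  by (induction p) (auto simp: abs_mult max_mult_distrib_left)

lemma sup_norm_eq_0_iff: "sup_norm p v = 0 \<longleftrightarrow> (\<forall>i<p. v i = 0)"
  using sup_norm_le_iff[of 0 p v] by (simp add: order_antisym_conv[OF sup_norm_nonneg])

lemma continuous_on_sup_norm [continuous_intros]:
  "(\<And>i. i < p \<Longrightarrow> continuous_on S (\<lambda>x. f x i)) \<Longrightarrow> continuous_on S (\<lambda>x. sup_norm p (f x))"
  by (induction p) (auto intro!: continuous_intros)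

lemma continuous_on_coordinate:
  fixes f :: "'b::topological_space \<Rightarrow> nat \<Rightarrow> real"
  shows "continuous_on S f \<Longrightarrow> continuous_on S (\<lambda>x. f x i)"
  by (rule continuous_on_product_then_coordinatewise)

lemma continuous_on_pair_coordinate [continuous_intros]:
  fixes f :: "'b::topological_space \<Rightarrow> (nat \<Rightarrow> real) \<times> 'c::topological_space"
    and g :: "'b \<Rightarrow> 'c \<times> (nat \<Rightarrow> real)"
  shows "continuous_on S f \<Longrightarrow> continuous_on S (\<lambda>x. fst (f x) i)"
    "continuous_on S g \<Longrightarrow> continuous_on S (\<lambda>x. snd (g x) i)"
  by (intro continuous_on_coordinate continuous_on_fst continuous_on_snd; assumption)+

text \<open>Inverse to \<open>centred\<close>, with a dilation built in:
  \<open>recentre p c (centred t)\<close> is \<open>t\<close> stretched by the factor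
  \<open>c\<close> from the centre of the cube. Coordinates from \<open>p\<close> on are cut off, as
  points of the cube vanish there.\<close>

definition recentre :: "nat \<Rightarrow> real \<Rightarrow> (nat \<Rightarrow> real) \<Rightarrow> nat \<Rightarrow> real" where
  "recentre p c v = (\<lambda>i. if i < p then 1/2 + c * v i / 2 else 0)"

definition centred :: "(nat \<Rightarrow> real) \<Rightarrow> nat \<Rightarrow> real" where
  "centred t = (\<lambda>i. 2 * t i - 1)"

lemma cube_iff: "t \<in> cube p \<longleftrightarrow> (\<forall>i\<ge>p. t i = 0) \<and> sup_norm p (centred t) \<le> 1"
proof -
  have "\<bar>2 * r - 1\<bar> \<le> 1 \<longleftrightarrow> 0 \<le> r \<and> r \<le> 1" for r :: real
    by (auto simp: abs_le_iff)
  then show ?thesis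
    by (simp add: cube_def centred_def topspace_Euclidean_space sup_norm_le_iff)
qed

lemma cube_boundary_iff: "t \<in> cube_boundary p \<longleftrightarrow> (\<forall>i\<ge>p. t i = 0) \<and> sup_norm p (centred t) = 1"
proof -
  have "\<bar>2 * r - 1\<bar> < 1 \<longleftrightarrow> 0 < r \<and> r < 1" for r :: real
    by (auto simp: abs_less_iff)
  then have "sup_norm p (centred t) < 1 \<longleftrightarrow> (\<forall>i<p. 0 < t i \<and> t i < 1)"
    by (simp add: sup_norm_less_iff centred_def)
  moreover have "(\<forall>i<p. 0 < t i \<and> t i < 1) \<longleftrightarrow> \<not> (\<exists>i<p. t i = 0 \<or> t i = 1)" if "t \<in> cube p"
    using that unfolding cube_def by (metis (lifting) linorder_not_le mem_Collect_eq order_le_less)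
  ultimately show ?thesis
    unfolding cube_boundary_def by (auto simp: cube_iff)
qed

lemma sup_norm_recentre: "sup_norm p (centred (recentre p c v)) = \<bar>c\<bar> * sup_norm p v"
  by (subst sup_norm_scale[symmetric], rule sup_norm_cong) (auto simp: recentre_def centred_def)

lemma recentre_outside [simp]: "p \<le> i \<Longrightarrow> recentre p c v i = 0"
  by (simp add: recentre_def)

lemma recentre_centred: "(\<And>i. i \<ge> p \<Longrightarrow> t i = 0) \<Longrightarrow> recentre p 1 (centred t) = t"
  by (auto simp: recentre_def centred_def fun_eq_iff diff_divide_distrib)

lemma continuous_on_recentre [continuous_intros]:
  assumes "continuous_on S c" "\<And>i. i < p \<Longrightarrow> continuous_on S (\<lambda>x. v x i)"
  shows "continuous_on S (\<lambda>x. recentre p (c x) (v x))"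
  unfolding recentre_def
proof (rule continuous_on_coordinatewise_then_product)
  show "continuous_on S (\<lambda>x. if i < p then 1/2 + c x * v x i / 2 else 0)" for i
  proof (cases "i < p")
    case True
    then have "continuous_on S (\<lambda>x. 1/2 + c x * v x i / 2)"
      using assms(2)[OF True] by (intro continuous_on_add continuous_on_mult continuous_on_divide
        continuous_on_const assms(1)) auto
    with True show ?thesis by simp
  qed simp
qed

lemma continuous_on_centred [continuous_intros]:
  "continuous_on S f \<Longrightarrow> continuous_on S (\<lambda>x. centred (f x) i)"
  unfolding centred_def
  by (intro continuous_on_diff continuous_on_mult_left continuous_on_const) (rule continuous_on_coordinate)

section \<open>Filling cubes over one brick, one family and several families\<close>

lemma fills_cubes_over_empty: "fills_cubes_over p X {}"
  by (simp add: fills_cubes_over_def)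

text \<open>\<open>B\<close> contracts along segments to a point \<open>b\<close>. The inner half of
  every cube carries one filling \<open>w\<close> chosen over \<open>b\<close>; across the outer
  shell the parameter slides from \<open>b\<close> back to \<open>x\<close>.\<close>

lemma fills_cubes_over_segment_closed:
  assumes B: "segment_closed B" and fill: "fills_cubes p X"
  shows "fills_cubes_over p X B"
proof (cases "B = {}")
  case False
  then obtain b where b: "b \<in> B" by auto
  show ?thesis
    unfolding fills_cubes_over_def
  proof (intro allI impI)
    fix g assume g: "continuous_map (top_of_set (B \<times> cube_boundary p)) X g"
    have "continuous_map (top_of_set (cube_boundary p)) X (\<lambda>t. g (b, t))"
      by (rule continuous_map_top_of_set_compose[OF g, of _ "\<lambda>t. (b, t)"])
         (auto intro: continuous_on_Pair continuous_on_const continuous_on_id simp: b)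
    then obtain w where w: "continuous_map (top_of_set (cube p)) X w"
      and wg: "\<And>t. t \<in> cube_boundary p \<Longrightarrow> w t = g (b, t)"
      using fill unfolding fills_cubes_def by blast
    define \<rho> where "\<rho> t = sup_norm p (centred t)" for t
    \<comment> \<open>The slide parameter \<open>2 - 2 * \<rho>\<close> is \<open>1\<close> at
      \<open>\<rho> = 1/2\<close>, where the value is that of \<open>w\<close> on the boundary, and
      \<open>0\<close> at \<open>\<rho> = 1\<close>, where it is \<open>g (x, t)\<close>. In the
      shell \<open>g\<close> is read at the radial projection of \<open>t\<close> to the
      boundary.\<close>
    define G where "G = (\<lambda>z. if \<rho> (snd z) \<le> 1/2 then w (recentre p 2 (centred (snd z)))
      else g ((\<lambda>i. (1 - (2 - 2 * \<rho> (snd z))) * fst z i + (2 - 2 * \<rho> (snd z)) * b i),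
              recentre p (1 / \<rho> (snd z)) (centred (snd z))))"
    have c\<rho>: "continuous_on S (\<lambda>z. \<rho> (snd z))" for S :: "((nat \<Rightarrow> real) \<times> (nat \<Rightarrow> real)) set"
      unfolding \<rho>_def by (intro continuous_on_sup_norm continuous_on_centred continuous_on_snd continuous_on_id)
    have cc: "continuous_on S (\<lambda>z. centred (snd z) i)" for S :: "((nat \<Rightarrow> real) \<times> (nat \<Rightarrow> real)) set" and i
      by (intro continuous_on_centred continuous_on_snd continuous_on_id)
    have "continuous_map (top_of_set (B \<times> cube p)) X G"
      unfolding G_def
    proof (rule continuous_map_top_of_set_cases_le)
      show "continuous_map (top_of_set {z \<in> B \<times> cube p. \<rho> (snd z) \<le> 1/2}) X
              (\<lambda>z. w (recentre p 2 (centred (snd z))))"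
        by (rule continuous_map_top_of_set_compose[OF w, where f = "\<lambda>z. recentre p 2 (centred (snd z))"])
           (auto intro!: continuous_on_recentre continuous_on_const cc simp: cube_iff sup_norm_recentre \<rho>_def)
      let ?S = "{z \<in> B \<times> cube p. 1/2 \<le> \<rho> (snd z)}"
      have "continuous_on ?S (\<lambda>z. (\<lambda>i. (1 - (2 - 2 * \<rho> (snd z))) * fst z i + (2 - 2 * \<rho> (snd z)) * b i))"
        by (rule continuous_on_coordinatewise_then_product) (intro continuous_intros c\<rho> continuous_on_id)
      moreover have "continuous_on ?S (\<lambda>z. recentre p (1 / \<rho> (snd z)) (centred (snd z)))"
        by (intro continuous_on_recentre continuous_on_divide continuous_on_const cc c\<rho>) auto
      ultimately have cont: "continuous_on ?S (\<lambda>z.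
           ((\<lambda>i. (1 - (2 - 2 * \<rho> (snd z))) * fst z i + (2 - 2 * \<rho> (snd z)) * b i),
              recentre p (1 / \<rho> (snd z)) (centred (snd z))))"
        by (rule continuous_on_Pair)
      show "continuous_map (top_of_set ?S) X
          (\<lambda>z. g ((\<lambda>i. (1 - (2 - 2 * \<rho> (snd z))) * fst z i + (2 - 2 * \<rho> (snd z)) * b i),
              recentre p (1 / \<rho> (snd z)) (centred (snd z))))"
      proof (rule continuous_map_top_of_set_compose[OF g cont _ refl], rule image_subsetI)
        fix z assume z: "z \<in> ?S"
        then have "(\<lambda>i. (1 - (2 - 2 * \<rho> (snd z))) * fst z i + (2 - 2 * \<rho> (snd z)) * b i) \<in> B"
          using B[unfolded segment_closed_def, rule_format, OF _ b, of "fst z" "2 - 2 * \<rho> (snd z)"]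
          by (auto simp: cube_iff \<rho>_def)
        moreover have "recentre p (1 / \<rho> (snd z)) (centred (snd z)) \<in> cube_boundary p"
          using z by (auto simp: cube_boundary_iff sup_norm_recentre \<rho>_def)
        ultimately show "((\<lambda>i. (1 - (2 - 2 * \<rho> (snd z))) * fst z i + (2 - 2 * \<rho> (snd z)) * b i),
              recentre p (1 / \<rho> (snd z)) (centred (snd z))) \<in> B \<times> cube_boundary p" by simp
      qed
      show "w (recentre p 2 (centred (snd z))) = g ((\<lambda>i. (1 - (2 - 2 * \<rho> (snd z))) * fst z i + (2 - 2 * \<rho> (snd z)) * b i),
              recentre p (1 / \<rho> (snd z)) (centred (snd z)))" if "\<rho> (snd z) = 1/2" for z
      proof -
        have "recentre p 2 (centred (snd z)) \<in> cube_boundary p"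
          using that by (simp add: \<rho>_def cube_boundary_iff sup_norm_recentre)
        then show ?thesis unfolding that using wg by simp
      qed
    qed (intro c\<rho> continuous_on_const)+
    moreover have "G (x, t) = g (x, t)" if "t \<in> cube_boundary p" for x t
      using that by (simp add: G_def \<rho>_def cube_boundary_iff recentre_centred)
    ultimately show "\<exists>G. continuous_map (top_of_set (B \<times> cube p)) X G \<and>
            (\<forall>x\<in>B. \<forall>t\<in>cube_boundary p. G (x, t) = g (x, t))" by blast
  qed
qed (simp add: fills_cubes_over_empty)

text \<open>The bricks of one family are disjoint and open in their union, so fillings chosen
  independently over them form one continuous map.\<close>

lemma fills_cubes_over_brick_family:
  assumes F: "brick_family (\<Union>F) F" and fill: "fills_cubes p X"
  shows "fills_cubes_over p X (\<Union>F)"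
  unfolding fills_cubes_over_def
proof (intro allI impI)
  fix g assume g: "continuous_map (top_of_set (\<Union>F \<times> cube_boundary p)) X g"
  have "\<exists>G. continuous_map (top_of_set (B \<times> cube p)) X G \<and>
            (\<forall>x\<in>B. \<forall>t\<in>cube_boundary p. G (x, t) = g (x, t))" if "B \<in> F" for B
  proof -
    have "continuous_map (top_of_set (B \<times> cube_boundary p)) X g"
      by (rule continuous_map_top_of_set_subset[OF g]) (use that in auto)
    moreover have "fills_cubes_over p X B"
      using F that fill by (intro fills_cubes_over_segment_closed) (auto simp: brick_family_def)
    ultimately show ?thesis by (auto simp: fills_cubes_over_def)
  qed
  then obtain G where G: "\<And>B. B \<in> F \<Longrightarrow> continuous_map (top_of_set (B \<times> cube p)) X (G B)"
    and Gg: "\<And>B x t. B \<in> F \<Longrightarrow> x \<in> B \<Longrightarrow> t \<in> cube_boundary p \<Longrightarrow> G B (x, t) = g (x, t)"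
    by metis
  obtain H where H: "continuous_map (top_of_set (\<Union>F \<times> cube p)) X H"
    and HG: "\<And>z B. B \<in> F \<Longrightarrow> z \<in> topspace (top_of_set (\<Union>F \<times> cube p)) \<inter> B \<times> cube p \<Longrightarrow> H z = G B z"
  proof (rule pasting_lemma_exists[where I = F and T = "\<lambda>B. B \<times> cube p" and f = G])
    show "openin (top_of_set (\<Union>F \<times> cube p)) (B \<times> cube p)" if "B \<in> F" for B
      using F that by (intro openin_top_of_set_product) (auto simp: brick_family_def)
    show "continuous_map (subtopology (top_of_set (\<Union>F \<times> cube p)) (B \<times> cube p)) X (G B)" if "B \<in> F" for B
    proof -
      have "(\<Union>F \<times> cube p) \<inter> (B \<times> cube p) = B \<times> cube p" using that by auto
      then show ?thesis using G[OF that] by (simp add: subtopology_subtopology)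
    qed
    show "G A z = G B z" if "A \<in> F" "B \<in> F" "z \<in> topspace (top_of_set (\<Union>F \<times> cube p)) \<inter> A \<times> cube p \<inter> B \<times> cube p" for A B z
    proof -
      have "A = B" using F that by (auto simp: brick_family_def disjoint_def)
      then show ?thesis by simp
    qed
  qed auto
  have "H (x, t) = g (x, t)" if "x \<in> \<Union>F" "t \<in> cube_boundary p" for x t
  proof -
    obtain B where B: "B \<in> F" "x \<in> B" using \<open>x \<in> \<Union>F\<close> by auto
    then show ?thesis using HG[of B "(x,t)"] Gg[of B x t] that by (auto simp: cube_boundary_def)
  qed
  with H show "\<exists>G. continuous_map (top_of_set (\<Union>F \<times> cube p)) X G \<and>
            (\<forall>x\<in>\<Union>F. \<forall>t\<in>cube_boundary p. G (x, t) = g (x, t))" by blast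
qed

lemma brick_family_mono:
  assumes "brick_family Z F" "\<Union>F \<subseteq> W" "W \<subseteq> Z"
  shows "brick_family W F"
  using assms unfolding brick_family_def by (meson Sup_le_iff openin_subset_trans)

lemma brick_family_subset: "brick_family Z F \<Longrightarrow> F' \<subseteq> F \<Longrightarrow> brick_family Z F'"
  by (auto simp: brick_family_def disjoint_def)

lemma segment_closed_Int: "segment_closed A \<Longrightarrow> segment_closed B \<Longrightarrow> segment_closed (A \<inter> B)"
  by (auto simp: segment_closed_def)

lemma brick_family_Int:
  assumes "brick_family Z F" "brick_family Z F'"
  shows "brick_family Z ((\<lambda>(A, B). A \<inter> B) ` (F \<times> F'))"
  unfolding brick_family_def
proof (intro conjI ballI)
  show "disjoint ((\<lambda>(A, B). A \<inter> B) ` (F \<times> F'))"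
    unfolding disjoint_def
  proof (intro ballI impI)
    fix C C' assume "C \<in> (\<lambda>(A, B). A \<inter> B) ` (F \<times> F')" "C' \<in> (\<lambda>(A, B). A \<inter> B) ` (F \<times> F')" "C \<noteq> C'"
    then obtain A B A' B' where *: "C = A \<inter> B" "C' = A' \<inter> B'" "A \<in> F" "A' \<in> F" "B \<in> F'" "B' \<in> F'"
      by auto
    with \<open>C \<noteq> C'\<close> have "A \<noteq> A' \<or> B \<noteq> B'" by auto
    with * assms have "A \<inter> A' = {} \<or> B \<inter> B' = {}"
      unfolding brick_family_def disjoint_def by blast
    with * show "C \<inter> C' = {}" by auto
  qed
  fix C assume "C \<in> (\<lambda>(A, B). A \<inter> B) ` (F \<times> F')"
  then obtain A B where "C = A \<inter> B" "A \<in> F" "B \<in> F'" by auto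
  with assms show "openin (top_of_set Z) C" "segment_closed C"
    by (auto simp: brick_family_def intro!: segment_closed_Int openin_Int)
qed

lemma continuous_on_fun_upd:
  fixes f :: "'b::topological_space \<Rightarrow> nat \<Rightarrow> real"
  assumes f: "continuous_on S f" and c: "continuous_on S c"
  shows "continuous_on S (\<lambda>z. (f z)(p := c z))"
proof (rule continuous_on_coordinatewise_then_product)
  show "continuous_on S (\<lambda>z. ((f z)(p := c z)) i)" for i
    using continuous_on_coordinate[OF f, of i] c by (cases "i = p") auto
qed

lemma cube_Suc_iff: "t \<in> cube (Suc p) \<longleftrightarrow> t(p := 0) \<in> cube p \<and> 0 \<le> t p \<and> t p \<le> 1"
proof
  assume "t \<in> cube (Suc p)"
  then have "t i = 0" if "Suc p \<le> i" for i
    using that by (simp add: cube_def topspace_Euclidean_space)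
  moreover have "0 \<le> t i \<and> t i \<le> 1" if "i \<le> p" for i
    using that \<open>t \<in> cube (Suc p)\<close> by (simp add: cube_def)
  ultimately show "t(p := 0) \<in> cube p \<and> 0 \<le> t p \<and> t p \<le> 1"
    by (simp add: cube_def topspace_Euclidean_space)
next
  assume *: "t(p := 0) \<in> cube p \<and> 0 \<le> t p \<and> t p \<le> 1"
  have "t i = 0" if "Suc p \<le> i" for i
    using * that by (auto simp: cube_def topspace_Euclidean_space dest: spec[of _ i])
  moreover have "0 \<le> t i \<and> t i \<le> 1" if "i < Suc p" for i
    using * that by (cases "i = p") (auto simp: cube_def dest: spec[of _ i])
  ultimately show "t \<in> cube (Suc p)"
    by (simp add: cube_def topspace_Euclidean_space)
qed

lemma cube_boundary_Suc_iff:
  "t \<in> cube_boundary (Suc p) \<longleftrightarrow> t \<in> cube (Suc p) \<and> (t(p := 0) \<in> cube_boundary p \<or> t p = 0 \<or> t p = 1)"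
proof -
  have "(\<exists>i<Suc p. t i = 0 \<or> t i = 1) \<longleftrightarrow> (\<exists>i<p. t i = 0 \<or> t i = 1) \<or> t p = 0 \<or> t p = 1"
    using less_Suc_eq by auto
  moreover have "(\<exists>i<p. (t(p := 0)) i = 0 \<or> (t(p := 0)) i = 1) \<longleftrightarrow> (\<exists>i<p. t i = 0 \<or> t i = 1)"
    by (rule ex_cong1) auto
  ultimately show ?thesis
    unfolding cube_boundary_def mem_Collect_eq cube_Suc_iff by blast
qed

lemma fills_cubes_overE:
  assumes "fills_cubes_over p X Z" "continuous_map (top_of_set (Z \<times> cube_boundary p)) X g"
  obtains G where "continuous_map (top_of_set (Z \<times> cube p)) X G"
    "\<And>x t. x \<in> Z \<Longrightarrow> t \<in> cube_boundary p \<Longrightarrow> G (x, t) = g (x, t)"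
  using assms unfolding fills_cubes_over_def by blast

text \<open>\<open>h\<close> on the bottom, \<open>e\<close> on the top and their common values on
  the sides form a map on the boundary of the cube of one dimension more; its filling is the
  homotopy.\<close>

lemma fills_cubes_over_homotopy:
  assumes W: "fills_cubes_over (Suc p) X W"
    and h: "continuous_map (top_of_set (W \<times> cube p)) X h"
    and e: "continuous_map (top_of_set (W \<times> cube p)) X e"
    and eq: "\<And>x t. x \<in> W \<Longrightarrow> t \<in> cube_boundary p \<Longrightarrow> h (x, t) = e (x, t)"
  obtains K where "continuous_map (top_of_set (W \<times> cube p \<times> {0..1::real})) X K"
    "\<And>x t. x \<in> W \<Longrightarrow> t \<in> cube p \<Longrightarrow> K (x, t, 0) = h (x, t)"
    "\<And>x t. x \<in> W \<Longrightarrow> t \<in> cube p \<Longrightarrow> K (x, t, 1) = e (x, t)"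
    "\<And>x t r. x \<in> W \<Longrightarrow> t \<in> cube_boundary p \<Longrightarrow> r \<in> {0..1} \<Longrightarrow> K (x, t, r) = h (x, t)"
proof -
  \<comment> \<open>Coordinate \<open>p\<close> is the time. On the boundary of the larger cube the
    switch at \<open>1/2\<close> takes place on side faces only, where \<open>h\<close> and
    \<open>e\<close> agree.\<close>
  define g where "g z = (if snd z p \<le> 1/2 then h (fst z, (snd z)(p := 0)) else e (fst z, (snd z)(p := 0)))" for z
  have cu: "continuous_on S (\<lambda>z. (fst z, (snd z)(p := 0)))" for S :: "((nat \<Rightarrow> real) \<times> (nat \<Rightarrow> real)) set"
    by (intro continuous_on_Pair continuous_on_fun_upd continuous_on_fst continuous_on_snd
        continuous_on_id continuous_on_const)
  have "continuous_map (top_of_set (W \<times> cube_boundary (Suc p))) X g"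
    unfolding g_def
  proof (rule continuous_map_top_of_set_cases_le)
    show "continuous_map (top_of_set {z \<in> W \<times> cube_boundary (Suc p). snd z p \<le> 1/2}) X (\<lambda>z. h (fst z, (snd z)(p := 0)))"
      by (rule continuous_map_top_of_set_compose[OF h cu _ refl]) (auto simp: cube_boundary_Suc_iff cube_Suc_iff)
    show "continuous_map (top_of_set {z \<in> W \<times> cube_boundary (Suc p). 1/2 \<le> snd z p}) X (\<lambda>z. e (fst z, (snd z)(p := 0)))"
      by (rule continuous_map_top_of_set_compose[OF e cu _ refl]) (auto simp: cube_boundary_Suc_iff cube_Suc_iff)
    show "h (fst z, (snd z)(p := 0)) = e (fst z, (snd z)(p := 0))"
      if "z \<in> W \<times> cube_boundary (Suc p)" "snd z p = 1/2" for z
      using that by (intro eq) (auto simp: cube_boundary_Suc_iff)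
  qed (intro continuous_on_coordinate continuous_on_snd continuous_on_id continuous_on_const)+
  then obtain G where G: "continuous_map (top_of_set (W \<times> cube (Suc p))) X G"
    and Gg: "\<And>x t. x \<in> W \<Longrightarrow> t \<in> cube_boundary (Suc p) \<Longrightarrow> G (x, t) = g (x, t)"
    using W unfolding fills_cubes_over_def by blast
  define K where "K = (\<lambda>(x, t, r). G (x, t(p := r)))"
  have upd: "t(p := 0) = t" if "t \<in> cube p" for t :: "nat \<Rightarrow> real"
    using that by (auto simp: cube_iff)
  have tp: "t p = 0" if "t \<in> cube p" for t :: "nat \<Rightarrow> real"
    using that by (simp add: cube_iff)
  have bd: "t \<in> cube_boundary p \<Longrightarrow> t \<in> cube p" for t by (simp add: cube_boundary_def)
  show thesis
  proof
    show "continuous_map (top_of_set (W \<times> cube p \<times> {0..1::real})) X K"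
    proof (rule continuous_map_top_of_set_compose[OF G, where f = "\<lambda>z. (fst z, (fst (snd z))(p := snd (snd z)))"])
      show "continuous_on (W \<times> cube p \<times> {0..1::real}) (\<lambda>z. (fst z, (fst (snd z))(p := snd (snd z))))"
        by (intro continuous_on_Pair continuous_on_fun_upd continuous_on_fst continuous_on_snd continuous_on_id)
    qed (auto simp: K_def cube_Suc_iff upd)
    show "K (x, t, 0) = h (x, t)" "K (x, t, 1) = e (x, t)" if "x \<in> W" "t \<in> cube p" for x t
      using that Gg[of x t] Gg[of x "t(p := 1)"] tp[OF that(2)]
      by (auto simp: K_def upd cube_boundary_Suc_iff cube_Suc_iff g_def fun_upd_same dest: upd)
    show "K (x, t, r) = h (x, t)" if "x \<in> W" "t \<in> cube_boundary p" "r \<in> {0..1}" for x t r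
      using that eq[of x t] upd[OF bd[OF that(2)]] bd[OF that(2)]
      by (auto simp: K_def Gg cube_boundary_Suc_iff cube_Suc_iff g_def)
  qed
qed

text \<open>A Mayer-Vietoris step: fillings over \<open>Z\<close> and over \<open>V\<close> agree on
  the boundary of the cube, so over \<open>Z \<inter> V\<close> they are joined by a homotopy rel
  boundary, at the price of filling cubes of one dimension more there.\<close>

lemma fills_cubes_over_Un:
  assumes "openin (top_of_set (Z \<union> V)) Z" "openin (top_of_set (Z \<union> V)) V"
    and Z: "fills_cubes_over p X Z" and V: "fills_cubes_over p X V"
    and ZV: "fills_cubes_over (Suc p) X (Z \<inter> V)"
  shows "fills_cubes_over p X (Z \<union> V)"
  unfolding fills_cubes_over_def
proof (intro allI impI)
  fix g assume g: "continuous_map (top_of_set ((Z \<union> V) \<times> cube_boundary p)) X g"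
  have "continuous_map (top_of_set (Z \<times> cube_boundary p)) X g" "continuous_map (top_of_set (V \<times> cube_boundary p)) X g"
    by (rule continuous_map_top_of_set_subset[OF g]; auto)+
  note gZV = this
  obtain h where h: "continuous_map (top_of_set (Z \<times> cube p)) X h"
    and hg: "\<And>x t. x \<in> Z \<Longrightarrow> t \<in> cube_boundary p \<Longrightarrow> h (x, t) = g (x, t)"
    using fills_cubes_overE[OF Z gZV(1)] by blast
  obtain e where e: "continuous_map (top_of_set (V \<times> cube p)) X e"
    and eg: "\<And>x t. x \<in> V \<Longrightarrow> t \<in> cube_boundary p \<Longrightarrow> e (x, t) = g (x, t)"
    using fills_cubes_overE[OF V gZV(2)] by blast
  have h': "continuous_map (top_of_set ((Z \<inter> V) \<times> cube p)) X h"
    by (rule continuous_map_top_of_set_subset[OF h]) auto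
  have e': "continuous_map (top_of_set ((Z \<inter> V) \<times> cube p)) X e"
    by (rule continuous_map_top_of_set_subset[OF e]) auto
  have he: "h (x, t) = e (x, t)" if "x \<in> Z \<inter> V" "t \<in> cube_boundary p" for x t
    using that hg eg by auto
  obtain K where K: "continuous_map (top_of_set ((Z \<inter> V) \<times> cube p \<times> {0..1::real})) X K"
    "\<And>x t. x \<in> Z \<inter> V \<Longrightarrow> t \<in> cube p \<Longrightarrow> K (x, t, 0) = h (x, t)"
    "\<And>x t. x \<in> Z \<inter> V \<Longrightarrow> t \<in> cube p \<Longrightarrow> K (x, t, 1) = e (x, t)"
    and Kb: "\<And>x t r. x \<in> Z \<inter> V \<Longrightarrow> t \<in> cube_boundary p \<Longrightarrow> r \<in> {0..1} \<Longrightarrow> K (x, t, r) = h (x, t)"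
    using fills_cubes_over_homotopy[OF ZV h' e' he] by blast
  obtain G where G: "continuous_map (top_of_set ((Z \<union> V) \<times> cube p)) X G"
    "\<And>x t. x \<in> Z - V \<Longrightarrow> t \<in> cube p \<Longrightarrow> G (x, t) = h (x, t)"
    "\<And>x t. x \<in> V - Z \<Longrightarrow> t \<in> cube p \<Longrightarrow> G (x, t) = e (x, t)"
    "\<And>x t. x \<in> Z \<inter> V \<Longrightarrow> t \<in> cube p \<Longrightarrow> \<exists>r\<in>{0..1}. G (x, t) = K (x, t, r)"
    using glue_along_homotopy[OF assms(1,2) h e K] by blast
  have "G (x, t) = g (x, t)" if x: "x \<in> Z \<union> V" and tb: "t \<in> cube_boundary p" for x t
  proof -
    have t: "t \<in> cube p" using tb by (simp add: cube_boundary_def)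
    consider "x \<in> Z - V" | "x \<in> V - Z" | "x \<in> Z \<inter> V" using x by blast
    then show ?thesis
    proof cases
      case 1 then show ?thesis using G(2)[OF _ t] hg[OF _ tb] by auto
    next
      case 2 then show ?thesis using G(3)[OF _ t] eg[OF _ tb] by auto
    next
      case 3
      then obtain r where "r \<in> {0..1}" "G (x, t) = K (x, t, r)" using G(4)[OF _ t] by blast
      then show ?thesis using 3 Kb[OF 3 tb, of r] hg[OF _ tb, of x] by auto
    qed
  qed
  with G(1) show "\<exists>G. continuous_map (top_of_set ((Z \<union> V) \<times> cube p)) X G \<and>
            (\<forall>x\<in>Z \<union> V. \<forall>t\<in>cube_boundary p. G (x, t) = g (x, t))" by blast
qed

text \<open>The nerve of such a cover has dimension below \<^term>\<open>card L\<close>, so this is the usual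
  obstruction theory over the nerve, with all cells supplied by the convexity of the bricks.\<close>

lemma fills_cubes_over_brick_families:
  assumes "finite L" "\<And>l. l \<in> L \<Longrightarrow> brick_family Z (F l)" "Z = (\<Union>l\<in>L. \<Union>(F l))"
    and fill: "\<And>j. j \<le> Suc s \<Longrightarrow> fills_cubes j X" and "card L + p \<le> s + 2"
  shows "fills_cubes_over p X Z"
  using assms(1-3,5)
proof (induction L arbitrary: Z F p rule: finite_induct)
  case empty
  then show ?case by (simp add: fills_cubes_over_empty)
next
  case (insert l L)
  define V where "V = \<Union>(F l)"
  define W where "W = (\<Union>k\<in>L. \<Union>(F k))"
  have Z: "Z = W \<union> V" using insert.prems(2) by (auto simp: V_def W_def)
  have F: "brick_family Z (F k)" if "k \<in> insert l L" for k using insert.prems(1) that by blast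
  have bV: "brick_family V (F l)"
    using F[of l] by (rule brick_family_mono) (auto simp: Z V_def)
  have bW: "brick_family W (F k)" if "k \<in> L" for k
    using F[of k] by (rule brick_family_mono) (use that in \<open>auto simp: Z W_def\<close>)
  \<comment> \<open>Intersections with the bricks of \<open>F l\<close> form brick families again.
    The overlap is thus covered by \<open>card L\<close> families, one fewer than the union, which
    pays for the step from \<open>p\<close> to \<open>Suc p\<close>.\<close>
  define F' where "F' k = (\<lambda>(A, B). A \<inter> B) ` (F k \<times> F l)" for k
  have UF': "\<Union>(F' k) = \<Union>(F k) \<inter> V" for k
    by (auto simp: F'_def V_def)
  have F': "brick_family (W \<inter> V) (F' k)" if "k \<in> L" for k
  proof (rule brick_family_mono)
    show "brick_family Z (F' k)"
      unfolding F'_def using F that by (intro brick_family_Int) auto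
  qed (use that in \<open>auto simp: UF' Z W_def\<close>)
  have card: "card L + Suc p \<le> s + 2" using insert by simp
  have "openin (top_of_set Z) W" "openin (top_of_set Z) V"
    using F by (auto simp: W_def V_def brick_family_def intro!: openin_Union)
  moreover have "fills_cubes_over p X W"
    by (rule insert.IH[of W F]) (use bW card in \<open>auto simp: W_def\<close>)
  moreover have "fills_cubes_over p X V"
    unfolding V_def using bV card by (intro fills_cubes_over_brick_family fill) (auto simp: V_def)
  moreover have "fills_cubes_over (Suc p) X (W \<inter> V)"
    by (rule insert.IH[of _ F']) (use F' card in \<open>auto simp: UF' W_def\<close>)
  ultimately show ?case
    unfolding Z by (intro fills_cubes_over_Un) auto
qed

section \<open>Vanishing homotopy groups\<close>

lemma top_of_set_cube:
  "subtopology (Euclidean_space p) (cube p) = top_of_set (cube p)"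
proof -
  have "{x. \<forall>i\<ge>p. x i = (0::real)} \<inter> cube p = cube p"
    by (auto simp: cube_def topspace_Euclidean_space)
  then show ?thesis
    by (simp add: Euclidean_space_def euclidean_product_topology subtopology_subtopology)
qed

lemma compact_cube: "compact (cube p)"
proof -
  have "compactin (powertop_real UNIV) (PiE UNIV (\<lambda>i. if i < p then {0..1} else {0}))"
    by (subst compactin_PiE) auto
  moreover have "PiE UNIV (\<lambda>i. if i < p then {0..1} else {0}) = cube p"
  proof -
    have "x i \<in> (if i < p then {0..1} else {0}) \<longleftrightarrow> (i < p \<longrightarrow> 0 \<le> x i \<and> x i \<le> 1) \<and> (p \<le> i \<longrightarrow> x i = 0)"
      for x :: "nat \<Rightarrow> real" and i by simp
    then show ?thesis
      unfolding PiE_UNIV_domain cube_def topspace_Euclidean_space by blast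
  qed
  ultimately show ?thesis
    by (simp add: euclidean_product_topology)
qed

text \<open>With \<open>\<rho>\<close> the sup norm of the centred point of the \<open>m\<close>-cube, the direction of
  \<open>((1 - \<rho>) v, 1 - 2 \<rho>)\<close> runs from one pole of the boundary of the \<open>(m + 1)\<close>-cube to the other.\<close>

definition cap_direction :: "nat \<Rightarrow> (nat \<Rightarrow> real) \<Rightarrow> nat \<Rightarrow> real" where
  "cap_direction m y = (\<lambda>i. if i < m then (1 - sup_norm m (centred y)) * centred y i
     else if i = m then 1 - 2 * sup_norm m (centred y) else 0)"

lemma sup_norm_cap_direction:
  assumes "sup_norm m (centred y) \<le> 1"
  shows "sup_norm (Suc m) (cap_direction m y) =
    max ((1 - sup_norm m (centred y)) * sup_norm m (centred y)) \<bar>1 - 2 * sup_norm m (centred y)\<bar>"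
proof -
  have "sup_norm m (cap_direction m y) = sup_norm m (\<lambda>i. (1 - sup_norm m (centred y)) * centred y i)"
    by (rule sup_norm_cong) (simp add: cap_direction_def)
  with assms show ?thesis
    by (simp add: sup_norm_scale) (simp add: cap_direction_def)
qed

text \<open>The last entry vanishes only if the norm of \<open>centred y\<close> is
  \<open>1/2\<close>, and then the other entries have norm \<open>1/4\<close>. So the ray in this
  direction is always defined.\<close>

lemma sup_norm_cap_direction_pos:
  assumes "sup_norm m (centred y) \<le> 1"
  shows "0 < sup_norm (Suc m) (cap_direction m y)"
proof (cases "2 * sup_norm m (centred y) = 1")
  case True
  then have half: "sup_norm m (centred y) = 1/2" by simp
  show ?thesis unfolding sup_norm_cap_direction[OF assms] half by simp
next
  case False
  then show ?thesis unfolding sup_norm_cap_direction[OF assms] by simp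
qed

text \<open>The cone over the sphere that arises from the \<open>m\<close>-cube by collapsing its
  boundary: level \<open>l = 0\<close> is the boundary of the \<open>(m + 1)\<close>-cube, level
  \<open>l = 1\<close> its centre. A null-homotopy rel boundary on the \<open>m\<close>-cube is to
  be read as a map on this cone.\<close>

definition cap_cone :: "nat \<Rightarrow> real \<times> (nat \<Rightarrow> real) \<Rightarrow> nat \<Rightarrow> real" where
  "cap_cone m = (\<lambda>(l, y). recentre (Suc m)
     ((1 - l) / sup_norm (Suc m) (cap_direction m y)) (cap_direction m y))"

lemma sup_norm_cap_cone:
  assumes "l \<le> 1" "sup_norm m (centred y) \<le> 1"
  shows "sup_norm (Suc m) (centred (cap_cone m (l, y))) = 1 - l"
  using assms sup_norm_cap_direction_pos[OF assms(2)]
  by (simp add: cap_cone_def sup_norm_recentre del: sup_norm.simps)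

lemma continuous_on_cap_direction:
  "continuous_on S (\<lambda>z. cap_direction m (snd z) i)" for S :: "(real \<times> (nat \<Rightarrow> real)) set"
proof -
  have c: "continuous_on S (\<lambda>z. centred (snd z) i)" for i
    by (intro continuous_on_centred continuous_on_snd continuous_on_id)
  have "continuous_on S (\<lambda>z. sup_norm m (centred (snd z)))"
    by (intro continuous_on_sup_norm c)
  then show ?thesis
    unfolding cap_direction_def
    by (cases "i < m"; cases "i = m") (auto intro!: continuous_on_mult continuous_on_diff continuous_on_const c)
qed

lemma continuous_on_cap_cone:
  "continuous_on ({0..1} \<times> cube m) (cap_cone m)"
  unfolding cap_cone_def case_prod_unfold
  by (intro continuous_on_recentre continuous_on_cap_direction continuous_on_divide continuous_on_diff
      continuous_on_const continuous_on_fst continuous_on_id continuous_on_sup_norm)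
     (use sup_norm_cap_direction_pos in \<open>fastforce simp: cube_iff simp del: sup_norm.simps\<close>)

lemma cap_cone_image:
  assumes "0 < m"
  shows "cap_cone m ` ({0..1} \<times> cube m) = cube (Suc m)"
proof (intro equalityI subsetI)
  fix z assume "z \<in> cap_cone m ` ({0..1} \<times> cube m)"
  then obtain l y where "z = cap_cone m (l, y)" "l \<in> {0..1}" "y \<in> cube m" by auto
  moreover have "\<forall>i\<ge>Suc m. cap_cone m (l, y) i = 0" by (simp add: cap_cone_def)
  ultimately show "z \<in> cube (Suc m)"
    by (auto simp: cube_iff[of _ "Suc m"] cube_iff[of _ m] sup_norm_cap_cone simp del: sup_norm.simps)
next
  fix z assume z: "z \<in> cube (Suc m)"
  define M where "M = sup_norm (Suc m) (centred z)"
  have M: "0 \<le> M" "M \<le> 1" using z sup_norm_nonneg by (auto simp: M_def cube_iff simp del: sup_norm.simps)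
  have "\<exists>y\<in>cube m. \<exists>c>0. \<forall>i<Suc m. cap_direction m y i = c * centred z i" if "M > 0"
  proof -
    define V where "V = sup_norm m (centred z)"
    define h where "h = centred z m"
    have V: "0 \<le> V" by (simp add: V_def)
    show ?thesis
    proof (cases "V = 0")
      case True
      then have zero: "centred z i = 0" if "i < m" for i
        using that by (simp add: V_def sup_norm_eq_0_iff)
      have h: "h \<noteq> 0" using \<open>M > 0\<close> True by (auto simp: M_def V_def h_def)
      show ?thesis
      proof (cases "h > 0")
        case True
        define y where "y = recentre m 0 (\<lambda>_. 0)"
        have y: "sup_norm m (centred y) = 0" by (simp add: y_def sup_norm_recentre)
        have "y \<in> cube m" using y by (simp add: cube_iff) (simp add: y_def)
        moreover have "cap_direction m y i = (1 / h) * centred z i" if "i < Suc m" for i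
          using that y zero h sup_norm_eq_0_iff[of m "centred y"]
          by (cases "i < m") (auto simp: cap_direction_def h_def less_Suc_eq)
        ultimately show ?thesis using True by (intro bexI[of _ y] exI[of _ "1 / h"]) auto
      next
        case False
        \<comment> \<open>Every boundary point of the \<open>m\<close>-cube has the downward
          direction; the corner with all \<open>m\<close> coordinates equal to \<open>1\<close> lies
          on the boundary because \<open>0 < m\<close>.\<close>
        define y where "y = recentre m 1 (\<lambda>_. 1)"
        have "sup_norm m (\<lambda>_. 1) = 1"
          using assms sup_norm_ge[of 0 m "\<lambda>_. 1"] sup_norm_le_iff[of 1 m "\<lambda>_. 1"] by auto
        then have y: "sup_norm m (centred y) = 1" by (simp add: y_def sup_norm_recentre)
        have "y \<in> cube m" using y by (simp add: cube_iff) (simp add: y_def)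
        moreover have "cap_direction m y i = (- 1 / h) * centred z i" if "i < Suc m" for i
          using that y zero h
          by (cases "i < m") (auto simp: cap_direction_def h_def less_Suc_eq)
        ultimately show ?thesis using False h by (intro bexI[of _ y] exI[of _ "- 1 / h"]) (auto simp: divide_neg_neg)
      qed
    next
      case False
      with V have V: "V > 0" by simp
      \<comment> \<open>The norm \<open>r\<close> of \<open>centred y\<close> has to satisfy
        \<open>(1 - r) * r : (1 - 2 * r) = V : h\<close>. Cross-multiplied, the difference of the
        two sides is \<open>- V\<close> at \<open>0\<close> and \<open>V\<close> at
        \<open>1\<close>.\<close>
      have "\<exists>r\<ge>0. r \<le> 1 \<and> h * r * (1 - r) - V * (1 - 2 * r) = 0"
        by (rule IVT') (use V in \<open>auto intro!: continuous_intros\<close>)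
      then obtain r where r: "0 \<le> r" "r \<le> 1" "h * r * (1 - r) = V * (1 - 2 * r)" by auto
      have "r \<noteq> 0" "r \<noteq> 1" using r(3) V by auto
      with r have r01: "0 < r" "r < 1" by auto
      define y where "y = recentre m (r / V) (centred z)"
      have y: "sup_norm m (centred y) = r"
        using V r by (simp add: y_def sup_norm_recentre) (simp add: V_def)
      have "y \<in> cube m" using y r by (simp add: cube_iff) (simp add: y_def)
      moreover have "cap_direction m y i = ((1 - r) * r / V) * centred z i" if "i < Suc m" for i
      proof (cases "i < m")
        case True
        then show ?thesis using y by (simp add: cap_direction_def) (simp add: y_def recentre_def centred_def)
      next
        case False
        then have "i = m" using that by simp
        then show ?thesis using y r(3) V by (simp add: cap_direction_def h_def[symmetric] field_simps)
      qed
      ultimately show ?thesis using r01 V by (intro bexI[of _ y] exI[of _ "(1 - r) * r / V"]) auto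
    qed
  qed
  \<comment> \<open>A default for \<open>M = 0\<close>: the centre of the large cube is the apex of
    the cone, which is reached from every \<open>y\<close>.\<close>
  moreover have "(\<lambda>_. 0) \<in> cube m" by (simp add: cube_def topspace_Euclidean_space)
  ultimately obtain y c where y: "y \<in> cube m" and c: "M > 0 \<Longrightarrow> c > 0 \<and> (\<forall>i<Suc m. cap_direction m y i = c * centred z i)"
    by (metis M(1) order_less_le)
  have "cap_cone m (1 - M, y) i = z i" for i
  proof (cases "i < Suc m")
    case True
    show ?thesis
    proof (cases "M = 0")
      case True
      then have "centred z i = 0" using \<open>i < Suc m\<close> sup_norm_eq_0_iff[of "Suc m"] by (auto simp: M_def simp del: sup_norm.simps)
      with True \<open>i < Suc m\<close> show ?thesis by (simp add: cap_cone_def recentre_def centred_def)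
    next
      case False
      with M c have c: "c > 0" "\<And>i. i < Suc m \<Longrightarrow> cap_direction m y i = c * centred z i" and "M > 0" by auto
      have "sup_norm (Suc m) (cap_direction m y) = sup_norm (Suc m) (\<lambda>i. c * centred z i)"
        by (rule sup_norm_cong) (rule c(2))
      then have "sup_norm (Suc m) (cap_direction m y) = c * M"
        using c(1) by (simp add: sup_norm_scale M_def del: sup_norm.simps)
      then show ?thesis using True c \<open>M > 0\<close>
        by (simp add: cap_cone_def recentre_def centred_def field_simps del: sup_norm.simps)
    qed
  next
    case False
    then show ?thesis using z by (auto simp: cap_cone_def cube_iff)
  qed
  then have "z = cap_cone m (1 - M, y)" by auto
  with y M show "z \<in> cap_cone m ` ({0..1} \<times> cube m)" by auto
qed

text \<open>Along the plane curve \<open>((1 - r) * r, 1 - 2 * r)\<close> the direction determines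
  \<open>r\<close>: eliminating \<open>c\<close> leaves an equation with the factor
  \<open>b - a\<close>, whose cofactor \<open>(1 - a) * (1 - b) + a * b\<close> is positive.\<close>

lemma cap_profile_inj:
  fixes a b :: real
  assumes "0 \<le> a" "a < 1" "0 \<le> b" "b < 1" "c > 0"
    "(1 - b) * b = c * ((1 - a) * a)" "1 - 2 * b = c * (1 - 2 * a)"
  shows "a = b"
proof -
  have "(1 - 2 * a) * (c * ((1 - b) * b)) = (c * (1 - 2 * a)) * ((1 - b) * b)" by simp
  also have "\<dots> = (1 - 2 * b) * (c * ((1 - a) * a))" by (simp only: assms(6,7))
  finally have "(1 - 2 * a) * (c * ((1 - b) * b)) = (1 - 2 * b) * (c * ((1 - a) * a))" .
  then have "(1 - 2 * a) * ((1 - b) * b) = (1 - 2 * b) * ((1 - a) * a)"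
    using assms(5) by simp
  then have "(b - a) * ((1 - a) * (1 - b) + a * b) = 0" by (simp add: algebra_simps)
  moreover have "(1 - a) * (1 - b) + a * b > 0" using assms by (simp add: add_pos_nonneg)
  ultimately show ?thesis by simp
qed

text \<open>The cone identifies only points on which a null-homotopy rel boundary takes the same
  value: those of the level \<open>l = 1\<close>, and at each level those on the boundary of the
  \<open>m\<close>-cube. This lets such a homotopy descend to the large cube.\<close>

lemma cap_cone_eqD:
  assumes "cap_cone m (l, y) = cap_cone m (l', y')" "l \<in> {0..1}" "l' \<in> {0..1}" "y \<in> cube m" "y' \<in> cube m"
  shows "l = l' \<and> (l = 1 \<or> y = y' \<or> y \<in> cube_boundary m \<and> y' \<in> cube_boundary m)"
proof -
  let ?r = "sup_norm m (centred y)" and ?r' = "sup_norm m (centred y')"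
  have r: "?r \<le> 1" "?r' \<le> 1" using assms(4,5) by (auto simp: cube_iff)
  have l: "l = l'" using assms r sup_norm_cap_cone[of l m y] sup_norm_cap_cone[of l' m y'] by auto
  show ?thesis
  proof (cases "l = 1")
    case False
    then have l1: "l < 1" using assms by auto
    define N where "N = sup_norm (Suc m) (cap_direction m y)"
    define N' where "N' = sup_norm (Suc m) (cap_direction m y')"
    have N: "N > 0" "N' > 0" using r sup_norm_cap_direction_pos unfolding N_def N'_def by blast+
    define c where "c = N' / N"
    have c: "c > 0" using N by (simp add: c_def)
    have dir: "cap_direction m y' i = c * cap_direction m y i" if "i < Suc m" for i
    proof -
      have "1/2 + (1 - l) / N * cap_direction m y i / 2 = 1/2 + (1 - l) / N' * cap_direction m y' i / 2"
        using fun_cong[OF assms(1), of i] l that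
        by (simp only: cap_cone_def case_prod_conv recentre_def N_def[symmetric] N'_def[symmetric] if_True)
      moreover have "u = v" if "1/2 + u / 2 = 1/2 + v / 2" for u v :: real
        using that by simp
      ultimately have "(1 - l) / N * cap_direction m y i = (1 - l) / N' * cap_direction m y' i" by blast
      then have "(1 - l) * (cap_direction m y i / N) = (1 - l) * (cap_direction m y' i / N')" by simp
      then have "cap_direction m y i / N = cap_direction m y' i / N'"
        by (rule iffD1[OF mult_left_cancel, rotated]) (use l1 in simp)
      then show ?thesis using N by (simp add: c_def field_simps)
    qed
    have m: "1 - 2 * ?r' = c * (1 - 2 * ?r)"
      using dir[of m] by (simp add: cap_direction_def)
    have low: "(1 - ?r') * centred y' i = c * ((1 - ?r) * centred y i)" if "i < m" for i
      using dir[of i] that by (simp add: cap_direction_def)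
    have "sup_norm m (\<lambda>i. (1 - ?r') * centred y' i) = sup_norm m (\<lambda>i. c * ((1 - ?r) * centred y i))"
      by (rule sup_norm_cong) (rule low)
    then have p: "(1 - ?r') * ?r' = c * ((1 - ?r) * ?r)"
      using r c by (simp add: sup_norm_scale)
    show ?thesis
    proof (cases "?r = 1 \<or> ?r' = 1")
      case True
      then have "?r = 1 \<and> ?r' = 1"
      proof
        assume 1: "?r = 1"
        then have "?r' = 1 \<or> ?r' = 0" using p by auto
        moreover have "?r' \<noteq> 0" using m 1 c by auto
        ultimately show ?thesis using 1 by auto
      next
        assume 1: "?r' = 1"
        then have "?r = 1 \<or> ?r = 0" using p c by auto
        moreover have "?r \<noteq> 0" using m 1 c by auto
        ultimately show ?thesis using 1 by auto
      qed
      then show ?thesis using l assms(4,5) by (auto simp: cube_boundary_iff cube_iff)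
    next
      case False
      then have r1: "?r < 1" "?r' < 1" using r by auto
      have req: "?r = ?r'"
        using cap_profile_inj[OF _ r1(1) _ r1(2) c p m] by simp
      have "c = 1"
      proof (cases "?r = 1/2")
        case True
        then show ?thesis using p req by simp
      next
        case False
        then show ?thesis using m req by simp
      qed
      have "y i = y' i" for i
      proof (cases "i < m")
        case True
        then have "(1 - ?r') * centred y' i = (1 - ?r') * centred y i"
          using low[of i] \<open>c = 1\<close> req by simp
        then show ?thesis using r1 by (simp add: centred_def)
      next
        case False
        then show ?thesis using assms(4,5) by (simp add: cube_iff)
      qed
      then show ?thesis using l by auto
    qed
  qed (use l in auto)
qed

text \<open>The passage from based to free vanishing. Along the bottom of the cone \<open>g\<close>
  becomes a spheroid; its null-homotopy is constant on the fibres of \<open>cap_cone\<close>, which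
  is a quotient map by compactness, and so descends to a filling of \<open>g\<close>.\<close>

lemma fills_cubes_Suc:
  assumes m: "0 < m" and van: "homotopy_group_vanishes m X"
  shows "fills_cubes (Suc m) X"
  unfolding fills_cubes_def
proof (intro allI impI)
  fix g assume g: "continuous_map (top_of_set (cube_boundary (Suc m))) X g"
  define \<phi> where "\<phi> y = cap_cone m (0, y)" for y
  have c\<phi>: "continuous_on (cube m) \<phi>"
    unfolding \<phi>_def
    by (rule continuous_on_compose2[OF continuous_on_cap_cone]) (auto intro!: continuous_on_Pair continuous_on_const continuous_on_id)
  have \<phi>b: "\<phi> y \<in> cube_boundary (Suc m)" if "y \<in> cube m" for y
    using that sup_norm_cap_cone[of 0 m y] by (simp add: \<phi>_def cube_boundary_iff cube_iff cap_cone_def del: sup_norm.simps)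
  \<comment> \<open>The common image of all boundary points of the \<open>m\<close>-cube; its value
    under \<open>g\<close> serves as base point.\<close>
  define pole where "pole = recentre (Suc m) (1 / sup_norm (Suc m) (\<lambda>i. if i = m then - 1 else 0)) (\<lambda>i. if i = m then - 1 else 0)"
  have pole: "\<phi> y = pole" if "y \<in> cube_boundary m" for y
  proof -
    have "cap_direction m y = (\<lambda>i. if i = m then - 1 else 0)"
      using that by (auto simp: cap_direction_def cube_boundary_iff fun_eq_iff)
    then show ?thesis by (simp only: \<phi>_def pole_def cap_cone_def) (simp del: sup_norm.simps)
  qed
  define a where "a = g pole"
  have gphi: "continuous_map (top_of_set (cube m)) X (\<lambda>y. g (\<phi> y))"
    by (rule continuous_map_top_of_set_compose[OF g c\<phi> _ refl]) (use \<phi>b in auto)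
  have bd_ne: "(\<lambda>_. 0) \<in> cube_boundary m"
    using m by (auto simp: cube_boundary_def cube_def topspace_Euclidean_space)
  have "a \<in> topspace X"
    using continuous_map_image_subset_topspace[OF gphi] bd_ne pole
    by (auto simp: a_def cube_boundary_def image_subset_iff)
  moreover from this have "(\<lambda>_. a) \<in> spheroids m X a" by (simp add: spheroids_def)
  moreover have "(\<lambda>y. g (\<phi> y)) \<in> spheroids m X a"
    using gphi pole by (simp add: spheroids_def top_of_set_cube a_def)
  ultimately have "homotopic_with (\<lambda>h. \<forall>t \<in> cube_boundary m. h t = a)
      (subtopology (Euclidean_space m) (cube m)) X (\<lambda>y. g (\<phi> y)) (\<lambda>_. a)"
    using van unfolding homotopy_group_vanishes_iff by blast
  then obtain N where N: "continuous_map (prod_topology (top_of_set {0..1::real}) (top_of_set (cube m))) X N"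
    and N0: "\<And>y. N (0, y) = g (\<phi> y)" and N1: "\<And>y. N (1, y) = a"
    and Nb: "\<And>l y. l \<in> {0..1} \<Longrightarrow> y \<in> cube_boundary m \<Longrightarrow> N (l, y) = a"
    unfolding homotopic_with_def top_of_set_cube by blast
  have "quotient_map (top_of_set ({0..1} \<times> cube m)) (top_of_set (cube (Suc m))) (cap_cone m)"
  proof (rule T1_Spaces.continuous_imp_quotient_map)
    show "continuous_map (top_of_set ({0..1} \<times> cube m)) (top_of_set (cube (Suc m))) (cap_cone m)"
      using continuous_on_cap_cone cap_cone_image[OF m] by (auto simp: continuous_map_in_subtopology)
    show "compact_space (top_of_set ({0..1::real} \<times> cube m))"
      by (simp add: compact_space_subtopology compact_Times compact_cube)
    show "Hausdorff_space (top_of_set (cube (Suc m)))"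
      by (intro Hausdorff_space_subtopology Hausdorff_space_euclidean)
  qed (simp add: cap_cone_image[OF m])
  moreover have "continuous_map (top_of_set ({0..1} \<times> cube m)) X N"
    using N by simp
  moreover have "N u = N v" if "u \<in> topspace (top_of_set ({0..1} \<times> cube m))"
    "v \<in> topspace (top_of_set ({0..1} \<times> cube m))" "cap_cone m u = cap_cone m v" for u v
  proof -
    obtain l y l' y' where uv: "u = (l, y)" "v = (l', y')" by fastforce
    then show ?thesis
      using cap_cone_eqD[of m l y l' y'] that N1 Nb by auto
  qed
  ultimately obtain G where G: "continuous_map (top_of_set (cube (Suc m))) X G"
    and GN: "\<And>u. u \<in> {0..1} \<times> cube m \<Longrightarrow> G (cap_cone m u) = N u"
    using quotient_map_lift_exists[of "top_of_set ({0..1} \<times> cube m)" "top_of_set (cube (Suc m))" "cap_cone m" X N]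
    by (metis topspace_euclidean_subtopology)
  have "G z = g z" if z: "z \<in> cube_boundary (Suc m)" for z
  proof -
    have "z \<in> cap_cone m ` ({0..1} \<times> cube m)"
      using z cap_cone_image[OF m] by (auto simp: cube_boundary_def)
    then obtain l y where ly: "z = cap_cone m (l, y)" "l \<in> {0..1}" "y \<in> cube m" by auto
    then have "l = 0" using z sup_norm_cap_cone[of l m y] by (simp add: cube_boundary_iff cube_iff del: sup_norm.simps)
    then show ?thesis using ly GN[of "(l, y)"] N0 by (simp add: \<phi>_def)
  qed
  with G show "\<exists>G. continuous_map (top_of_set (cube (Suc m))) X G \<and> (\<forall>t\<in>cube_boundary (Suc m). G t = g t)"
    by blast
qed

lemma cube_Suc_0: "cube (Suc 0) = (\<lambda>r i. if i = 0 then r else 0) ` {0..1}"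
proof
  show "cube (Suc 0) \<subseteq> (\<lambda>r i. if i = 0 then r else 0) ` {0..1}"
  proof
    fix t assume t: "t \<in> cube (Suc 0)"
    then have "t = (\<lambda>i. if i = 0 then t 0 else 0)"
      by (auto simp: cube_def topspace_Euclidean_space fun_eq_iff)
    moreover have "t 0 \<in> {0..1}" using t by (simp add: cube_def)
    ultimately show "t \<in> (\<lambda>r i. if i = 0 then r else 0) ` {0..1}" by (rule image_eqI)
  qed
  show "(\<lambda>r i. if i = 0 then r else 0) ` {0..1} \<subseteq> cube (Suc 0)"
    by (auto simp: cube_def topspace_Euclidean_space)
qed

text \<open>Dimensions \<open>0\<close> and \<open>1\<close> are treated directly. For
  \<open>m = 0\<close> the cone construction would break down, as \<open>cap_cone 0\<close> reaches
  only one half of the interval; there a path between the two end values is the filling.\<close>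

lemma fills_cubes_of_connected:
  assumes ne: "topspace X \<noteq> {}" and van: "\<And>j. j \<le> s \<Longrightarrow> homotopy_group_vanishes j X" and "p \<le> Suc s"
  shows "fills_cubes p X"
proof -
  consider "p = 0" | "p = Suc 0" | m where "p = Suc m" "0 < m"
    by (metis gr0_conv_Suc not0_implies_Suc)
  then show ?thesis
  proof cases
    case 1
    obtain x where "x \<in> topspace X" using ne by blast
    with 1 show ?thesis
      unfolding fills_cubes_def by (auto simp: cube_boundary_0 intro!: exI[of _ "\<lambda>_. x"])
  next
    case 2
    have pc: "path_connected_space X" using van[of 0] by (simp add: homotopy_group_vanishes_0)
    show ?thesis unfolding fills_cubes_def 2
    proof (intro allI impI)
      fix g assume g: "continuous_map (top_of_set (cube_boundary (Suc 0))) X g"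
      define e where "e r = (\<lambda>i::nat. if i = 0 then r else 0)" for r :: real
      have e: "cube (Suc 0) = e ` {0..1}" unfolding cube_Suc_0 e_def ..
      have bd: "cube_boundary (Suc 0) = {e 0, e 1}"
      proof
        show "cube_boundary (Suc 0) \<subseteq> {e 0, e 1}"
          unfolding cube_boundary_def e by (auto simp: e_def)
        have "e 0 \<in> cube (Suc 0)" "e 1 \<in> cube (Suc 0)" unfolding e by (rule imageI; simp)+
        then show "{e 0, e 1} \<subseteq> cube_boundary (Suc 0)"
          by (simp add: cube_boundary_def) (simp add: e_def)
      qed
      then have "g (e 0) \<in> topspace X" "g (e 1) \<in> topspace X"
        using continuous_map_image_subset_topspace[OF g] by auto
      then obtain q where q: "pathin X q" "q 0 = g (e 0)" "q 1 = g (e 1)"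
        using pc unfolding path_connected_space_def by metis
      have "continuous_map (top_of_set (cube (Suc 0))) X (\<lambda>t. q (t 0))"
        by (rule continuous_map_top_of_set_compose[OF q(1)[unfolded pathin_def], where f = "\<lambda>t. t 0"])
           (auto simp: cube_Suc_0 intro: continuous_on_coordinate continuous_on_id)
      moreover have "e r 0 = r" for r by (simp add: e_def)
      ultimately show "\<exists>G. continuous_map (top_of_set (cube (Suc 0))) X G \<and> (\<forall>t\<in>cube_boundary (Suc 0). G t = g t)"
        using q(2,3) by (intro exI[of _ "\<lambda>t. q (t 0)"]) (auto simp: bd)
    qed
  next
    case 3
    with van assms(3) show ?thesis by (simp add: fills_cubes_Suc)
  qed
qed

section \<open>Brick decompositions of Euclidean space\<close>

definition coordinate_box :: "nat \<Rightarrow> (nat \<Rightarrow> real) \<Rightarrow> (nat \<Rightarrow> real) \<Rightarrow> (nat \<Rightarrow> real) set" where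
  "coordinate_box n a b = {z. \<forall>i<n. a i < z i \<and> z i < b i}"

lemma open_coordinate_box: "open (coordinate_box n a b)"
proof -
  have "coordinate_box n a b = (\<Inter>i\<in>{..<n}. (\<lambda>z. z i) -` {a i<..<b i})"
    by (auto simp: coordinate_box_def)
  moreover have "open ((\<lambda>z::nat \<Rightarrow> real. z i) -` {a i<..<b i})" for i
    by (rule open_vimage) (auto intro: continuous_on_coordinate continuous_on_id)
  ultimately show ?thesis by (simp add: open_INT)
qed

lemma segment_closed_coordinate_box: "segment_closed (coordinate_box n a b)"
proof -
  have "a < (1 - r) * x + r * y \<and> (1 - r) * x + r * y < b"
    if "a < x" "x < b" "a < y" "y < b" "0 \<le> r" "r \<le> 1" for a b x y r :: real
    using that convex_bound_lt[of x b y "1 - r" r] convex_bound_lt[of "- x" "- a" "- y" "1 - r" r]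
    by simp
  note between = this
  show ?thesis
    unfolding segment_closed_def
  proof (intro ballI)
    fix x y and r :: real assume "x \<in> coordinate_box n a b" "y \<in> coordinate_box n a b" "r \<in> {0..1}"
    then show "(\<lambda>i. (1 - r) * x i + r * y i) \<in> coordinate_box n a b"
      unfolding coordinate_box_def using between[of "a i" "x i" "b i" "y i" r for i] by auto
  qed
qed

text \<open>The bricks of level \<open>l\<close> have exactly \<open>l\<close> coordinates farther than the threshold from the lattice
  and all others closer. Thresholds that decrease with the level make the levels overlap, so that
  all of them together cover.\<close>

definition brick_threshold :: "nat \<Rightarrow> real" where
  "brick_threshold l = 1 / (real l + 3)"

definition brick :: "nat \<Rightarrow> real \<Rightarrow> nat \<Rightarrow> nat set \<Rightarrow> (nat \<Rightarrow> int) \<Rightarrow> (nat \<Rightarrow> real) set" where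
  "brick n \<delta> l T k = coordinate_box n
     (\<lambda>i. \<delta> * (k i + (if i \<in> T then brick_threshold l else - brick_threshold l)))
     (\<lambda>i. \<delta> * (k i + (if i \<in> T then 1 - brick_threshold l else brick_threshold l)))"

definition bricks :: "nat \<Rightarrow> real \<Rightarrow> (nat \<Rightarrow> real) set \<Rightarrow> nat \<Rightarrow> (nat \<Rightarrow> real) set set" where
  "bricks n \<delta> D l = {D \<inter> brick n \<delta> l T k | T k. T \<subseteq> {..<n} \<and> card T = l}"

text \<open>Staying below \<open>1/2\<close> keeps the intervals around different lattice points
  apart and makes every side of a brick, of length \<open>2 * c\<close> or \<open>1 - 2 * c\<close>
  for the threshold \<open>c\<close>, shorter than one lattice cell.\<close>

lemma brick_threshold_bounds: "0 < brick_threshold l" "brick_threshold l \<le> 1/3"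
  by (simp_all add: brick_threshold_def)

lemma brick_threshold_strict_antimono: "brick_threshold (Suc l) < brick_threshold l"
  by (simp add: brick_threshold_def frac_less2)

lemma in_brick_iff:
  assumes "0 < \<delta>"
  shows "z \<in> brick n \<delta> l T k \<longleftrightarrow> (\<forall>i<n. if i \<in> T
    then k i + brick_threshold l < z i / \<delta> \<and> z i / \<delta> < k i + 1 - brick_threshold l
    else k i - brick_threshold l < z i / \<delta> \<and> z i / \<delta> < k i + brick_threshold l)"
  unfolding brick_def coordinate_box_def using assms
  by (auto simp: less_divide_eq divide_less_eq mult.commute add_diff_eq)

lemma brick_diameter:
  assumes "0 < \<delta>" "x \<in> brick n \<delta> l T k" "y \<in> brick n \<delta> l T k" "i < n"
  shows "\<bar>x i - y i\<bar> < \<delta>"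
proof -
  have "\<bar>x i / \<delta> - y i / \<delta>\<bar> < 1"
    using assms(2-4) brick_threshold_bounds[of l] unfolding in_brick_iff[OF assms(1)]
    by (cases "i \<in> T") (fastforce simp: abs_less_iff)+
  then have "\<bar>x i - y i\<bar> / \<delta> < 1"
    using assms(1) by (metis abs_divide abs_of_pos diff_divide_distrib)
  with assms(1) show ?thesis by simp
qed

text \<open>Bricks of one level share their threshold, so for each coordinate the near and far
  intervals are pairwise disjoint. A common point thus determines \<open>T\<close> and
  \<open>k\<close> below \<open>n\<close>, and with them the brick.\<close>

lemma disjoint_bricks:
  assumes "0 < \<delta>"
  shows "disjoint (bricks n \<delta> D l)"
  unfolding disjoint_def
proof (intro ballI impI)
  fix A B assume "A \<in> bricks n \<delta> D l" "B \<in> bricks n \<delta> D l" "A \<noteq> B"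
  then obtain T k T' k' where A: "A = D \<inter> brick n \<delta> l T k" and B: "B = D \<inter> brick n \<delta> l T' k'"
    by (auto simp: bricks_def)
  show "A \<inter> B = {}"
  proof (rule ccontr)
    assume "A \<inter> B \<noteq> {}"
    then obtain z where z: "z \<in> brick n \<delta> l T k" "z \<in> brick n \<delta> l T' k'" using A B by auto
    let ?c = "brick_threshold l"
    have eq: "(i \<in> T \<longleftrightarrow> i \<in> T') \<and> k i = k' i" if i: "i < n" for i
    proof -
      define w where "w = z i / \<delta>"
      have c: "0 < ?c" "?c \<le> 1/3" by (rule brick_threshold_bounds)+
      have 1: "if i \<in> T then k i + ?c < w \<and> w < real_of_int (k i) + 1 - ?c else k i - ?c < w \<and> w < k i + ?c"
        using z(1)[unfolded in_brick_iff[OF assms], THEN spec, THEN mp, OF i] unfolding w_def .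
      have 2: "if i \<in> T' then k' i + ?c < w \<and> w < real_of_int (k' i) + 1 - ?c else k' i - ?c < w \<and> w < k' i + ?c"
        using z(2)[unfolded in_brick_iff[OF assms], THEN spec, THEN mp, OF i] unfolding w_def .
      have same: "k i = k' i" if "(i \<in> T) = (i \<in> T')"
      proof -
        have "\<bar>real_of_int (k i) - real_of_int (k' i)\<bar> < 1" using 1 2 c that by (auto split: if_splits)
        then show ?thesis by linarith
      qed
      have "(i \<in> T) = (i \<in> T')"
      proof (rule ccontr)
        assume "(i \<in> T) \<noteq> (i \<in> T')"
        then consider "i \<in> T" "i \<notin> T'" | "i \<notin> T" "i \<in> T'" by blast
        then show False
        proof cases
          case c1: 1
          have "real_of_int (k i) < real_of_int (k' i)" "real_of_int (k' i) < real_of_int (k i) + 1"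
            using 1 2 c1 by auto
          then show False by simp
        next
          case c2: 2
          have "real_of_int (k' i) < real_of_int (k i)" "real_of_int (k i) < real_of_int (k' i) + 1"
            using 1 2 c2 by auto
          then show False by simp
        qed
      qed
      with same show ?thesis by blast
    qed
    have "brick n \<delta> l T k = brick n \<delta> l T' k'"
      unfolding brick_def coordinate_box_def by (intro Collect_cong all_cong) (simp add: eq)
    with A B \<open>A \<noteq> B\<close> show False by simp
  qed
qed

lemma brick_family_bricks:
  assumes "0 < \<delta>" "segment_closed D"
  shows "brick_family D (bricks n \<delta> D l)"
  unfolding brick_family_def
proof (intro conjI ballI disjoint_bricks[OF assms(1)])
  fix B assume "B \<in> bricks n \<delta> D l"
  then obtain T k where "B = D \<inter> brick n \<delta> l T k" by (auto simp: bricks_def)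
  then show "openin (top_of_set D) B" "segment_closed B"
    using assms(2) segment_closed_coordinate_box open_coordinate_box
    by (auto simp: brick_def intro!: segment_closed_Int openin_open_Int)
qed

text \<open>The number \<open>N l\<close> of coordinates with \<open>c l \<le> d i\<close> grows
  with \<open>l\<close>, and \<open>l\<close> is taken least with \<open>N l \<le> l\<close>.
  Minimality gives at least \<open>l\<close> coordinates above the previous threshold, hence
  strictly above \<open>c l\<close>. The strict and the weak count are then both \<open>l\<close>,
  and no coordinate lies on the threshold.\<close>

lemma exists_threshold_level:
  fixes d :: "nat \<Rightarrow> real" and c :: "nat \<Rightarrow> real"
  assumes "\<And>l. c (Suc l) < c l"
  obtains l where "l \<le> n" "card {i. i < n \<and> c l < d i} = l" "\<And>i. i < n \<Longrightarrow> d i \<noteq> c l"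
proof -
  define N where "N l = card {i. i < n \<and> c l \<le> d i}" for l
  have "N n \<le> card {..<n}" unfolding N_def by (rule card_mono) auto
  then have ex: "N n \<le> n" by simp
  define l where "l = (LEAST l. N l \<le> l)"
  have l: "N l \<le> l" and ln: "l \<le> n" unfolding l_def using ex by (auto intro: LeastI Least_le)
  have sub: "{i. i < n \<and> c l < d i} \<subseteq> {i. i < n \<and> c l \<le> d i}" by auto
  have ge: "l \<le> card {i. i < n \<and> c l < d i}"
  proof (cases l)
    case (Suc m)
    then have "\<not> N m \<le> m" using not_less_Least[of m "\<lambda>l. N l \<le> l"] unfolding l_def[symmetric] by simp
    then have "l \<le> N m" using Suc by simp
    also have "N m \<le> card {i. i < n \<and> c l < d i}"
      unfolding N_def Suc using assms[of m] by (intro card_mono) auto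
    finally show ?thesis .
  qed simp
  have "card {i. i < n \<and> c l \<le> d i} \<le> card {i. i < n \<and> c l < d i}" using l ge by (simp add: N_def)
  then have eq: "{i. i < n \<and> c l < d i} = {i. i < n \<and> c l \<le> d i}"
    using sub by (intro card_seteq) auto
  have "card {i. i < n \<and> c l < d i} = l" using l ge eq by (simp add: N_def)
  moreover have "d i \<noteq> c l" if i: "i < n" for i
  proof
    assume "d i = c l"
    then have "i \<in> {i. i < n \<and> c l \<le> d i}" using i by simp
    then have "i \<in> {i. i < n \<and> c l < d i}" unfolding eq .
    with \<open>d i = c l\<close> show False by simp
  qed
  ultimately show thesis using that ln by blast
qed

lemma bricks_cover:
  assumes "0 < \<delta>" "x \<in> D"
  obtains l B where "l \<le> n" "B \<in> bricks n \<delta> D l" "x \<in> B"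
proof -
  define w where "w i = x i / \<delta>" for i
  define d where "d i = min (frac (w i)) (1 - frac (w i))" for i
  obtain l where l: "l \<le> n" "card {i. i < n \<and> brick_threshold l < d i} = l"
    "\<And>i. i < n \<Longrightarrow> d i \<noteq> brick_threshold l"
    using exists_threshold_level[of brick_threshold n d] brick_threshold_strict_antimono by blast
  define T where "T = {i. i < n \<and> brick_threshold l < d i}"
  \<comment> \<open>A far coordinate is labelled by the lattice cell that contains it, a near one by
    the closest integer, which is the next one if the fractional part is large.\<close>
  define k where "k i = (if i \<in> T \<or> frac (w i) < brick_threshold l then \<lfloor>w i\<rfloor> else \<lfloor>w i\<rfloor> + 1)" for i
  have w: "w i = of_int \<lfloor>w i\<rfloor> + frac (w i)" for i by (simp add: frac_def)
  have "if i \<in> T then k i + brick_threshold l < w i \<and> w i < real_of_int (k i) + 1 - brick_threshold l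
    else k i - brick_threshold l < w i \<and> w i < k i + brick_threshold l" if "i < n" for i
  proof (cases "i \<in> T")
    case True
    then show ?thesis using w[of i] by (auto simp: T_def d_def k_def)
  next
    case False
    then have d: "d i < brick_threshold l" using l(3)[OF that] that by (auto simp: T_def)
    have fr: "0 \<le> frac (w i)" "frac (w i) < 1" by (simp_all add: frac_lt_1)
    show ?thesis
    proof (cases "frac (w i) < brick_threshold l")
      case True
      then show ?thesis using w[of i] False brick_threshold_bounds[of l] fr by (simp add: k_def) linarith
    next
      case 2: False
      then have "1 - frac (w i) < brick_threshold l" using d by (simp add: d_def min_def split: if_splits)
      then show ?thesis using w[of i] False 2 brick_threshold_bounds[of l] fr by (simp add: k_def)
    qed
  qed
  then have "x \<in> brick n \<delta> l T k"
    unfolding in_brick_iff[OF assms(1)] w_def by simp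
  moreover have "T \<subseteq> {..<n}" by (auto simp: T_def)
  ultimately show thesis
    using l(1,2) assms(2) by (intro that[of l "D \<inter> brick n \<delta> l T k"]) (auto simp: bricks_def T_def)
qed

section \<open>Extending null-homotopies over the bricks of one index\<close>

lemma homotopy_of_fills_cubes_over:
  assumes V: "fills_cubes_over (Suc 0) X V"
    and a: "continuous_map (top_of_set V) X a" and b: "continuous_map (top_of_set V) X b"
  obtains e where "continuous_map (top_of_set (V \<times> {0..1::real})) X e"
    "\<And>x. x \<in> V \<Longrightarrow> e (x, 0) = a x" "\<And>x. x \<in> V \<Longrightarrow> e (x, 1) = b x"
proof -
  let ?o = "\<lambda>_::nat. 0::real"
  have a': "continuous_map (top_of_set (V \<times> cube 0)) X (\<lambda>z. a (fst z))"
    by (rule continuous_map_top_of_set_compose[OF a, of _ fst]) (auto intro: continuous_on_fst)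
  have b': "continuous_map (top_of_set (V \<times> cube 0)) X (\<lambda>z. b (fst z))"
    by (rule continuous_map_top_of_set_compose[OF b, of _ fst]) (auto intro: continuous_on_fst)
  have nb: "a (fst (x, t)) = b (fst (x, t))" if "x \<in> V" "t \<in> cube_boundary 0" for x and t :: "nat \<Rightarrow> real"
    using that by (simp add: cube_boundary_0)
  obtain K where K: "continuous_map (top_of_set (V \<times> cube 0 \<times> {0..1::real})) X K"
    "\<And>x t. x \<in> V \<Longrightarrow> t \<in> cube 0 \<Longrightarrow> K (x, t, 0) = a (fst (x, t))"
    "\<And>x t. x \<in> V \<Longrightarrow> t \<in> cube 0 \<Longrightarrow> K (x, t, 1) = b (fst (x, t))"
    by (rule fills_cubes_over_homotopy[OF V a' b'], erule (1) nb, rule that)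
  have "continuous_map (top_of_set (V \<times> {0..1})) X (\<lambda>z. K (fst z, ?o, snd z))"
    by (rule continuous_map_top_of_set_compose[OF K(1), of _ "\<lambda>z. (fst z, ?o, snd z)"])
       (auto simp: cube_0 intro!: continuous_on_Pair continuous_on_fst continuous_on_snd continuous_on_const continuous_on_id)
  then show thesis
    using K(2,3) by (intro that) (auto simp: cube_0)
qed

text \<open>The case of the \<open>1\<close>-cube in \<open>fills_cubes_over_homotopy\<close>, with
  that cube replaced by the real interval: \<open>t\<close> is the time of the two given homotopies,
  \<open>r\<close> the time of the homotopy between them.\<close>

lemma homotopy_rel_of_fills_cubes_over:
  assumes W: "fills_cubes_over (Suc (Suc 0)) X W"
    and h: "continuous_map (top_of_set (W \<times> {0..1::real})) X h"
    and e: "continuous_map (top_of_set (W \<times> {0..1::real})) X e"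
    and eq: "\<And>x t. x \<in> W \<Longrightarrow> t \<in> {0, 1} \<Longrightarrow> h (x, t) = e (x, t)"
  obtains K where "continuous_map (top_of_set (W \<times> {0..1::real} \<times> {0..1::real})) X K"
    "\<And>x t. x \<in> W \<Longrightarrow> t \<in> {0..1} \<Longrightarrow> K (x, t, 0) = h (x, t)"
    "\<And>x t. x \<in> W \<Longrightarrow> t \<in> {0..1} \<Longrightarrow> K (x, t, 1) = e (x, t)"
    "\<And>x t r. x \<in> W \<Longrightarrow> t \<in> {0, 1} \<Longrightarrow> r \<in> {0..1} \<Longrightarrow> K (x, t, r) = h (x, t)"
proof -
  define \<iota> where "\<iota> r = (\<lambda>i::nat. if i = 0 then r else 0)" for r :: real
  have \<iota>0: "\<iota> r 0 = r" for r by (simp add: \<iota>_def)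
  have cube1: "cube (Suc 0) = \<iota> ` {0..1}" unfolding cube_Suc_0 \<iota>_def ..
  have bd1: "t 0 \<in> {0, 1}" if "t \<in> cube_boundary (Suc 0)" for t
    using that by (auto simp: cube_boundary_def)
  have \<iota>bd: "\<iota> t \<in> cube_boundary (Suc 0)" if "t \<in> {0, 1}" for t
    using that cube1 by (auto simp: cube_boundary_def \<iota>0)
  have c: "continuous_on S (\<lambda>z. (fst z, snd z 0))" for S :: "((nat \<Rightarrow> real) \<times> (nat \<Rightarrow> real)) set"
    by (intro continuous_on_Pair continuous_on_fst continuous_on_coordinate continuous_on_snd continuous_on_id)
  have h': "continuous_map (top_of_set (W \<times> cube (Suc 0))) X (\<lambda>z. h (fst z, snd z 0))"
    by (rule continuous_map_top_of_set_compose[OF h c _ refl]) (auto simp: cube1 \<iota>0)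
  have e': "continuous_map (top_of_set (W \<times> cube (Suc 0))) X (\<lambda>z. e (fst z, snd z 0))"
    by (rule continuous_map_top_of_set_compose[OF e c _ refl]) (auto simp: cube1 \<iota>0)
  have eq': "h (fst (x, t), snd (x, t) 0) = e (fst (x, t), snd (x, t) 0)"
    if "x \<in> W" "t \<in> cube_boundary (Suc 0)" for x t
    using eq[OF that(1) bd1[OF that(2)]] by simp
  obtain K where K: "continuous_map (top_of_set (W \<times> cube (Suc 0) \<times> {0..1::real})) X K"
    "\<And>x t. x \<in> W \<Longrightarrow> t \<in> cube (Suc 0) \<Longrightarrow> K (x, t, 0) = h (fst (x, t), snd (x, t) 0)"
    "\<And>x t. x \<in> W \<Longrightarrow> t \<in> cube (Suc 0) \<Longrightarrow> K (x, t, 1) = e (fst (x, t), snd (x, t) 0)"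
    "\<And>x t r. x \<in> W \<Longrightarrow> t \<in> cube_boundary (Suc 0) \<Longrightarrow> r \<in> {0..1} \<Longrightarrow> K (x, t, r) = h (fst (x, t), snd (x, t) 0)"
    by (rule fills_cubes_over_homotopy[OF W h' e'], erule (1) eq', rule that)
  have "continuous_on S (\<lambda>z. \<iota> (f z))" if "continuous_on S f" for S :: "((nat \<Rightarrow> real) \<times> real \<times> real) set" and f
    unfolding \<iota>_def
  proof (rule continuous_on_coordinatewise_then_product)
    show "continuous_on S (\<lambda>z. if i = 0 then f z else 0)" for i :: nat
      using that by (cases "i = 0") auto
  qed
  note c\<iota> = this
  have "continuous_on S (\<lambda>z. (fst z, \<iota> (fst (snd z)), snd (snd z)))" for S :: "((nat \<Rightarrow> real) \<times> real \<times> real) set"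
    by (intro continuous_on_Pair c\<iota> continuous_on_fst continuous_on_snd continuous_on_id)
  then have "continuous_map (top_of_set (W \<times> {0..1} \<times> {0..1})) X (\<lambda>z. K (fst z, \<iota> (fst (snd z)), snd (snd z)))"
    by (rule continuous_map_top_of_set_compose[OF K(1) _ _ refl]) (auto simp: cube1)
  then show thesis
    using K(2-4) \<iota>bd by (intro that) (auto simp: cube1 \<iota>0)
qed

text \<open>\<open>h\<close> lives on the collar \<open>Z0\<close> and has to survive unchanged on
  the core \<open>C\<close>. Bricks inside \<open>Z0\<close> can use \<open>h\<close>; by
  \<open>FC\<close> the others miss \<open>C\<close>, so adding them family by family, with
  corrections only where they overlap what is already there, leaves the core alone.\<close>

lemma extend_nullhomotopy_over_bricks:
  fixes Z0 C D :: "(nat \<Rightarrow> real) set" and h :: "(nat \<Rightarrow> real) \<times> real \<Rightarrow> 'a"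
  assumes fill: "\<And>j. j \<le> Suc s \<Longrightarrow> fills_cubes j X" and x0: "x0 \<in> topspace X"
    and F: "\<And>j. j \<le> s \<Longrightarrow> brick_family D (F j)"
    and u: "continuous_map (top_of_set D) X u"
    and C: "openin (top_of_set D) C" "C \<subseteq> Z0"
    and h: "continuous_map (top_of_set (Z0 \<times> {0..1})) X h"
    and h0: "\<And>x. x \<in> Z0 \<Longrightarrow> h (x, 0) = u x" and h1: "\<And>x. x \<in> Z0 \<Longrightarrow> h (x, 1) = x0"
    and FC: "\<And>j B. j \<le> s \<Longrightarrow> B \<in> F j \<Longrightarrow> B \<subseteq> Z0 \<or> B \<inter> C = {}"
  obtains G where "continuous_map (top_of_set ((C \<union> (\<Union>j\<le>s. \<Union>(F j))) \<times> {0..1})) X G"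
    "\<And>x. x \<in> C \<union> (\<Union>j\<le>s. \<Union>(F j)) \<Longrightarrow> G (x, 0) = u x"
    "\<And>x. x \<in> C \<union> (\<Union>j\<le>s. \<Union>(F j)) \<Longrightarrow> G (x, 1) = x0"
    "\<And>x t. x \<in> C \<Longrightarrow> t \<in> {0..1} \<Longrightarrow> G (x, t) = h (x, t)"
proof -
  \<comment> \<open>After \<open>j\<close> rounds the families below \<open>j\<close> are complete,
    while of the others only the bricks inside \<open>Z0\<close> are present.\<close>
  define E where "E j l = (if l < j then F l else {B \<in> F l. B \<subseteq> Z0})" for j l
  define Z where "Z j = C \<union> (\<Union>l\<le>s. \<Union>(E j l))" for j
  have EF: "E j l \<subseteq> F l" for j l by (auto simp: E_def)
  have subD: "\<Union>(F l) \<subseteq> D" if "l \<le> s" for l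
    using F[OF that] openin_imp_subset unfolding brick_family_def by blast
  have bE: "brick_family D (E j l)" if "l \<le> s" for j l
    using F[OF that] EF by (rule brick_family_subset)
  have oU: "openin (top_of_set D) (\<Union>A)" if "brick_family D A" for A
    using that unfolding brick_family_def by (intro openin_Union) blast
  have oZ: "openin (top_of_set D) (Z j)" for j
    unfolding Z_def by (intro openin_Un C(1) openin_Union) (use bE oU in auto)
  have "\<exists>G. continuous_map (top_of_set (Z j \<times> {0..1})) X G \<and> (\<forall>x\<in>Z j. G (x, 0) = u x) \<and>
      (\<forall>x\<in>Z j. G (x, 1) = x0) \<and> (\<forall>x\<in>C. \<forall>t\<in>{0..1}. G (x, t) = h (x, t))" if "j \<le> Suc s" for j
    using that
  proof (induction j)
    case 0
    have "Z 0 \<subseteq> Z0" using C(2) by (auto simp: Z_def E_def)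
    then have "continuous_map (top_of_set (Z 0 \<times> {0..1})) X h"
      by (intro continuous_map_top_of_set_subset[OF h]) auto
    with \<open>Z 0 \<subseteq> Z0\<close> h0 h1 show ?case by blast
  next
    case (Suc j)
    then obtain G where G: "continuous_map (top_of_set (Z j \<times> {0..1})) X G"
      and G0: "\<And>x. x \<in> Z j \<Longrightarrow> G (x, 0) = u x" and G1: "\<And>x. x \<in> Z j \<Longrightarrow> G (x, 1) = x0"
      and GC: "\<And>x t. x \<in> C \<Longrightarrow> t \<in> {0..1} \<Longrightarrow> G (x, t) = h (x, t)" by force
    have j: "j \<le> s" using Suc by simp
    define N where "N = {B \<in> F j. \<not> B \<subseteq> Z0}"
    define V where "V = \<Union>N"
    have bN: "brick_family D N" by (rule brick_family_subset[OF F[OF j]]) (auto simp: N_def)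
    have VD: "V \<subseteq> D" using subD[OF j] by (auto simp: V_def N_def)
    have VC: "V \<inter> C = {}" using FC[OF j] by (auto simp: V_def N_def)
    have ZS: "Z (Suc j) = Z j \<union> V"
    proof -
      have "\<Union>(E (Suc j) l) = \<Union>(E j l) \<union> (if l = j then V else {})" for l
        by (auto simp: E_def V_def N_def)
      then show ?thesis using j by (auto simp: Z_def split: if_splits)
    qed
    have uV: "continuous_map (top_of_set V) X u"
      by (rule continuous_map_top_of_set_subset[OF u]) (use VD in auto)
    have cV: "continuous_map (top_of_set V) X (\<lambda>_. x0)" using x0 by simp
    have fV: "fills_cubes_over (Suc 0) X V"
      unfolding V_def
      by (intro fills_cubes_over_brick_family fill brick_family_mono[OF bN subset_refl VD[unfolded V_def]]) simp
    obtain e where e: "continuous_map (top_of_set (V \<times> {0..1::real})) X e"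
      and e0: "\<And>x. x \<in> V \<Longrightarrow> e (x, 0) = u x" and e1: "\<And>x. x \<in> V \<Longrightarrow> e (x, 1) = x0"
      by (rule homotopy_of_fills_cubes_over[OF fV uV cV]) (rule that)
    define W where "W = Z j \<inter> V"
    have fW: "fills_cubes_over (Suc (Suc 0)) X W"
    proof (rule fills_cubes_over_brick_families[where s = s])
      let ?F = "\<lambda>l. (\<lambda>(A, B). A \<inter> B) ` (E j l \<times> N)"
      have UF: "\<Union>(?F l) = \<Union>(E j l) \<inter> V" for l by (auto simp: V_def)
      show "finite ({..s} - {j})" by simp
      \<comment> \<open>Old and new bricks of the same family are disjoint, so family
        \<open>j\<close> drops out of the overlap. Only \<open>s\<close> families remain, and
        filling \<open>2\<close>-cubes over them exhausts the bound \<open>s + 2\<close>.\<close>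
      have "\<Union>(E j j) \<inter> V = {}"
      proof (rule equals0I)
        fix x assume "x \<in> \<Union>(E j j) \<inter> V"
        then obtain A B where "x \<in> A" "x \<in> B" "A \<in> F j" "B \<in> F j" "A \<subseteq> Z0" "\<not> B \<subseteq> Z0"
          by (auto simp: E_def V_def N_def)
        then show False using F[OF j] unfolding brick_family_def disjoint_def by blast
      qed
      then have "Z j \<inter> V = (\<Union>l\<in>{..s} - {j}. \<Union>(E j l) \<inter> V)"
        using VC by (auto simp: Z_def)
      then show "W = (\<Union>l\<in>{..s} - {j}. \<Union>(?F l))" by (simp only: UF W_def)
      show "brick_family W (?F l)" if "l \<in> {..s} - {j}" for l
      proof (rule brick_family_mono[of D])
        show "brick_family D (?F l)" using that bE bN by (intro brick_family_Int) auto
        show "W \<subseteq> D" using VD by (auto simp: W_def)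
        show "\<Union>(?F l) \<subseteq> W" unfolding UF W_def Z_def using that by auto
      qed
      show "card ({..s} - {j}) + Suc (Suc 0) \<le> s + 2" using j by simp
    qed (rule fill)
    have GW: "continuous_map (top_of_set (W \<times> {0..1})) X G"
      by (rule continuous_map_top_of_set_subset[OF G]) (auto simp: W_def)
    have eW: "continuous_map (top_of_set (W \<times> {0..1})) X e"
      by (rule continuous_map_top_of_set_subset[OF e]) (auto simp: W_def)
    have eqW: "G (x, t) = e (x, t)" if "x \<in> W" "t \<in> {0, 1}" for x t
      using that G0 G1 e0 e1 by (auto simp: W_def)
    obtain K where K: "continuous_map (top_of_set (W \<times> {0..1::real} \<times> {0..1::real})) X K"
      "\<And>x t. x \<in> W \<Longrightarrow> t \<in> {0..1} \<Longrightarrow> K (x, t, 0) = G (x, t)"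
      "\<And>x t. x \<in> W \<Longrightarrow> t \<in> {0..1} \<Longrightarrow> K (x, t, 1) = e (x, t)"
      and Kb: "\<And>x t r. x \<in> W \<Longrightarrow> t \<in> {0, 1} \<Longrightarrow> r \<in> {0..1} \<Longrightarrow> K (x, t, r) = G (x, t)"
      by (rule homotopy_rel_of_fills_cubes_over[OF fW GW eW], erule (1) eqW, rule that)
    have sub: "Z j \<union> V \<subseteq> D" using VD openin_imp_subset[OF oZ[of j]] by auto
    have o1: "openin (top_of_set (Z j \<union> V)) (Z j)"
      using oZ[of j] sub by (meson Un_upper1 openin_subset_trans)
    have o2: "openin (top_of_set (Z j \<union> V)) V"
      using oU[OF bN] sub unfolding V_def by (meson Un_upper2 openin_subset_trans)
    obtain G' where G': "continuous_map (top_of_set ((Z j \<union> V) \<times> {0..1})) X G'"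
      and GZ: "\<And>x t. x \<in> Z j - V \<Longrightarrow> t \<in> {0..1} \<Longrightarrow> G' (x, t) = G (x, t)"
      and GV: "\<And>x t. x \<in> V - Z j \<Longrightarrow> t \<in> {0..1} \<Longrightarrow> G' (x, t) = e (x, t)"
      and GK: "\<And>x t. x \<in> Z j \<inter> V \<Longrightarrow> t \<in> {0..1} \<Longrightarrow> \<exists>r\<in>{0..1}. G' (x, t) = K (x, t, r)"
      by (rule glue_along_homotopy[OF o1 o2 G e K(1)[unfolded W_def]],
          erule (1) K(2)[unfolded W_def], erule (1) K(3)[unfolded W_def], rule that)
    have ends: "G' (x, 0) = u x \<and> G' (x, 1) = x0" if x: "x \<in> Z j \<union> V" for x
    proof -
      consider "x \<in> Z j - V" | "x \<in> V - Z j" | "x \<in> W" using x by (auto simp: W_def)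
      then show ?thesis
      proof cases
        case 1 then show ?thesis using GZ G0 G1 by auto
      next
        case 2 then show ?thesis using GV e0 e1 by auto
      next
        case 3
        then obtain r0 r1 where "r0 \<in> {0..1}" "G' (x, 0) = K (x, 0, r0)" "r1 \<in> {0..1}" "G' (x, 1) = K (x, 1, r1)"
          using GK[of x 0] GK[of x 1] by (auto simp: W_def)
        with 3 show ?thesis using Kb G0 G1 by (auto simp: W_def)
      qed
    qed
    moreover have "G' (x, t) = h (x, t)" if "x \<in> C" "t \<in> {0..1}" for x t
    proof -
      have "x \<in> Z j - V" using that VC by (auto simp: Z_def)
      then show ?thesis using GZ GC that by simp
    qed
    ultimately show ?case using G' unfolding ZS by blast
  qed
  from this[of "Suc s"] obtain G where *: "continuous_map (top_of_set (Z (Suc s) \<times> {0..1})) X G"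
      "\<forall>x\<in>Z (Suc s). G (x, 0) = u x" "\<forall>x\<in>Z (Suc s). G (x, 1) = x0" "\<forall>x\<in>C. \<forall>t\<in>{0..1}. G (x, t) = h (x, t)"
    by auto
  have "Z (Suc s) = C \<union> (\<Union>j\<le>s. \<Union>(F j))" by (auto simp: Z_def E_def)
  with * show thesis by (intro that[of G]) auto
qed

section \<open>Covers with null-homotopies over a disc\<close>

text \<open>\<open>H i\<close> carries information only where \<open>f i\<close> is positive. A map
  \<open>u\<close> stands in place of the inclusion so that the notion pulls back along
  characteristic maps of cells.\<close>

definition null_cover :: "nat \<Rightarrow> 'b topology \<Rightarrow> 'a topology \<Rightarrow> ('b \<Rightarrow> 'a) \<Rightarrow> 'a \<Rightarrow>
    (nat \<Rightarrow> 'b \<Rightarrow> real) \<Rightarrow> (nat \<Rightarrow> 'b \<times> real \<Rightarrow> 'a) \<Rightarrow> bool" where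
  "null_cover k T X u x0 f H \<longleftrightarrow>
     (\<forall>i<k. continuous_map T euclideanreal (f i) \<and> (\<forall>x\<in>topspace T. 0 \<le> f i x \<and> f i x \<le> 1) \<and>
        continuous_map (prod_topology (subtopology T {x. 0 < f i x}) (top_of_set {0..1})) X (H i) \<and>
        (\<forall>x\<in>topspace T. 0 < f i x \<longrightarrow> H i (x, 0) = u x \<and> H i (x, 1) = x0)) \<and>
     (\<forall>x\<in>topspace T. \<exists>i<k. f i x = 1)"

lemma null_cover_top_of_set:
  "null_cover k (top_of_set D) X u x0 f H \<longleftrightarrow>
     (\<forall>i<k. continuous_on D (f i) \<and> (\<forall>x\<in>D. 0 \<le> f i x \<and> f i x \<le> 1) \<and>
        continuous_map (top_of_set ({x \<in> D. 0 < f i x} \<times> {0..1})) X (H i) \<and>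
        (\<forall>x\<in>D. 0 < f i x \<longrightarrow> H i (x, 0) = u x \<and> H i (x, 1) = x0)) \<and>
     (\<forall>x\<in>D. \<exists>i<k. f i x = 1)"
proof -
  have "prod_topology (subtopology (top_of_set D) {x. 0 < f i x}) (top_of_set {0..1::real}) =
      top_of_set ({x \<in> D. 0 < f i x} \<times> {0..1})" for i
  proof -
    have "D \<inter> {x. 0 < f i x} = {x \<in> D. 0 < f i x}" by auto
    then show ?thesis by (simp add: subtopology_subtopology)
  qed
  then show ?thesis by (simp add: null_cover_def)
qed

lemma sup_norm_attained: "0 < p \<Longrightarrow> \<exists>i<p. sup_norm p v = \<bar>v i\<bar>"
proof (induction p)
  case (Suc p)
  show ?case
  proof (cases "p = 0")
    case False
    then obtain i where "i < p" "sup_norm p v = \<bar>v i\<bar>" using Suc by auto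
    then show ?thesis by (cases "\<bar>v i\<bar> \<le> \<bar>v p\<bar>") (auto simp: max_def intro: less_SucI)
  qed auto
qed simp

text \<open>Distances to the complements of the \<open>W i\<close>, divided by their maximum. If a
  complement is empty the distance is set to \<open>1\<close>, because \<open>infdist\<close> would
  return \<open>0\<close>.\<close>

lemma max_normalised_functions:
  fixes D :: "'b::metric_space set"
  assumes W: "\<And>i. i < k \<Longrightarrow> openin (top_of_set D) (W i)" and cover: "D \<subseteq> (\<Union>i<k. W i)"
  obtains \<rho> :: "nat \<Rightarrow> 'b \<Rightarrow> real" where "\<And>i. i < k \<Longrightarrow> continuous_on D (\<rho> i)"
    "\<And>i x. i < k \<Longrightarrow> x \<in> D \<Longrightarrow> 0 \<le> \<rho> i x \<and> \<rho> i x \<le> 1"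
    "\<And>i x. i < k \<Longrightarrow> x \<in> D \<Longrightarrow> 0 < \<rho> i x \<Longrightarrow> x \<in> W i"
    "\<And>x. x \<in> D \<Longrightarrow> \<exists>i<k. \<rho> i x = 1"
proof -
  define a where "a i x = (if D - W i = {} then 1 else infdist x (D - W i))" for i and x :: 'b
  define m where "m x = sup_norm k (\<lambda>i. a i x)" for x
  have a0: "0 \<le> a i x" for i x by (simp add: a_def infdist_nonneg)
  have a_iff: "0 < a i x \<longleftrightarrow> x \<in> W i" if "i < k" "x \<in> D" for i x
  proof -
    have "closedin (top_of_set D) (D - W i)" using W[OF that(1)] by (simp add: closedin_diff)
    then show ?thesis
      using that(2) infdist_eq_0_iff_relclosed[of D "D - W i" x] infdist_nonneg[of x "D - W i"]
      by (auto simp: a_def order_less_le)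
  qed
  have ca: "continuous_on D (a i)" for i
    unfolding a_def by (cases "D - W i = {}") (auto intro!: continuous_intros)
  have le: "a i x \<le> m x" if "i < k" for i x
    using sup_norm_ge[of i k "\<lambda>i. a i x"] that a0[of i x] by (simp add: m_def)
  have m: "0 < m x" if x: "x \<in> D" for x
  proof -
    obtain i where "i < k" "x \<in> W i" using cover x by auto
    then have "0 < a i x" using a_iff x by simp
    then show ?thesis using le[OF \<open>i < k\<close>, of x] by simp
  qed
  have cm: "continuous_on D m"
    unfolding m_def by (intro continuous_on_sup_norm ca)
  show thesis
  proof
    show "continuous_on D (\<lambda>x. a i x / m x)" for i
      by (intro continuous_on_divide ca cm) (use m in force)
    show "0 \<le> a i x / m x \<and> a i x / m x \<le> 1" if "i < k" "x \<in> D" for i x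
      using a0[of i x] m[OF that(2)] le[OF that(1), of x] by simp
    show "x \<in> W i" if "i < k" "x \<in> D" "0 < a i x / m x" for i x
      using that m[OF that(2)] a_iff[OF that(1,2)] by (simp add: zero_less_divide_iff)
    show "\<exists>i<k. a i x / m x = 1" if x: "x \<in> D" for x
    proof -
      have "0 < k" using cover x by auto
      then obtain i where "i < k" "m x = \<bar>a i x\<bar>"
        using sup_norm_attained[of k "\<lambda>i. a i x"] by (auto simp: m_def)
      then show ?thesis using m[OF x] a0[of i x] by (intro exI[of _ i]) auto
    qed
  qed
qed

text \<open>By compactness the distance attains its minimum, which is positive because points with
  vanishing coordinates from \<open>n\<close> on are told apart by the first \<open>n\<close>. The
  sup norm is used since it measures the size of bricks.\<close>

lemma coordinate_separation:
  assumes "compact K" "compact L" "K \<inter> L = {}" and sub: "\<And>x i. x \<in> K \<union> L \<Longrightarrow> n \<le> i \<Longrightarrow> x i = 0"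
  obtains \<delta> where "0 < \<delta>" "\<And>x y. x \<in> K \<Longrightarrow> y \<in> L \<Longrightarrow> \<delta> \<le> sup_norm n (\<lambda>i. x i - y i)"
proof (cases "K \<times> L = {}")
  case True
  then show thesis using that[of 1] by auto
next
  case False
  define \<nu> where "\<nu> z = sup_norm n (\<lambda>i. fst z i - snd z i)" for z :: "(nat \<Rightarrow> real) \<times> (nat \<Rightarrow> real)"
  have "continuous_on (K \<times> L) \<nu>"
    unfolding \<nu>_def
    by (intro continuous_on_sup_norm continuous_on_diff continuous_on_coordinate continuous_on_fst continuous_on_snd continuous_on_id)
  then obtain z where z: "z \<in> K \<times> L" "\<And>w. w \<in> K \<times> L \<Longrightarrow> \<nu> z \<le> \<nu> w"
    using continuous_attains_inf[OF compact_Times[OF assms(1,2)] False] by blast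
  have "\<nu> z \<noteq> 0"
  proof
    assume "\<nu> z = 0"
    then have "fst z i = snd z i" for i
      using z(1) sub[of "fst z" i] sub[of "snd z" i] by (cases "i < n") (auto simp: \<nu>_def sup_norm_eq_0_iff)
    then have "fst z = snd z" by auto
    with z(1) assms(3) show False by auto
  qed
  then have "0 < \<nu> z" using sup_norm_nonneg by (simp add: \<nu>_def order_less_le)
  then show thesis
    by (rule that) (use z(2) in \<open>auto simp: \<nu>_def\<close>)
qed

section \<open>Discs and radial projection\<close>

abbreviation radius :: "nat \<Rightarrow> (nat \<Rightarrow> real) \<Rightarrow> real" where
  "radius n x \<equiv> L2_set x {..<n}"

lemma disc_iff: "x \<in> disc n \<longleftrightarrow> (\<forall>i\<ge>n. x i = 0) \<and> radius n x \<le> 1"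
  by (simp add: disc_def topspace_Euclidean_space L2_set_def)

lemma open_disc_iff: "x \<in> open_disc n \<longleftrightarrow> (\<forall>i\<ge>n. x i = 0) \<and> radius n x < 1"
  by (simp add: open_disc_def topspace_Euclidean_space L2_set_def)

lemma disc_boundary_iff: "x \<in> disc_boundary n \<longleftrightarrow> (\<forall>i\<ge>n. x i = 0) \<and> radius n x = 1"
  by (simp add: disc_boundary_def topspace_Euclidean_space L2_set_def)

lemma disc_eq: "disc n = open_disc n \<union> disc_boundary n" "open_disc n \<inter> disc_boundary n = {}"
  by (auto simp: disc_iff open_disc_iff disc_boundary_iff)

lemma radius_scale: "radius n (\<lambda>i. c * x i) = \<bar>c\<bar> * radius n x"
  by (simp add: L2_set_def power_mult_distrib sum_distrib_left[symmetric] real_sqrt_mult)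

lemma continuous_on_radius: "continuous_on S f \<Longrightarrow> continuous_on S (\<lambda>x. radius n (f x))"
  unfolding L2_set_def
  by (intro continuous_on_real_sqrt continuous_on_sum continuous_on_power continuous_on_coordinate)

lemma segment_closed_disc: "segment_closed (disc n)"
  unfolding segment_closed_def
proof (intro ballI)
  fix x y and r :: real assume *: "x \<in> disc n" "y \<in> disc n" "r \<in> {0..1}"
  have "radius n (\<lambda>i. (1 - r) * x i + r * y i) \<le> radius n (\<lambda>i. (1 - r) * x i) + radius n (\<lambda>i. r * y i)"
    by (rule L2_set_triangle_ineq)
  also have "\<dots> \<le> (1 - r) * 1 + r * 1"
    using * by (intro add_mono) (auto simp: radius_scale disc_iff intro: mult_left_le)
  finally show "(\<lambda>i. (1 - r) * x i + r * y i) \<in> disc n"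
    using * by (simp add: disc_iff)
qed

lemma compact_disc: "compact (disc n)"
proof -
  let ?P = "PiE UNIV (\<lambda>i. if i < n then {-1..1::real} else {0})"
  have "compactin (powertop_real UNIV) ?P"
    by (subst compactin_PiE) auto
  then have "compact ?P" by (simp add: euclidean_product_topology)
  moreover have "closed {x. radius n x \<le> 1}"
    by (intro closed_Collect_le continuous_on_radius continuous_on_id continuous_on_const)
  ultimately have "compact (?P \<inter> {x. radius n x \<le> 1})" by (rule compact_Int_closed)
  moreover have "?P \<inter> {x. radius n x \<le> 1} = disc n"
  proof
    show "?P \<inter> {x. radius n x \<le> 1} \<subseteq> disc n"
    proof
      fix x assume x: "x \<in> ?P \<inter> {x. radius n x \<le> 1}"
      have "x i = 0" if "n \<le> i" for i
        using PiE_mem[OF IntD1[OF x] UNIV_I, of i] that by simp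
      then show "x \<in> disc n" using x by (simp add: disc_iff)
    qed
    show "disc n \<subseteq> ?P \<inter> {x. radius n x \<le> 1}"
    proof
      fix x assume x: "x \<in> disc n"
      have "radius n (\<lambda>i. \<bar>x i\<bar>) = radius n x" by (simp add: L2_set_def)
      then have "\<bar>x i\<bar> \<le> 1" if "i < n" for i
        using x member_le_L2_set[of "{..<n}" i "\<lambda>i. \<bar>x i\<bar>"] that by (simp add: disc_iff)
      then have "x i \<in> (if i < n then {-1..1} else {0})" for i
        using x by (simp add: disc_iff abs_le_iff)
      then show "x \<in> ?P \<inter> {x. radius n x \<le> 1}"
        using x unfolding disc_iff PiE_UNIV_domain by blast
    qed
  qed
  ultimately show ?thesis by simp
qed

lemma top_of_set_disc:
  "subtopology (Euclidean_space n) (disc n) = top_of_set (disc n)"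
  "subtopology (Euclidean_space n) (open_disc n) = top_of_set (open_disc n)"
proof -
  have "{x. \<forall>i\<ge>n. x i = (0::real)} \<inter> disc n = disc n" "{x. \<forall>i\<ge>n. x i = (0::real)} \<inter> open_disc n = open_disc n"
    by (auto simp: disc_iff open_disc_iff)
  then show "subtopology (Euclidean_space n) (disc n) = top_of_set (disc n)"
    "subtopology (Euclidean_space n) (open_disc n) = top_of_set (open_disc n)"
    by (simp_all add: Euclidean_space_def euclidean_product_topology subtopology_subtopology)
qed

definition radial :: "nat \<Rightarrow> (nat \<Rightarrow> real) \<Rightarrow> nat \<Rightarrow> real" where
  "radial n x = (\<lambda>i. x i / radius n x)"

lemma radial_in_boundary: "x \<in> disc n \<Longrightarrow> 0 < radius n x \<Longrightarrow> radial n x \<in> disc_boundary n"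
  using radius_scale[of "1 / radius n x" x n] by (simp add: disc_iff disc_boundary_iff radial_def)

lemma radial_boundary: "x \<in> disc_boundary n \<Longrightarrow> radial n x = x"
  by (simp add: radial_def disc_boundary_iff)

lemma continuous_on_scaling:
  fixes f :: "'b::topological_space \<Rightarrow> nat \<Rightarrow> real"
  assumes "continuous_on S c" "continuous_on S f"
  shows "continuous_on S (\<lambda>x. (\<lambda>i. c x * f x i))"
  by (rule continuous_on_coordinatewise_then_product)
     (intro continuous_on_mult assms continuous_on_coordinate)

lemma continuous_on_radial:
  assumes "continuous_on S f" "\<And>x. x \<in> S \<Longrightarrow> 0 < radius n (f x)"
  shows "continuous_on S (\<lambda>x. radial n (f x))"
proof -
  have "continuous_on S (\<lambda>x. (\<lambda>i. inverse (radius n (f x)) * f x i))"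
    by (intro continuous_on_scaling continuous_on_inverse continuous_on_radius assms(1)) (use assms(2) in force)
  then show ?thesis by (simp add: radial_def divide_inverse mult.commute)
qed

text \<open>A point of radius \<open>r\<close> first moves outwards along its ray at unit speed,
  reaches the boundary at time \<open>1 - r\<close>, and spends the remaining time \<open>r\<close>
  following \<open>H\<close>. On the boundary itself this is \<open>H\<close>.\<close>

lemma null_cover_collar:
  fixes H :: "(nat \<Rightarrow> real) \<times> real \<Rightarrow> 'a"
  assumes u: "continuous_map (top_of_set (disc n)) X u"
    and A: "\<And>x. x \<in> A \<Longrightarrow> x \<in> disc n \<and> 0 < radius n x \<and> radial n x \<in> P" and P: "P \<subseteq> disc_boundary n"
    and H: "continuous_map (top_of_set (P \<times> {0..1})) X H"
    and H0: "\<And>x. x \<in> P \<Longrightarrow> H (x, 0) = u x" and H1: "\<And>x. x \<in> P \<Longrightarrow> H (x, 1) = x0"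
  obtains h where "continuous_map (top_of_set (A \<times> {0..1})) X h"
    "\<And>x. x \<in> A \<Longrightarrow> h (x, 0) = u x" "\<And>x. x \<in> A \<Longrightarrow> h (x, 1) = x0"
    "\<And>x t. x \<in> P \<Longrightarrow> t \<in> {0..1} \<Longrightarrow> h (x, t) = H (x, t)"
proof -
  let ?r = "\<lambda>z::(nat \<Rightarrow> real) \<times> real. radius n (fst z)"
  define h where "h z = (if snd z \<le> 1 - ?r z then u (\<lambda>i. ((?r z + snd z) / ?r z) * fst z i)
    else H (radial n (fst z), (snd z - (1 - ?r z)) / ?r z))" for z
  have cr: "continuous_on S ?r" for S
    by (intro continuous_on_radius continuous_on_fst continuous_on_id)
  have cs: "continuous_on S snd" for S :: "((nat \<Rightarrow> real) \<times> real) set"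
    by (intro continuous_on_snd continuous_on_id)
  have cf: "continuous_on S fst" for S :: "((nat \<Rightarrow> real) \<times> real) set"
    by (intro continuous_on_fst continuous_on_id)
  have rpos: "0 < ?r z" if "z \<in> A \<times> {0..1}" for z using A that by auto
  have "continuous_map (top_of_set (A \<times> {0..1})) X h"
    unfolding h_def
  proof (rule continuous_map_top_of_set_cases_le)
    show "continuous_on (A \<times> {0..1::real}) snd" by (rule cs)
    show "continuous_on (A \<times> {0..1}) (\<lambda>z. 1 - ?r z)"
      by (intro continuous_on_diff continuous_on_const cr)
    let ?S = "{z \<in> A \<times> {0..1}. snd z \<le> 1 - ?r z}"
    have 1: "continuous_on ?S (\<lambda>z. (\<lambda>i. ((?r z + snd z) / ?r z) * fst z i))"
      by (intro continuous_on_scaling continuous_on_divide continuous_on_add cr cs cf) (use rpos in force)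
    show "continuous_map (top_of_set ?S) X (\<lambda>z. u (\<lambda>i. ((?r z + snd z) / ?r z) * fst z i))"
    proof (rule continuous_map_top_of_set_compose[OF u 1 _ refl], rule image_subsetI)
      fix z assume z: "z \<in> ?S"
      then have "radius n (\<lambda>i. ((?r z + snd z) / ?r z) * fst z i) = ?r z + snd z"
        using rpos[of z] by (subst radius_scale) auto
      then show "(\<lambda>i. ((?r z + snd z) / ?r z) * fst z i) \<in> disc n"
        using z A[of "fst z"] by (auto simp: disc_iff)
    qed
    let ?S = "{z \<in> A \<times> {0..1}. 1 - ?r z \<le> snd z}"
    have 2: "continuous_on ?S (\<lambda>z. (radial n (fst z), (snd z - (1 - ?r z)) / ?r z))"
      by (intro continuous_on_Pair continuous_on_radial continuous_on_divide continuous_on_diff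
          continuous_on_const cr cs cf) (use rpos in force)+
    show "continuous_map (top_of_set ?S) X (\<lambda>z. H (radial n (fst z), (snd z - (1 - ?r z)) / ?r z))"
    proof (rule continuous_map_top_of_set_compose[OF H 2 _ refl], rule image_subsetI)
      fix z assume z: "z \<in> ?S"
      then show "(radial n (fst z), (snd z - (1 - ?r z)) / ?r z) \<in> P \<times> {0..1}"
        using A[of "fst z"] by auto
    qed
    fix z assume z: "z \<in> A \<times> {0..1}" "snd z = 1 - ?r z"
    have "H (radial n (fst z), 0) = u (radial n (fst z))"
      using A[of "fst z"] z by (intro H0) auto
    then show "u (\<lambda>i. ((?r z + snd z) / ?r z) * fst z i) = H (radial n (fst z), (snd z - (1 - ?r z)) / ?r z)"
      using z by (simp add: radial_def)
  qed
  moreover have "h (x, 0) = u x" "h (x, 1) = x0" if "x \<in> A" for x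
  proof -
    have x: "x \<in> disc n" "0 < radius n x" "radial n x \<in> P" using A[OF that] by auto
    then show "h (x, 0) = u x" "h (x, 1) = x0"
      using H1[OF x(3)] by (auto simp: h_def disc_iff)
  qed
  moreover have "h (x, t) = H (x, t)" if "x \<in> P" "t \<in> {0..1}" for x t
  proof -
    have b: "x \<in> disc_boundary n" using that P by auto
    then have r: "radius n x = 1" by (simp add: disc_boundary_iff)
    show ?thesis
      using that H0[OF that(1)] radial_boundary[OF b] by (auto simp: h_def r)
  qed
  ultimately show thesis by (rule that)
qed

text \<open>The radii are arranged so that the collar homotopies, used outside, and the brick
  homotopies, used inside, meet at radius \<open>7/8\<close>, where a positive new function forces
  the point into the core on which the two agree.\<close>

lemma null_cover_extend_disc:
  fixes X :: "'a topology"
  assumes fill: "\<And>j. j \<le> Suc s \<Longrightarrow> fills_cubes j X" and x0: "x0 \<in> topspace X"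
    and n: "n < k * Suc s"
    and u: "continuous_map (top_of_set (disc n)) X u"
    and bd: "null_cover k (top_of_set (disc_boundary n)) X u x0 f H"
  obtains F G where "null_cover k (top_of_set (disc n)) X u x0 F G"
    "\<And>i x. i < k \<Longrightarrow> x \<in> disc_boundary n \<Longrightarrow> F i x = f i x"
    "\<And>i x t. i < k \<Longrightarrow> x \<in> disc_boundary n \<Longrightarrow> 0 < f i x \<Longrightarrow> t \<in> {0..1} \<Longrightarrow> G i (x, t) = H i (x, t)"
proof -
  define D where "D = disc n"
  define S where "S = disc_boundary n"
  define r where "r = radius n"
  define \<theta> where "\<theta> = radial n"
  have SD: "S \<subseteq> D" by (auto simp: S_def D_def disc_iff disc_boundary_iff)
  have r01: "0 \<le> r x" "x \<in> D \<Longrightarrow> r x \<le> 1" for x by (auto simp: r_def D_def disc_iff)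
  have rS: "r x = 1" "\<theta> x = x" if "x \<in> S" for x
    using that radial_boundary[of x n] by (auto simp: r_def \<theta>_def S_def disc_boundary_iff)
  have \<theta>S: "\<theta> x \<in> S" if "x \<in> D" "0 < r x" for x
    using that radial_in_boundary[of x n] by (simp add: r_def \<theta>_def D_def S_def)
  have cr: "continuous_on T r" for T unfolding r_def by (intro continuous_on_radius continuous_on_id)
  have c\<theta>: "continuous_on T \<theta>" if "\<And>x. x \<in> T \<Longrightarrow> 0 < r x" for T
    unfolding \<theta>_def by (intro continuous_on_radial continuous_on_id) (use that in \<open>simp add: r_def\<close>)
  have compD: "compact D" unfolding D_def by (rule compact_disc)
  have cf: "continuous_on S (f i)" and f01: "\<And>x. x \<in> S \<Longrightarrow> 0 \<le> f i x \<and> f i x \<le> 1"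
    and cH: "continuous_map (top_of_set ({x \<in> S. 0 < f i x} \<times> {0..1})) X (H i)"
    and H0: "\<And>x. x \<in> S \<Longrightarrow> 0 < f i x \<Longrightarrow> H i (x, 0) = u x"
    and H1: "\<And>x. x \<in> S \<Longrightarrow> 0 < f i x \<Longrightarrow> H i (x, 1) = x0" if "i < k" for i
    using bd that unfolding null_cover_top_of_set S_def by auto
  have fmax: "\<exists>i<k. f i x = 1" if "x \<in> S" for x
    using bd that unfolding null_cover_top_of_set S_def by auto
  have cf\<theta>: "continuous_on T (\<lambda>x. f i (\<theta> x))" if "i < k" "\<And>x. x \<in> T \<Longrightarrow> x \<in> D \<and> 0 < r x" for i T
    by (rule continuous_on_compose2[OF cf[OF that(1)] c\<theta>]) (use that(2) \<theta>S in auto)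

  \<comment> \<open>\<open>Z i\<close> is where the collar homotopy exists, \<open>C i\<close> where
    it must be kept. The gaps in radius (\<open>1/4\<close> against \<open>1/2\<close>) and in value
    (\<open>0\<close> against \<open>1/2\<close>) separate the compact set \<open>K i\<close>, which
    contains \<open>C i\<close>, from the complement of \<open>Z i\<close>.\<close>
  define Z where "Z i = {x \<in> D. 1/4 < r x \<and> 0 < f i (\<theta> x)}" for i
  define C where "C i = {x \<in> D. 1/2 < r x \<and> 1/2 < f i (\<theta> x)}" for i
  define K where "K i = {x \<in> D. 1/2 \<le> r x \<and> 1/2 \<le> f i (\<theta> x)}" for i
  have KZ: "K i \<subseteq> Z i" and CK: "C i \<subseteq> K i" and CZ: "C i \<subseteq> Z i" for i by (auto simp: K_def Z_def C_def)
  have level_open: "openin (top_of_set D) {x \<in> D. a < r x \<and> b < f i (\<theta> x)}" if "i < k" "0 \<le> a" for i a b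
  proof -
    have "openin (top_of_set D) (D \<inter> r -` {a<..})"
      by (rule continuous_openin_preimage_gen[OF cr]) simp
    moreover have "openin (top_of_set (D \<inter> r -` {a<..})) ((D \<inter> r -` {a<..}) \<inter> (\<lambda>x. f i (\<theta> x)) -` {b<..})"
      by (rule continuous_openin_preimage_gen[OF cf\<theta>[OF that(1)]]) (use that(2) in auto)
    ultimately have "openin (top_of_set D) ((D \<inter> r -` {a<..}) \<inter> (\<lambda>x. f i (\<theta> x)) -` {b<..})"
      by (rule openin_trans[rotated])
    moreover have "(D \<inter> r -` {a<..}) \<inter> (\<lambda>x. f i (\<theta> x)) -` {b<..} = {x \<in> D. a < r x \<and> b < f i (\<theta> x)}" by auto
    ultimately show ?thesis by simp
  qed
  have oZ: "openin (top_of_set D) (Z i)" and oC: "openin (top_of_set D) (C i)" if "i < k" for i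
    unfolding Z_def C_def by (rule level_open[OF that]; simp)+
  have compK: "compact (K i)" if "i < k" for i
  proof -
    let ?E = "D \<inter> r -` {1/2..}"
    have "closedin (top_of_set D) ?E"
      by (rule continuous_closedin_preimage[OF cr]) simp
    then have "compact ?E" using compD by (rule closedin_compact[rotated])
    moreover have "closedin (top_of_set ?E) (?E \<inter> (\<lambda>x. f i (\<theta> x)) -` {1/2..})"
      by (rule continuous_closedin_preimage[OF cf\<theta>[OF that]]) auto
    ultimately have "compact (?E \<inter> (\<lambda>x. f i (\<theta> x)) -` {1/2..})" by (rule closedin_compact)
    moreover have "?E \<inter> (\<lambda>x. f i (\<theta> x)) -` {1/2..} = K i" by (auto simp: K_def)
    ultimately show ?thesis by simp
  qed
  have compDZ: "compact (D - Z i)" if "i < k" for i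
  proof -
    have "closedin (top_of_set D) (D - Z i)" using oZ[OF that] by (simp add: closedin_diff)
    then show ?thesis using compD by (rule closedin_compact[rotated])
  qed
  have "\<exists>\<delta>>0. \<forall>x\<in>K i. \<forall>y\<in>D - Z i. \<delta> \<le> sup_norm n (\<lambda>j. x j - y j)" if i: "i < k" for i
  proof -
    obtain \<delta> where "0 < \<delta>" "\<And>x y. x \<in> K i \<Longrightarrow> y \<in> D - Z i \<Longrightarrow> \<delta> \<le> sup_norm n (\<lambda>j. x j - y j)"
    proof (rule coordinate_separation[OF compK[OF i] compDZ[OF i]])
      show "K i \<inter> (D - Z i) = {}" using KZ by auto
      show "x j = 0" if "x \<in> K i \<union> (D - Z i)" "n \<le> j" for x j
        using that by (auto simp: K_def D_def disc_iff)
    qed (rule that)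
    then show ?thesis by blast
  qed
  then obtain \<delta>' where \<delta>': "\<And>i. i < k \<Longrightarrow> 0 < \<delta>' i"
    "\<And>i x y. i < k \<Longrightarrow> x \<in> K i \<Longrightarrow> y \<in> D - Z i \<Longrightarrow> \<delta>' i \<le> sup_norm n (\<lambda>j. x j - y j)"
    by metis
  \<comment> \<open>Bricks of this size cannot meet both \<open>C i\<close> and the complement of
    \<open>Z i\<close>, for any \<open>i < k\<close>.\<close>
  define \<delta> where "\<delta> = Min (insert 1 (\<delta>' ` {..<k}))"
  have \<delta>: "0 < \<delta>" "\<And>i. i < k \<Longrightarrow> \<delta> \<le> \<delta>' i"
    using \<delta>'(1) by (auto simp: \<delta>_def)

  \<comment> \<open>Index \<open>i\<close> receives the levels from \<open>i * Suc s\<close> to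
    \<open>i * Suc s + s\<close>, so that a level finds its index and place by division with
    remainder. Levels above \<open>n\<close> have no bricks.\<close>
  define F where "F i j = bricks n \<delta> D (i * Suc s + j)" for i j
  define W where "W i = (\<Union>j\<le>s. \<Union>(F i j))" for i
  have bF: "brick_family D (F i j)" for i j
    unfolding F_def by (rule brick_family_bricks[OF \<delta>(1)]) (simp add: D_def segment_closed_disc)
  have FC: "B \<subseteq> Z i \<or> B \<inter> C i = {}" if i: "i < k" and BF: "B \<in> F i j" for i j B
  proof (rule ccontr)
    assume "\<not> ?thesis"
    then obtain x y where xy: "x \<in> B" "x \<in> C i" "y \<in> B" "y \<notin> Z i" by blast
    obtain T l where B: "B = D \<inter> brick n \<delta> (i * Suc s + j) T l" using BF by (auto simp: F_def bricks_def)
    then have xyb: "x \<in> brick n \<delta> (i * Suc s + j) T l" "y \<in> brick n \<delta> (i * Suc s + j) T l"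
      using xy by auto
    have "sup_norm n (\<lambda>j. x j - y j) < \<delta>"
      unfolding sup_norm_less_iff[OF \<delta>(1)] using brick_diameter[OF \<delta>(1) xyb] by blast
    moreover have "\<delta>' i \<le> sup_norm n (\<lambda>j. x j - y j)"
      using xy B CK by (intro \<delta>'(2)[OF i]) auto
    ultimately show False using \<delta>(2)[OF i] by simp
  qed
  have Wcover: "D \<subseteq> (\<Union>i<k. W i)"
  proof
    fix x assume "x \<in> D"
    then obtain l B where l: "l \<le> n" "B \<in> bricks n \<delta> D l" "x \<in> B" using bricks_cover[OF \<delta>(1)] by metis
    have "l div Suc s < k" using l(1) n by (simp add: less_mult_imp_div_less del: mult_Suc_right)
    moreover have "B \<in> F (l div Suc s) (l mod Suc s)"
      unfolding F_def using l(2) by (simp only: div_mult_mod_eq)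
    moreover have "l mod Suc s \<le> s" by (simp add: less_Suc_eq_le[symmetric])
    ultimately show "x \<in> (\<Union>i<k. W i)" using l(3) unfolding W_def by blast
  qed
  have oW: "openin (top_of_set D) (W i)" for i
    unfolding W_def using bF[of i] by (auto simp: brick_family_def intro!: openin_Union)
  define collar where "collar i h \<longleftrightarrow> continuous_map (top_of_set (Z i \<times> {0..1})) X h \<and> (\<forall>x\<in>Z i. h (x, 0) = u x) \<and>
      (\<forall>x\<in>Z i. h (x, 1) = x0) \<and> (\<forall>x\<in>S. 0 < f i x \<longrightarrow> (\<forall>t\<in>{0..1}. h (x, t) = H i (x, t)))" for i h
  have "\<exists>h. collar i h" if i: "i < k" for i
  proof -
    have ZP: "x \<in> disc n \<and> 0 < radius n x \<and> radial n x \<in> {x \<in> S. 0 < f i x}" if "x \<in> Z i" for x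
      using that \<theta>S[of x] by (auto simp: Z_def D_def r_def \<theta>_def)
    have PS: "{x \<in> S. 0 < f i x} \<subseteq> disc_boundary n" by (auto simp: S_def)
    show ?thesis
    proof (rule null_cover_collar[where A = "Z i" and P = "{x \<in> S. 0 < f i x}" and H = "H i"])
      show "H i (x, 0) = u x" "H i (x, 1) = x0" if "x \<in> {x \<in> S. 0 < f i x}" for x
        using that H0[OF i] H1[OF i] by auto
      fix h :: "(nat \<Rightarrow> real) \<times> real \<Rightarrow> 'a"
      assume "continuous_map (top_of_set (Z i \<times> {0..1})) X h"
        "\<And>x. x \<in> Z i \<Longrightarrow> h (x, 0) = u x" "\<And>x. x \<in> Z i \<Longrightarrow> h (x, 1) = x0"
        "\<And>x t. x \<in> {x \<in> S. 0 < f i x} \<Longrightarrow> t \<in> {0..1} \<Longrightarrow> h (x, t) = H i (x, t)"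
      then show ?thesis unfolding collar_def by (intro exI[of _ h] conjI) auto
    qed (use u ZP PS cH[OF i] in auto)
  qed
  then obtain h where "\<And>i. i < k \<Longrightarrow> collar i (h i)" by metis
  then have h: "\<And>i. i < k \<Longrightarrow> continuous_map (top_of_set (Z i \<times> {0..1})) X (h i)"
    and h0: "\<And>i x. i < k \<Longrightarrow> x \<in> Z i \<Longrightarrow> h i (x, 0) = u x"
    and h1: "\<And>i x. i < k \<Longrightarrow> x \<in> Z i \<Longrightarrow> h i (x, 1) = x0"
    and hH: "\<And>i x t. i < k \<Longrightarrow> x \<in> S \<Longrightarrow> 0 < f i x \<Longrightarrow> t \<in> {0..1} \<Longrightarrow> h i (x, t) = H i (x, t)"
    unfolding collar_def by blast+
  define core where "core i G \<longleftrightarrow> continuous_map (top_of_set ((C i \<union> W i) \<times> {0..1})) X G \<and> (\<forall>x\<in>C i \<union> W i. G (x, 0) = u x) \<and>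
      (\<forall>x\<in>C i \<union> W i. G (x, 1) = x0) \<and> (\<forall>x\<in>C i. \<forall>t\<in>{0..1}. G (x, t) = h i (x, t))" for i G
  have "\<exists>G. core i G" if i: "i < k" for i
  proof (rule extend_nullhomotopy_over_bricks[where s = s and X = X and u = u and ?x0.0 = x0 and F = "F i"
        and D = D and ?Z0.0 = "Z i" and C = "C i" and h = "h i"])
    fix g :: "(nat \<Rightarrow> real) \<times> real \<Rightarrow> 'a"
    assume "continuous_map (top_of_set ((C i \<union> (\<Union>j\<le>s. \<Union>(F i j))) \<times> {0..1})) X g"
      "\<And>x. x \<in> C i \<union> (\<Union>j\<le>s. \<Union>(F i j)) \<Longrightarrow> g (x, 0) = u x"
      "\<And>x. x \<in> C i \<union> (\<Union>j\<le>s. \<Union>(F i j)) \<Longrightarrow> g (x, 1) = x0"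
      "\<And>x t. x \<in> C i \<Longrightarrow> t \<in> {0..1} \<Longrightarrow> g (x, t) = h i (x, t)"
    then show ?thesis unfolding core_def W_def by (intro exI[of _ g] conjI ballI)
  qed (rule x0 bF u[folded D_def] oC[OF i] CZ h[OF i] h0[OF i] h1[OF i] FC[OF i] fill; assumption)+
  then obtain G where "\<And>i. i < k \<Longrightarrow> core i (G i)" by metis
  then have G: "\<And>i. i < k \<Longrightarrow> continuous_map (top_of_set ((C i \<union> W i) \<times> {0..1})) X (G i)"
    and G0: "\<And>i x. i < k \<Longrightarrow> x \<in> C i \<union> W i \<Longrightarrow> G i (x, 0) = u x"
    and G1: "\<And>i x. i < k \<Longrightarrow> x \<in> C i \<union> W i \<Longrightarrow> G i (x, 1) = x0"
    and GC: "\<And>i x t. i < k \<Longrightarrow> x \<in> C i \<Longrightarrow> t \<in> {0..1} \<Longrightarrow> G i (x, t) = h i (x, t)"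
    unfolding core_def by blast+
  obtain \<rho> :: "nat \<Rightarrow> (nat \<Rightarrow> real) \<Rightarrow> real" where c\<rho>: "\<And>i. i < k \<Longrightarrow> continuous_on D (\<rho> i)"
    and \<rho>01: "\<And>i x. i < k \<Longrightarrow> x \<in> D \<Longrightarrow> 0 \<le> \<rho> i x \<and> \<rho> i x \<le> 1"
    and \<rho>W: "\<And>i x. i < k \<Longrightarrow> x \<in> D \<Longrightarrow> 0 < \<rho> i x \<Longrightarrow> x \<in> W i"
    and \<rho>max: "\<And>x. x \<in> D \<Longrightarrow> \<exists>i<k. \<rho> i x = 1"
    using max_normalised_functions[OF oW Wcover] by metis

  \<comment> \<open>As the radius grows, \<open>a\<close> rises from \<open>0\<close> to
    \<open>1\<close> between \<open>5/8\<close> and \<open>3/4\<close>, \<open>b\<close> falls from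
    \<open>1\<close> to \<open>0\<close> between \<open>3/4\<close> and \<open>7/8\<close>, and
    \<open>\<epsilon>\<close> falls from \<open>1/2\<close> to \<open>0\<close> between
    \<open>7/8\<close> and \<open>1\<close>. At every radius \<open>a\<close> or \<open>b\<close> is
    \<open>1\<close>, so old or new functions attain the maximum \<open>1\<close>.\<close>
  define \<epsilon> where "\<epsilon> x = min (1/2) (4 * (1 - r x))" for x
  define a where "a x = max 0 (min 1 (8 * r x - 5))" for x
  define b where "b x = max 0 (min 1 (7 - 8 * r x))" for x
  \<comment> \<open>The quotient is positive only where the old function exceeds
    \<open>\<epsilon>\<close>, and it keeps the value \<open>1\<close>. The case distinction avoids
    the radial projection near the centre and is continuous because \<open>a\<close> vanishes up to
    \<open>5/8\<close>.\<close>
  define m where "m i x = (if r x \<le> 1/2 then 0 else a x * max 0 ((f i (\<theta> x) - \<epsilon> x) / (1 - \<epsilon> x)))" for i x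
  define F' where "F' i x = max (m i x) (b x * \<rho> i x)" for i x
  define G' where "G' i z = (if 7/8 \<le> r (fst z) then h i z else G i z)" for i z
  have \<epsilon>: "0 \<le> \<epsilon> x" "\<epsilon> x \<le> 1/2" if "x \<in> D" for x
    unfolding \<epsilon>_def using r01(2)[OF that] min.cobounded1[of "1/2" "4 * (1 - r x)"] by (simp, blast)
  have ab: "0 \<le> a x" "a x \<le> 1" "0 \<le> b x" "b x \<le> 1" for x by (auto simp: a_def b_def)
  have m01: "0 \<le> m i x" "m i x \<le> 1" if "i < k" "x \<in> D" for i x
  proof -
    show "0 \<le> m i x" using ab by (simp add: m_def)
    show "m i x \<le> 1"
    proof (cases "r x \<le> 1/2")
      case False
      then have "f i (\<theta> x) \<le> 1" using f01[OF that(1) \<theta>S[OF that(2)]] by auto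
      then have "(f i (\<theta> x) - \<epsilon> x) / (1 - \<epsilon> x) \<le> 1" using \<epsilon>[OF that(2)] by (simp add: divide_le_eq)
      then show ?thesis using ab[of x] by (auto simp: m_def intro!: mult_le_one)
    qed (simp add: m_def)
  qed
  have mpos: "\<epsilon> x < f i (\<theta> x) \<and> 5/8 < r x" if "0 < m i x" "x \<in> D" for i x
  proof -
    have far: "\<not> r x \<le> 1/2" using that by (auto simp: m_def)
    have "0 < a x * max 0 ((f i (\<theta> x) - \<epsilon> x) / (1 - \<epsilon> x))"
      using that(1) unfolding m_def if_not_P[OF far] .
    then have "0 < a x" "0 < (f i (\<theta> x) - \<epsilon> x) / (1 - \<epsilon> x)"
      using ab[of x] by (auto simp: zero_less_mult_iff max_def split: if_splits)
    then show ?thesis using \<epsilon>[OF that(2)] by (auto simp: a_def zero_less_divide_iff)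
  qed
  have cm: "continuous_on D (m i)" if "i < k" for i
    unfolding m_def
  proof (rule continuous_on_cases_le)
    show "continuous_on {x \<in> D. 1/2 \<le> r x} (\<lambda>x. a x * max 0 ((f i (\<theta> x) - \<epsilon> x) / (1 - \<epsilon> x)))"
      unfolding a_def \<epsilon>_def
      by (intro continuous_on_mult continuous_on_max continuous_on_min continuous_on_diff continuous_on_divide
          continuous_on_const cr cf\<theta>[OF that]) (use r01(2) in \<open>auto simp: min_def\<close>)
  qed (auto simp: cr a_def)
  have cF': "continuous_on D (F' i)" if "i < k" for i
    unfolding F'_def b_def
    by (intro continuous_on_mult continuous_on_max continuous_on_min continuous_on_diff continuous_on_const cr cm c\<rho> that)
  have outer: "x \<in> Z i" if "i < k" "x \<in> D" "0 < F' i x" "7/8 \<le> r x" for i x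
  proof -
    have "b x = 0" using that by (simp add: b_def)
    then have "0 < m i x" using that(3) by (simp add: F'_def less_max_iff_disj)
    then show ?thesis using mpos[OF _ that(2)] \<epsilon>[OF that(2)] that by (fastforce simp: Z_def)
  qed
  have inner: "x \<in> C i \<union> W i" if "i < k" "x \<in> D" "0 < F' i x" "r x \<le> 7/8" for i x
  proof -
    have "\<epsilon> x = 1/2" using that by (simp add: \<epsilon>_def)
    have "0 < m i x \<or> 0 < b x * \<rho> i x" using that(3) by (auto simp: F'_def less_max_iff_disj)
    then show ?thesis
    proof
      assume "0 < m i x"
      then show ?thesis using mpos[OF _ that(2)] \<open>\<epsilon> x = 1/2\<close> that(2) by (fastforce simp: C_def)
    next
      assume "0 < b x * \<rho> i x"
      then have "0 < \<rho> i x" using ab[of x] by (simp add: zero_less_mult_iff)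
      then show ?thesis using \<rho>W that by blast
    qed
  qed
  \<comment> \<open>At the seam the bumps are switched off and \<open>\<epsilon>\<close> is
    \<open>1/2\<close>, so positivity means that the old function exceeds \<open>1/2\<close>. This
    is the core, where \<open>G i\<close> was built to equal \<open>h i\<close>.\<close>
  have middle: "x \<in> C i" if "i < k" "x \<in> D" "0 < F' i x" "r x = 7/8" for i x
  proof -
    have "b x = 0" "\<epsilon> x = 1/2" using that by (simp_all add: b_def \<epsilon>_def)
    then have "0 < m i x" using that(3) by (simp add: F'_def less_max_iff_disj)
    then show ?thesis using mpos[OF _ that(2)] \<open>\<epsilon> x = 1/2\<close> that(2) by (fastforce simp: C_def)
  qed
  have F'S: "F' i x = f i x" if "i < k" "x \<in> S" for i x
  proof -
    have "a x = 1" "b x = 0" "\<epsilon> x = 0" using rS[OF that(2)] by (simp_all add: a_def b_def \<epsilon>_def)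
    then show ?thesis using rS[OF that(2)] f01[OF that] by (simp add: F'_def m_def)
  qed
  have "null_cover k (top_of_set D) X u x0 F' G'"
    unfolding null_cover_top_of_set
  proof (intro conjI allI impI ballI)
    show "continuous_on D (F' i)" if "i < k" for i by (rule cF'[OF that])
    show "0 \<le> F' i x" "F' i x \<le> 1" if "i < k" "x \<in> D" for i x
      using m01[OF that] \<rho>01[OF that] ab[of x] by (auto simp: F'_def intro!: mult_le_one)
    show "continuous_map (top_of_set ({x \<in> D. 0 < F' i x} \<times> {0..1})) X (G' i)" if i: "i < k" for i
      unfolding G'_def
    proof (rule continuous_map_top_of_set_cases_le)
      let ?S = "{x \<in> D. 0 < F' i x} \<times> {0..1::real}"
      show "continuous_on ?S (\<lambda>z. 7/8)" by (rule continuous_on_const)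
      show "continuous_on ?S (\<lambda>z. r (fst z))"
        unfolding r_def by (intro continuous_on_radius continuous_on_fst continuous_on_id)
      show "continuous_map (top_of_set {z \<in> ?S. 7/8 \<le> r (fst z)}) X (h i)"
        by (rule continuous_map_top_of_set_subset[OF h[OF i]]) (use outer[OF i] in auto)
      show "continuous_map (top_of_set {z \<in> ?S. r (fst z) \<le> 7/8}) X (G i)"
      proof (rule continuous_map_top_of_set_subset[OF G[OF i]])
        show "{z \<in> ?S. r (fst z) \<le> 7/8} \<subseteq> (C i \<union> W i) \<times> {0..1}"
        proof
          fix z assume "z \<in> {z \<in> ?S. r (fst z) \<le> 7/8}"
          then show "z \<in> (C i \<union> W i) \<times> {0..1}" using inner[OF i, of "fst z"] by (cases z) auto
        qed
      qed simp
      show "h i z = G i z" if "z \<in> ?S" "7/8 = r (fst z)" for z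
        using that middle[OF i, of "fst z"] GC[OF i, of "fst z" "snd z"] by auto
    qed
    show "G' i (x, 0) = u x" "G' i (x, 1) = x0" if "i < k" "x \<in> D" "0 < F' i x" for i x
      using outer[OF that] inner[OF that] h0[OF that(1), of x] h1[OF that(1), of x]
        G0[OF that(1), of x] G1[OF that(1), of x] by (auto simp: G'_def)
    show "\<exists>i<k. F' i x = 1" if x: "x \<in> D" for x
    proof (cases "3/4 \<le> r x")
      case True
      then have "a x = 1" by (simp add: a_def)
      obtain i where i: "i < k" "f i (\<theta> x) = 1" using fmax[of "\<theta> x"] \<theta>S[OF x] True by auto
      then have "m i x = 1" using True \<open>a x = 1\<close> \<epsilon>[OF x] by (simp add: m_def)
      moreover have "b x * \<rho> i x \<le> 1" using \<rho>01[OF i(1) x] ab[of x] by (intro mult_le_one) auto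
      ultimately have "F' i x = 1" by (simp add: F'_def)
      with i show ?thesis by blast
    next
      case False
      then have "b x = 1" by (simp add: b_def)
      obtain i where i: "i < k" "\<rho> i x = 1" using \<rho>max[OF x] by blast
      then have "F' i x = 1" using m01(2)[OF i(1) x] \<open>b x = 1\<close> by (simp add: F'_def)
      with i show ?thesis by blast
    qed
  qed
  moreover have "G' i (x, t) = H i (x, t)" if "i < k" "x \<in> S" "0 < f i x" "t \<in> {0..1}" for i x t
    using hH[OF that] rS[OF that(2)] by (simp add: G'_def)
  ultimately show thesis
    using that[of F' G'] F'S by (simp add: D_def S_def)
qed

section \<open>CW complexes\<close>

lemma continuous_map_on_slices:
  assumes \<pi>: "continuous_map N (discrete_topology E) \<pi>"
    and g: "\<And>e. e \<in> E \<Longrightarrow> continuous_map (subtopology N {z. \<pi> z = e}) Z g"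
  shows "continuous_map N Z g"
proof (rule pasting_lemma[where I = E and T = "\<lambda>e. {z \<in> topspace N. \<pi> z = e}" and f = "\<lambda>_. g"])
  show "openin N {z \<in> topspace N. \<pi> z = e}" if "e \<in> E" for e
    using openin_continuous_map_preimage[OF \<pi>, of "{e}"] that by simp
  show "continuous_map (subtopology N {z \<in> topspace N. \<pi> z = e}) Z g" if "e \<in> E" for e
  proof -
    have "subtopology N {z \<in> topspace N. \<pi> z = e} = subtopology N {z. \<pi> z = e}"
    proof -
      have "{z \<in> topspace N. \<pi> z = e} = topspace N \<inter> {z. \<pi> z = e}" by auto
      then show ?thesis by (simp add: subtopology_restrict)
    qed
    then show ?thesis using g[OF that] by simp
  qed
  show "\<exists>e. e \<in> E \<and> z \<in> {z \<in> topspace N. \<pi> z = e} \<and> g z = g z" if "z \<in> topspace N" for z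
    using continuous_map_image_subset_topspace[OF \<pi>] that by auto
qed simp

lemma null_cover_pullback:
  assumes \<phi>: "continuous_map S T \<phi>" and n: "null_cover k T X u x0 f H"
  shows "null_cover k S X (\<lambda>x. u (\<phi> x)) x0 (\<lambda>i x. f i (\<phi> x)) (\<lambda>i z. H i (\<phi> (fst z), snd z))"
  unfolding null_cover_def
proof (intro conjI allI impI ballI)
  have \<phi>T: "\<phi> x \<in> topspace T" if "x \<in> topspace S" for x
    using continuous_map_image_subset_topspace[OF \<phi>] that by auto
  show "\<exists>i<k. f i (\<phi> x) = 1" if "x \<in> topspace S" for x
    using n \<phi>T[OF that] by (simp add: null_cover_def)
  fix i assume i: "i < k"
  show "continuous_map S euclideanreal (\<lambda>x. f i (\<phi> x))"
    using continuous_map_compose[OF \<phi>, of euclideanreal "f i"] n i by (simp add: null_cover_def o_def)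
  show "0 \<le> f i (\<phi> x)" "f i (\<phi> x) \<le> 1" if "x \<in> topspace S" for x
    using n \<phi>T[OF that] i by (auto simp: null_cover_def)
  show "H i (\<phi> (fst (x, 0)), snd (x, 0)) = u (\<phi> x)" "H i (\<phi> (fst (x, 1)), snd (x, 1)) = x0"
    if "x \<in> topspace S" "0 < f i (\<phi> x)" for x
    using n \<phi>T[OF that(1)] i that(2) by (auto simp: null_cover_def)
  have "continuous_map (subtopology S {x. 0 < f i (\<phi> x)}) (subtopology T {y. 0 < f i y}) \<phi>"
    using \<phi> by (auto simp: continuous_map_in_subtopology continuous_map_from_subtopology)
  from continuous_map_compose[OF continuous_map_fst this]
  have "continuous_map (prod_topology (subtopology S {x. 0 < f i (\<phi> x)}) (top_of_set {0..1}))
      (prod_topology (subtopology T {y. 0 < f i y}) (top_of_set {0..1::real})) (\<lambda>z. (\<phi> (fst z), snd z))"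
    by (intro continuous_map_pairedI continuous_map_snd) (simp add: o_def)
  from continuous_map_compose[OF this, of X "H i"] n i
  show "continuous_map (prod_topology (subtopology S {x. 0 < f i (\<phi> x)}) (top_of_set {0..1})) X
      (\<lambda>z. H i (\<phi> (fst z), snd z))"
    by (simp add: null_cover_def o_def)
qed

section \<open>Closed cells and skeleta\<close>

locale cw =
  fixes Y :: "'a topology" and C :: "'a cw_data"
  assumes cw: "cw_complex Y C"
begin

abbreviation closed_disc :: "'a set \<Rightarrow> (nat \<Rightarrow> real) set" where
  "closed_disc e \<equiv> disc (cell_dim C e)"

text \<open>The strict bound makes \<open>skeleton_below 0\<close> empty, which starts the
  induction; \<open>skeleton_below (Suc r)\<close> is the usual \<open>r\<close>-skeleton.\<close>

definition skeleton_below :: "nat \<Rightarrow> 'a set" where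
  "skeleton_below r = \<Union>{e \<in> cells C. cell_dim C e < r}"

lemma Hausdorff: "Hausdorff_space Y"
  using cw by (simp add: cw_complex_def)

lemma char_map_continuous: "e \<in> cells C \<Longrightarrow> continuous_map (top_of_set (closed_disc e)) Y (char_map C e)"
  using cw by (simp add: cw_complex_def top_of_set_disc)

lemma cell_subset: "e \<in> cells C \<Longrightarrow> e \<subseteq> topspace Y"
  using cw by (auto simp: cw_complex_def)

lemma char_map_open_disc:
  assumes "e \<in> cells C"
  shows "char_map C e ` open_disc (cell_dim C e) = e" "inj_on (char_map C e) (open_disc (cell_dim C e))"
proof -
  have "homeomorphic_map (top_of_set (open_disc (cell_dim C e))) (subtopology Y e) (char_map C e)"
    using cw assms by (simp add: cw_complex_def top_of_set_disc)
  then show "char_map C e ` open_disc (cell_dim C e) = e" "inj_on (char_map C e) (open_disc (cell_dim C e))"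
    using cell_subset[OF assms]
    by (auto simp: homeomorphic_eq_everything_map inf_absorb2)
qed

lemma cells_disjoint: "e \<in> cells C \<Longrightarrow> e' \<in> cells C \<Longrightarrow> y \<in> e \<Longrightarrow> y \<in> e' \<Longrightarrow> e = e'"
  using cw by (auto simp: cw_complex_def disjoint_def)

lemma char_map_boundary:
  assumes "e \<in> cells C"
  obtains F where "finite F" "F \<subseteq> cells C" "\<And>f. f \<in> F \<Longrightarrow> cell_dim C f < cell_dim C e"
    "char_map C e ` disc_boundary (cell_dim C e) \<subseteq> \<Union>F"
proof -
  have "\<exists>F. finite F \<and> F \<subseteq> cells C \<and> (\<forall>f\<in>F. cell_dim C f < cell_dim C e) \<and>
      char_map C e ` disc_boundary (cell_dim C e) \<subseteq> \<Union>F"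
    using cw assms by (simp add: cw_complex_def)
  then show thesis using that by metis
qed

lemma closed_disc_image_closed:
  assumes "e \<in> cells C" "closed K" "K \<subseteq> closed_disc e"
  shows "closedin Y (char_map C e ` K)"
proof (rule compactin_imp_closedin[OF Hausdorff image_compactin[OF _ char_map_continuous[OF assms(1)]]])
  have "compact K" using compact_disc assms(2,3) by (metis compact_Int_closed inf.absorb_iff2)
  then show "compactin (top_of_set (closed_disc e)) K"
    using assms(3) by (simp add: compactin_subtopology)
qed

lemma not_in_skeleton_below:
  "e \<in> cells C \<Longrightarrow> r \<le> cell_dim C e \<Longrightarrow> e \<inter> skeleton_below r = {}"
  using cells_disjoint by (fastforce simp: skeleton_below_def)

lemma boundary_in_skeleton_below:
  assumes "e \<in> cells C" "x \<in> disc_boundary (cell_dim C e)"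
  shows "char_map C e x \<in> skeleton_below (cell_dim C e)"
proof -
  obtain F where "F \<subseteq> cells C" "\<And>f. f \<in> F \<Longrightarrow> cell_dim C f < cell_dim C e"
    "char_map C e ` disc_boundary (cell_dim C e) \<subseteq> \<Union>F"
    using char_map_boundary[OF assms(1)] by metis
  moreover from this(3) obtain f where "f \<in> F" "char_map C e x \<in> f" using assms(2) by blast
  ultimately show ?thesis unfolding skeleton_below_def by blast
qed

lemma skeleton_below_mono: "r \<le> r' \<Longrightarrow> skeleton_below r \<subseteq> skeleton_below r'"
  by (auto simp: skeleton_below_def)

lemma skeleton_below_subset: "skeleton_below r \<subseteq> topspace Y"
  using cell_subset by (auto simp: skeleton_below_def)

lemma closed_disc_in_skeleton_below:
  assumes "e \<in> cells C" "cell_dim C e < r" "x \<in> closed_disc e"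
  shows "char_map C e x \<in> skeleton_below r"
proof -
  consider "x \<in> open_disc (cell_dim C e)" | "x \<in> disc_boundary (cell_dim C e)"
    using assms(3) disc_eq(1) by auto
  then show ?thesis
  proof cases
    case 1
    then have "char_map C e x \<in> e" using char_map_open_disc(1)[OF assms(1)] by auto
    then show ?thesis using assms(1,2) by (auto simp: skeleton_below_def)
  next
    case 2
    then show ?thesis
      using boundary_in_skeleton_below[OF assms(1)] skeleton_below_mono[of "cell_dim C e" r] assms(2) by auto
  qed
qed

text \<open>Only the cells of the skeleton have to be tested, because the attaching map of a higher cell
  meets the skeleton in finitely many closed cells.\<close>

lemma closedin_skeleton:
  assumes S: "S \<subseteq> skeleton_below r"
    and cl: "\<And>e. e \<in> cells C \<Longrightarrow> cell_dim C e < r \<Longrightarrow> closedin Y (S \<inter> char_map C e ` closed_disc e)"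
  shows "closedin Y S"
proof -
  have all: "closedin Y (S \<inter> char_map C e ` closed_disc e)" if "e \<in> cells C" for e
    using that
  proof (induction "cell_dim C e" arbitrary: e rule: less_induct)
    case less
    show ?case
    proof (cases "cell_dim C e < r")
      case False
      let ?bd = "char_map C e ` disc_boundary (cell_dim C e)"
      obtain F where F: "finite F" "F \<subseteq> cells C" "\<And>f. f \<in> F \<Longrightarrow> cell_dim C f < cell_dim C e" "?bd \<subseteq> \<Union>F"
        using char_map_boundary[OF less.prems] by metis
      have "S \<inter> e = {}" using not_in_skeleton_below[OF less.prems, of r] False S by auto
      then have "S \<inter> char_map C e ` closed_disc e = S \<inter> ?bd"
        using char_map_open_disc(1)[OF less.prems] disc_eq(1)[of "cell_dim C e"] by (auto simp: image_Un)
      also have "\<dots> = ?bd \<inter> (\<Union>f\<in>F. S \<inter> char_map C f ` closed_disc f)"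
      proof -
        have sub: "f \<subseteq> char_map C f ` closed_disc f" if "f \<in> F" for f
          using char_map_open_disc(1)[of f] disc_eq(1)[of "cell_dim C f"] F(2) that by auto
        have "S \<inter> B = B \<inter> (\<Union>f\<in>F. S \<inter> G f)" if "B \<subseteq> \<Union>F" "\<And>f. f \<in> F \<Longrightarrow> f \<subseteq> G f" for B G
          using that by blast
        from this[OF F(4) sub] show ?thesis .
      qed
      also have "closedin Y \<dots>"
      proof (intro closedin_Int closedin_Union)
        have "closed (disc_boundary (cell_dim C e))"
        proof -
          have "disc_boundary (cell_dim C e) = closed_disc e \<inter> {x. radius (cell_dim C e) x = 1}"
            by (auto simp: disc_iff disc_boundary_iff)
          moreover have "closed {x. radius (cell_dim C e) x = 1}"
            by (intro closed_Collect_eq continuous_on_radius continuous_on_id continuous_on_const)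
          ultimately show ?thesis by (simp add: closed_Int compact_imp_closed compact_disc)
        qed
        then show "closedin Y ?bd"
          by (rule closed_disc_image_closed[OF less.prems]) (auto simp: disc_eq(1))
      qed (use F less.hyps in auto)
      finally show ?thesis .
    qed (use cl less.prems in blast)
  qed
  have "closedin Y (S \<inter> Y closure_of e)" if e: "e \<in> cells C" for e
  proof -
    have "Y closure_of e \<subseteq> char_map C e ` closed_disc e"
    proof (rule closure_of_minimal)
      show "e \<subseteq> char_map C e ` closed_disc e"
        using char_map_open_disc(1)[OF e] disc_eq(1)[of "cell_dim C e"] by auto
      show "closedin Y (char_map C e ` closed_disc e)"
        by (rule closed_disc_image_closed[OF e]) (simp_all add: compact_imp_closed compact_disc)
    qed
    then have "S \<inter> Y closure_of e = (S \<inter> char_map C e ` closed_disc e) \<inter> Y closure_of e" by auto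
    then show ?thesis using all[OF e] by (simp add: closedin_Int)
  qed
  moreover have "S \<subseteq> topspace Y" using S skeleton_below_subset by auto
  ultimately show ?thesis using cw by (simp add: cw_complex_def)
qed

section \<open>Skeleta as quotients of disjoint unions of discs\<close>

abbreviation skeleton :: "nat \<Rightarrow> 'a topology" where
  "skeleton r \<equiv> subtopology Y (skeleton_below r)"

lemma topspace_skeleton: "topspace (skeleton r) = skeleton_below r"
  using skeleton_below_subset[of r] by auto

text \<open>The disjoint union of the closed discs, with the cell as a discrete label. Discs of all
  dimensions fit into one type because the surplus coordinates are zero.\<close>

definition cell_discs :: "nat \<Rightarrow> ('a set \<times> (nat \<Rightarrow> real)) topology" where
  "cell_discs r = subtopology (prod_topology (discrete_topology {e \<in> cells C. cell_dim C e < r}) euclidean)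
     {z. snd z \<in> closed_disc (fst z)}"

definition attach :: "'a set \<times> (nat \<Rightarrow> real) \<Rightarrow> 'a" where
  "attach z = char_map C (fst z) (snd z)"

lemma topspace_cell_discs:
  "z \<in> topspace (cell_discs r) \<longleftrightarrow> fst z \<in> cells C \<and> cell_dim C (fst z) < r \<and> snd z \<in> closed_disc (fst z)"
  by (cases z) (auto simp: cell_discs_def)

lemma continuous_map_fst_cell_discs:
  "continuous_map (cell_discs r) (discrete_topology {e \<in> cells C. cell_dim C e < r}) fst"
  unfolding cell_discs_def by (rule continuous_map_subtopology_fst)

lemma continuous_map_snd_slice:
  "continuous_map (subtopology (cell_discs r) {z. fst z = e}) (top_of_set (closed_disc e)) snd"
  unfolding cell_discs_def subtopology_subtopology
  by (auto simp: continuous_map_in_subtopology continuous_map_subtopology_snd)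

text \<open>This is the weak topology of the complex. A closed trace on a disc is compact, hence has
  closed image in the Hausdorff space \<open>Y\<close>, and \<open>closedin_skeleton\<close>
  assembles these images.\<close>

lemma quotient_map_attach: "quotient_map (cell_discs r) (skeleton r) attach"
  unfolding quotient_map_closedin
proof (intro conjI allI impI)
  have sur: "attach ` topspace (cell_discs r) = skeleton_below r"
  proof
    show "attach ` topspace (cell_discs r) \<subseteq> skeleton_below r"
      using closed_disc_in_skeleton_below by (auto simp: topspace_cell_discs attach_def)
    show "skeleton_below r \<subseteq> attach ` topspace (cell_discs r)"
    proof
      fix y assume "y \<in> skeleton_below r"
      then obtain e where e: "e \<in> cells C" "cell_dim C e < r" "y \<in> e" by (auto simp: skeleton_below_def)
      then obtain x where "x \<in> open_disc (cell_dim C e)" "y = char_map C e x"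
        using char_map_open_disc(1)[OF e(1)] by auto
      then show "y \<in> attach ` topspace (cell_discs r)"
        using e disc_eq(1) by (intro image_eqI[of _ _ "(e, x)"]) (auto simp: attach_def topspace_cell_discs)
    qed
  qed
  then show "attach ` topspace (cell_discs r) = topspace (skeleton r)" by (simp only: topspace_skeleton)
  have "continuous_map (cell_discs r) Y attach"
  proof (rule continuous_map_on_slices[OF continuous_map_fst_cell_discs])
    fix e assume "e \<in> {e \<in> cells C. cell_dim C e < r}"
    then have "continuous_map (subtopology (cell_discs r) {z. fst z = e}) Y (char_map C e \<circ> snd)"
      by (intro continuous_map_compose[OF continuous_map_snd_slice] char_map_continuous) auto
    then show "continuous_map (subtopology (cell_discs r) {z. fst z = e}) Y attach"
      by (rule continuous_map_eq) (auto simp: attach_def)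
  qed
  then have cont: "continuous_map (cell_discs r) (skeleton r) attach"
    using sur by (auto simp: continuous_map_in_subtopology)
  fix U assume U: "U \<subseteq> topspace (skeleton r)"
  then have Us: "U \<subseteq> skeleton_below r" by simp
  show "closedin (cell_discs r) {z \<in> topspace (cell_discs r). attach z \<in> U} \<longleftrightarrow> closedin (skeleton r) U"
  proof
    assume "closedin (skeleton r) U"
    then show "closedin (cell_discs r) {z \<in> topspace (cell_discs r). attach z \<in> U}"
      by (rule closedin_continuous_map_preimage[OF cont])
  next
    assume cl: "closedin (cell_discs r) {z \<in> topspace (cell_discs r). attach z \<in> U}"
    have "closedin Y U"
    proof (rule closedin_skeleton[OF Us])
      fix e assume e: "e \<in> cells C" "cell_dim C e < r"
      have "continuous_map (top_of_set (closed_disc e)) (cell_discs r) (Pair e)"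
        unfolding cell_discs_def using e
        by (auto simp: continuous_map_in_subtopology continuous_map_pairwise o_def)
      from closedin_continuous_map_preimage[OF this cl]
      have "closedin (top_of_set (closed_disc e)) {x \<in> closed_disc e. char_map C e x \<in> U}"
        using e by (simp add: topspace_cell_discs attach_def)
      then have "closed {x \<in> closed_disc e. char_map C e x \<in> U}"
        by (simp add: closedin_closed_eq compact_imp_closed compact_disc)
      then have "closedin Y (char_map C e ` {x \<in> closed_disc e. char_map C e x \<in> U})"
        by (rule closed_disc_image_closed[OF e(1)]) auto
      moreover have "char_map C e ` {x \<in> closed_disc e. char_map C e x \<in> U} = U \<inter> char_map C e ` closed_disc e"
        by auto
      ultimately show "closedin Y (U \<inter> char_map C e ` closed_disc e)" by simp
    qed
    then show "closedin (skeleton r) U" using Us by (simp add: closedin_subset_topspace)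
  qed
qed

text \<open>A quotient map restricted to the preimage of an open set is again a quotient map, and so
  is its product with the compact Hausdorff interval. Homotopies that exist only over a set
  \<open>{f > 0}\<close> can therefore be tested on cells.\<close>

lemma continuous_map_skeleton_homotopy:
  assumes U: "openin (skeleton r) U"
    and g: "\<And>e. e \<in> cells C \<Longrightarrow> cell_dim C e < r \<Longrightarrow>
      continuous_map (top_of_set ({x \<in> closed_disc e. char_map C e x \<in> U} \<times> {0..1::real})) Z
        (\<lambda>z. g (char_map C e (fst z), snd z))"
  shows "continuous_map (prod_topology (subtopology (skeleton r) U) (top_of_set {0..1})) Z g"
proof -
  define V where "V = {z \<in> topspace (cell_discs r). attach z \<in> U}"
  have "quotient_map (subtopology (cell_discs r) V) (subtopology (skeleton r) U) attach"
    by (rule quotient_map_restriction[OF quotient_map_attach]) (use U in \<open>auto simp: V_def\<close>)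
  then have q: "quotient_map (prod_topology (subtopology (cell_discs r) V) (top_of_set {0..1::real}))
      (prod_topology (subtopology (skeleton r) U) (top_of_set {0..1})) (\<lambda>(z, t). (attach z, t))"
    by (intro quotient_map_prod_left)
       (auto intro: compact_imp_locally_compact_space Hausdorff_space_subtopology simp: compact_space_subtopology)
  let ?N = "prod_topology (subtopology (cell_discs r) V) (top_of_set {0..1::real})"
  have "continuous_map ?N Z (g \<circ> (\<lambda>(z, t). (attach z, t)))"
  proof (rule continuous_map_on_slices)
    show "continuous_map ?N (discrete_topology {e \<in> cells C. cell_dim C e < r}) (\<lambda>w. fst (fst w))"
      by (rule continuous_map_compose[OF continuous_map_fst, unfolded o_def])
         (rule continuous_map_from_subtopology[OF continuous_map_fst_cell_discs])
    fix e assume e: "e \<in> {e \<in> cells C. cell_dim C e < r}"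
    let ?A = "{x \<in> closed_disc e. char_map C e x \<in> U}"
    have "continuous_map (subtopology ?N {w. fst (fst w) = e}) (prod_topology (top_of_set ?A) (top_of_set {0..1}))
        (\<lambda>w. (snd (fst w), snd w))"
    proof -
      have 1: "continuous_map (subtopology ?N {w. fst (fst w) = e}) euclidean (\<lambda>w. snd (fst w))"
      proof -
        have "continuous_map (subtopology (cell_discs r) V) euclidean snd"
          unfolding cell_discs_def subtopology_subtopology by (rule continuous_map_subtopology_snd)
        then show ?thesis
          by (rule continuous_map_from_subtopology[OF continuous_map_compose[OF continuous_map_fst, unfolded o_def]])
      qed
      have 2: "continuous_map (subtopology ?N {w. fst (fst w) = e}) (top_of_set {0..1}) snd"
        by (intro continuous_map_from_subtopology continuous_map_snd)
      have "continuous_map (subtopology ?N {w. fst (fst w) = e}) (top_of_set ?A) (\<lambda>w. snd (fst w))"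
        using 1 by (auto simp: continuous_map_in_subtopology V_def topspace_cell_discs attach_def)
      then show ?thesis using 2 by (rule continuous_map_pairedI)
    qed
    from continuous_map_compose[OF this, of Z "\<lambda>z. g (char_map C e (fst z), snd z)"]
    have "continuous_map (subtopology ?N {w. fst (fst w) = e}) Z (\<lambda>w. g (char_map C e (snd (fst w)), snd w))"
      using g e by (simp add: o_def)
    then show "continuous_map (subtopology ?N {w. fst (fst w) = e}) Z (g \<circ> (\<lambda>(z, t). (attach z, t)))"
      by (rule continuous_map_eq) (auto simp: attach_def)
  qed
  then show ?thesis by (rule continuous_compose_quotient_map[OF q])
qed

lemma continuous_map_skeleton:
  assumes "\<And>e. e \<in> cells C \<Longrightarrow> cell_dim C e < r \<Longrightarrow>
      continuous_map (top_of_set (closed_disc e)) Z (\<lambda>x. g (char_map C e x))"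
  shows "continuous_map (skeleton r) Z g"
proof (rule continuous_compose_quotient_map[OF quotient_map_attach])
  show "continuous_map (cell_discs r) Z (g \<circ> attach)"
  proof (rule continuous_map_on_slices[OF continuous_map_fst_cell_discs])
    fix e assume "e \<in> {e \<in> cells C. cell_dim C e < r}"
    then have "continuous_map (subtopology (cell_discs r) {z. fst z = e}) Z ((\<lambda>x. g (char_map C e x)) \<circ> snd)"
      by (intro continuous_map_compose[OF continuous_map_snd_slice] assms) auto
    then show "continuous_map (subtopology (cell_discs r) {z. fst z = e}) Z (g \<circ> attach)"
      by (rule continuous_map_eq) (auto simp: attach_def)
  qed
qed

end

context cw
begin

text \<open>The old data are pulled back to the boundary sphere of each \<open>r\<close>-cell and
  extended over its disc. As the extension reproduces \<open>f\<close>, and \<open>H\<close> where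
  \<open>f\<close> is positive, the cells fit together with the lower skeleton.\<close>

lemma null_cover_skeleton_Suc:
  assumes fill: "\<And>j. j \<le> Suc s \<Longrightarrow> fills_cubes j X" and x0: "x0 \<in> topspace X"
    and incl: "continuous_map Y X (\<lambda>y. y)" and r: "r < k * Suc s"
    and n: "null_cover k (skeleton r) X (\<lambda>y. y) x0 f H"
  obtains f' H' where "null_cover k (skeleton (Suc r)) X (\<lambda>y. y) x0 f' H'"
proof -
  have cX: "continuous_map (top_of_set (closed_disc e)) X (char_map C e)" if "e \<in> cells C" for e
    using continuous_map_compose[OF char_map_continuous[OF that] incl] by (simp add: o_def)
  define new where "new e F G \<longleftrightarrow> null_cover k (top_of_set (closed_disc e)) X (char_map C e) x0 F G \<and>
    (\<forall>i<k. \<forall>x\<in>disc_boundary r. F i x = f i (char_map C e x)) \<and>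
    (\<forall>i<k. \<forall>x\<in>disc_boundary r. 0 < f i (char_map C e x) \<longrightarrow>
       (\<forall>t\<in>{0..1}. G i (x, t) = H i (char_map C e x, t)))" for e F G
  have "\<exists>F G. new e F G" if e: "e \<in> cells C" "cell_dim C e = r" for e
  proof -
    have bdY: "continuous_map (top_of_set (disc_boundary r)) Y (char_map C e)"
      by (rule continuous_map_top_of_set_subset[OF char_map_continuous[OF e(1)]]) (auto simp: e disc_eq(1))
    have "continuous_map (top_of_set (disc_boundary r)) (skeleton r) (char_map C e)"
      using bdY boundary_in_skeleton_below[OF e(1)] e(2) by (auto simp: continuous_map_in_subtopology)
    from null_cover_pullback[OF this n]
    have bd: "null_cover k (top_of_set (disc_boundary r)) X (char_map C e) x0
       (\<lambda>i x. f i (char_map C e x)) (\<lambda>i z. H i (char_map C e (fst z), snd z))" .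
    obtain F G where "null_cover k (top_of_set (disc r)) X (char_map C e) x0 F G"
      "\<And>i x. i < k \<Longrightarrow> x \<in> disc_boundary r \<Longrightarrow> F i x = f i (char_map C e x)"
      "\<And>i x t. i < k \<Longrightarrow> x \<in> disc_boundary r \<Longrightarrow> 0 < f i (char_map C e x) \<Longrightarrow> t \<in> {0..1} \<Longrightarrow>
        G i (x, t) = H i (char_map C e (fst (x, t)), snd (x, t))"
      by (rule null_cover_extend_disc[OF fill x0 r cX[OF e(1), unfolded e(2)] bd], assumption, rule that)
    then have "new e F G" unfolding new_def e(2) by auto
    then show ?thesis by blast
  qed
  then obtain F G where new: "\<And>e. e \<in> cells C \<Longrightarrow> cell_dim C e = r \<Longrightarrow> new e (F e) (G e)" by metis

  \<comment> \<open>A new point lies in one \<open>r\<close>-cell only and has one preimage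
    \<open>pre\<close> in the open disc. Continuity of \<open>f'\<close> and \<open>H'\<close> is
    examined after composition with the characteristic maps, where they turn into \<open>F e\<close>
    and \<open>G e\<close>.\<close>
  define cell where "cell y = (THE e. e \<in> cells C \<and> y \<in> e)" for y
  define pre where "pre y = inv_into (open_disc r) (char_map C (cell y)) y" for y
  define f' where "f' i y = (if y \<in> skeleton_below r then f i y else F (cell y) i (pre y))" for i y
  define H' where "H' i z = (if fst z \<in> skeleton_below r then H i z else G (cell (fst z)) i (pre (fst z), snd z))" for i z

  have inner: "cell (char_map C e x) = e \<and> pre (char_map C e x) = x \<and> char_map C e x \<notin> skeleton_below r"
    if e: "e \<in> cells C" "cell_dim C e = r" and x: "x \<in> open_disc r" for e x
  proof -
    have y: "char_map C e x \<in> e" using char_map_open_disc(1)[OF e(1)] e(2) x by auto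
    have c: "cell (char_map C e x) = e"
      unfolding cell_def using e(1) y cells_disjoint by (intro the_equality) auto
    moreover have "pre (char_map C e x) = x"
      unfolding pre_def c using char_map_open_disc(2)[OF e(1)] e(2) x by (simp add: inv_into_f_f)
    moreover have "char_map C e x \<notin> skeleton_below r"
      using not_in_skeleton_below[OF e(1), of r] e(2) y by auto
    ultimately show ?thesis by simp
  qed
  have old_f: "f' i (char_map C e x) = f i (char_map C e x)"
    and old_H: "H' i (char_map C e x, t) = H i (char_map C e x, t)"
    if "e \<in> cells C" "cell_dim C e < r" "x \<in> closed_disc e" for i e x t
    using closed_disc_in_skeleton_below[OF that] by (simp_all add: f'_def H'_def)
  have new_f: "f' i (char_map C e x) = F e i x"
    if e: "e \<in> cells C" "cell_dim C e = r" and x: "x \<in> disc r" and i: "i < k" for i e x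
  proof (cases "x \<in> open_disc r")
    case True
    then show ?thesis using inner[OF e] by (simp add: f'_def)
  next
    case False
    then have b: "x \<in> disc_boundary r" using x disc_eq(1)[of r] by auto
    then show ?thesis using boundary_in_skeleton_below[OF e(1)] e(2) new[OF e] i by (simp add: f'_def new_def)
  qed
  have new_H: "H' i (char_map C e x, t) = G e i (x, t)"
    if e: "e \<in> cells C" "cell_dim C e = r" and x: "x \<in> disc r" and i: "i < k"
      and pos: "0 < f' i (char_map C e x)" and t: "t \<in> {0..1}" for i e x t
  proof (cases "x \<in> open_disc r")
    case True
    then show ?thesis using inner[OF e] by (simp add: H'_def)
  next
    case False
    then have b: "x \<in> disc_boundary r" using x disc_eq(1)[of r] by auto
    then have sk: "char_map C e x \<in> skeleton_below r" using boundary_in_skeleton_below[OF e(1)] e(2) by simp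
    then have "0 < f i (char_map C e x)" using pos by (simp add: f'_def)
    then show ?thesis using new[OF e] b i t sk by (simp add: H'_def new_def)
  qed

  have cF: "null_cover k (top_of_set (disc r)) X (char_map C e) x0 (F e) (G e)"
    if "e \<in> cells C" "cell_dim C e = r" for e
    using new[OF that] that(2) by (simp add: new_def)
  note ncF = cF[unfolded null_cover_top_of_set]
  have old: "null_cover k (top_of_set (closed_disc e)) X (char_map C e) x0
       (\<lambda>i x. f i (char_map C e x)) (\<lambda>i z. H i (char_map C e (fst z), snd z))"
    if e: "e \<in> cells C" "cell_dim C e < r" for e
  proof (rule null_cover_pullback[OF _ n])
    show "continuous_map (top_of_set (closed_disc e)) (skeleton r) (char_map C e)"
      using char_map_continuous[OF e(1)] closed_disc_in_skeleton_below[OF e]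
      by (auto simp: continuous_map_in_subtopology)
  qed
  have cells_Suc: "cell_dim C e < r \<or> cell_dim C e = r" if "cell_dim C e < Suc r" for e
    using that by auto
  have contf: "continuous_map (skeleton (Suc r)) euclideanreal (f' i)" if i: "i < k" for i
  proof (rule continuous_map_skeleton)
    fix e assume e: "e \<in> cells C" "cell_dim C e < Suc r"
    show "continuous_map (top_of_set (closed_disc e)) euclideanreal (\<lambda>x. f' i (char_map C e x))"
      using cells_Suc[OF e(2)]
    proof
      assume l: "cell_dim C e < r"
      have "continuous_map (top_of_set (closed_disc e)) euclideanreal (\<lambda>x. f i (char_map C e x))"
        using old[OF e(1) l] i by (simp add: null_cover_def)
      then show ?thesis by (rule continuous_map_eq) (use old_f[OF e(1) l] in simp)
    next
      assume d: "cell_dim C e = r"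
      have "continuous_map (top_of_set (disc r)) euclideanreal (F e i)"
        using cF[OF e(1) d] i by (simp add: null_cover_def)
      then show ?thesis unfolding d by (rule continuous_map_eq) (use new_f[OF e(1) d _ i] in simp)
    qed
  qed
  have points: "\<exists>e x. e \<in> cells C \<and> cell_dim C e < Suc r \<and> x \<in> closed_disc e \<and> y = char_map C e x"
    if y: "y \<in> skeleton_below (Suc r)" for y
  proof -
    obtain e where e: "e \<in> cells C" "cell_dim C e < Suc r" "y \<in> e" using y by (auto simp: skeleton_below_def)
    then obtain x where "x \<in> open_disc (cell_dim C e)" "y = char_map C e x"
      using char_map_open_disc(1)[OF e(1)] by auto
    then show ?thesis using e disc_eq(1) by blast
  qed
  have "null_cover k (skeleton (Suc r)) X (\<lambda>y. y) x0 f' H'"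
    unfolding null_cover_def topspace_skeleton
  proof (intro conjI allI impI ballI)
    fix i assume i: "i < k"
    show "continuous_map (skeleton (Suc r)) euclideanreal (f' i)" by (rule contf[OF i])
    let ?U = "{y \<in> topspace (skeleton (Suc r)). 0 < f' i y}"
    \<comment> \<open>Since \<open>f' i\<close> is already continuous on the skeleton, its
      positivity set is open, as the criterion for homotopies demands.\<close>
    have "openin (skeleton (Suc r)) ?U"
      using openin_continuous_map_preimage[OF contf[OF i], of "{0<..}"] by simp
    then have "continuous_map (prod_topology (subtopology (skeleton (Suc r)) ?U) (top_of_set {0..1})) X (H' i)"
    proof (rule continuous_map_skeleton_homotopy)
      fix e assume e: "e \<in> cells C" "cell_dim C e < Suc r"
      have U: "{x \<in> closed_disc e. char_map C e x \<in> ?U} = {x \<in> closed_disc e. 0 < f' i (char_map C e x)}"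
        using closed_disc_in_skeleton_below[OF e] by (auto simp: topspace_skeleton simp del: topspace_subtopology)
      show "continuous_map (top_of_set ({x \<in> closed_disc e. char_map C e x \<in> ?U} \<times> {0..1})) X
          (\<lambda>z. H' i (char_map C e (fst z), snd z))"
        unfolding U using cells_Suc[OF e(2)]
      proof
        assume l: "cell_dim C e < r"
        have "continuous_map (top_of_set ({x \<in> closed_disc e. 0 < f i (char_map C e x)} \<times> {0..1})) X
            (\<lambda>z. H i (char_map C e (fst z), snd z))"
          using old[OF e(1) l] i unfolding null_cover_top_of_set by blast
        moreover have "{x \<in> closed_disc e. 0 < f' i (char_map C e x)} = {x \<in> closed_disc e. 0 < f i (char_map C e x)}"
          using old_f[OF e(1) l] by auto
        ultimately show "continuous_map (top_of_set ({x \<in> closed_disc e. 0 < f' i (char_map C e x)} \<times> {0..1})) X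
            (\<lambda>z. H' i (char_map C e (fst z), snd z))"
          using old_H[OF e(1) l] by (auto intro: continuous_map_eq)
      next
        assume d: "cell_dim C e = r"
        have "continuous_map (top_of_set ({x \<in> disc r. 0 < F e i x} \<times> {0..1})) X (G e i)"
          using ncF[OF e(1) d] i by blast
        then show "continuous_map (top_of_set ({x \<in> closed_disc e. 0 < f' i (char_map C e x)} \<times> {0..1})) X
            (\<lambda>z. H' i (char_map C e (fst z), snd z))"
          unfolding d
          by (rule continuous_map_top_of_set_subset) (use new_f[OF e(1) d _ i] new_H[OF e(1) d _ i] in auto)
      qed
    qed
    moreover have "subtopology (skeleton (Suc r)) ?U = subtopology (skeleton (Suc r)) {y. 0 < f' i y}"
    proof -
      have "?U = topspace (skeleton (Suc r)) \<inter> {y. 0 < f' i y}" by auto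
      then show ?thesis by (simp only: subtopology_restrict)
    qed
    ultimately show "continuous_map (prod_topology (subtopology (skeleton (Suc r)) {y. 0 < f' i y}) (top_of_set {0..1})) X (H' i)"
      by simp
  next
    fix i y assume i: "i < k" and y: "y \<in> skeleton_below (Suc r)"
    obtain e x where e: "e \<in> cells C" "cell_dim C e < Suc r" and x: "x \<in> closed_disc e" and yx: "y = char_map C e x"
      using points[OF y] by blast
    have "(0 \<le> f' i y \<and> f' i y \<le> 1) \<and> (0 < f' i y \<longrightarrow> H' i (y, 0) = y \<and> H' i (y, 1) = x0)"
      using cells_Suc[OF e(2)]
    proof
      assume l: "cell_dim C e < r"
      then show ?thesis
        using old[OF e(1) l] i x old_f[OF e(1) l x] old_H[OF e(1) l x] unfolding yx null_cover_top_of_set by simp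
    next
      assume d: "cell_dim C e = r"
      then have x': "x \<in> disc r" using x by simp
      have nf: "f' i y = F e i x" unfolding yx by (rule new_f[OF e(1) d x' i])
      have nH: "H' i (y, t) = G e i (x, t)" if "0 < f' i y" "t \<in> {0..1}" for t
        using that unfolding yx by (intro new_H[OF e(1) d x' i]) auto
      show ?thesis
        using ncF[OF e(1) d] i x' nH[of 0] nH[of 1] unfolding nf by (auto simp: yx)
    qed
    then show "0 \<le> f' i y" "f' i y \<le> 1" "0 < f' i y \<Longrightarrow> H' i (y, 0) = y" "0 < f' i y \<Longrightarrow> H' i (y, 1) = x0"
      by auto
  next
    fix y assume y: "y \<in> skeleton_below (Suc r)"
    obtain e x where e: "e \<in> cells C" "cell_dim C e < Suc r" and x: "x \<in> closed_disc e" and yx: "y = char_map C e x"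
      using points[OF y] by blast
    show "\<exists>i<k. f' i y = 1" using cells_Suc[OF e(2)]
    proof
      assume l: "cell_dim C e < r"
      then show ?thesis
        using old[OF e(1) l] x old_f[OF e(1) l x] unfolding yx null_cover_top_of_set by simp
    next
      assume d: "cell_dim C e = r"
      then show ?thesis
        using ncF[OF e(1) d] x new_f[OF e(1) d] unfolding yx by fastforce
    qed
  qed
  then show thesis by (rule that)
qed

lemma null_cover_of_finite_dim:
  assumes fill: "\<And>j. j \<le> Suc s \<Longrightarrow> fills_cubes j X" and x0: "x0 \<in> topspace X"
    and incl: "continuous_map Y X (\<lambda>y. y)" and dim: "\<And>e. e \<in> cells C \<Longrightarrow> cell_dim C e \<le> n"
    and k: "n < k * Suc s"
  obtains f H where "null_cover k Y X (\<lambda>y. y) x0 f H"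
proof -
  have "\<exists>f H. null_cover k (skeleton r) X (\<lambda>y. y) x0 f H" if "r \<le> Suc n" for r
    using that
  proof (induction r)
    case 0
    \<comment> \<open>On the empty space arbitrary functions form a null cover vacuously.\<close>
    have "skeleton_below 0 = {}" by (simp add: skeleton_below_def)
    then show ?case
      by (intro exI[of _ "\<lambda>_ _. 0"] exI[of _ "\<lambda>_ _. x0"])
         (simp add: null_cover_def)
  next
    case (Suc r)
    then obtain f H where "null_cover k (skeleton r) X (\<lambda>y. y) x0 f H" by auto
    moreover have "r < k * Suc s" using Suc.prems k by simp
    ultimately show ?case
      using null_cover_skeleton_Suc[OF fill x0 incl] by metis
  qed
  from this[of "Suc n"] obtain f H where *: "null_cover k (skeleton (Suc n)) X (\<lambda>y. y) x0 f H" by auto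
  have "skeleton_below (Suc n) = topspace Y"
  proof -
    have "{e \<in> cells C. cell_dim C e < Suc n} = cells C" using dim by (auto simp: less_Suc_eq_le)
    then show ?thesis using cw by (simp add: skeleton_below_def cw_complex_def)
  qed
  then have "skeleton (Suc n) = Y" by simp
  with * that show thesis by simp
qed

end

section \<open>Motion planners\<close>

text \<open>The exponential law: for compact \<open>K\<close> and open \<open>V\<close> the
  condition \<open>S (z, t) \<in> V\<close> for all \<open>t \<in> K\<close> is open in
  \<open>z\<close> by the tube lemma, so the adjoint of \<open>S\<close> is continuous into the
  compact-open topology. \<open>restrict\<close> makes the paths extensional, as
  \<open>paths\<close> demands.\<close>

lemma has_motion_planner_of_homotopy:
  assumes S: "continuous_map (prod_topology (subtopology (prod_topology X X) U) (top_of_set {0..1::real})) X S"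
    and U: "U \<subseteq> A" "U \<subseteq> topspace X \<times> topspace X"
    and S0: "\<And>z. z \<in> U \<Longrightarrow> S (z, 0) = fst z" and S1: "\<And>z. z \<in> U \<Longrightarrow> S (z, 1) = snd z"
  shows "has_motion_planner X A U"
proof -
  let ?N = "subtopology (prod_topology X X) U"
  let ?I = "top_of_set {0..1::real}"
  have tN: "topspace ?N = U" using U(2) by auto
  define s where "s z = restrict (\<lambda>t. S (z, t)) {0..1}" for z
  have paths: "s z \<in> paths X" if "z \<in> U" for z
  proof -
    have "continuous_map ?I (prod_topology ?N ?I) (\<lambda>t. (z, t))"
      using that U(2) by (auto simp: continuous_map_pairwise o_def)
    from continuous_map_compose[OF this S] have "continuous_map ?I X (\<lambda>t. S (z, t))" by (simp add: o_def)
    then have "continuous_map ?I X (s z)" by (rule continuous_map_eq) (auto simp: s_def)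
    then show ?thesis by (auto simp: paths_def pathin_def s_def)
  qed
  have "continuous_map ?N (path_space X) s"
    unfolding path_space_def
  proof (rule continuous_on_generated_topo)
    fix O' assume "O' \<in> {{\<sigma> \<in> paths X. \<sigma> ` K \<subseteq> V} | K V. K \<subseteq> {0..1} \<and> compact K \<and> openin X V}"
    then obtain K V where O': "O' = {\<sigma> \<in> paths X. \<sigma> ` K \<subseteq> V}" and K: "K \<subseteq> {0..1}" "compact K" and V: "openin X V"
      by blast
    have eq: "s -` O' \<inter> topspace ?N = {z \<in> U. \<forall>t\<in>K. S (z, t) \<in> V}"
    proof -
      have "s z ` K \<subseteq> V \<longleftrightarrow> (\<forall>t\<in>K. S (z, t) \<in> V)" for z
        using K(1) by (auto simp: s_def image_subset_iff subset_iff)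
      then show ?thesis unfolding tN O' using paths by auto
    qed
    define W where "W = {w \<in> topspace (prod_topology ?N ?I). S w \<in> V}"
    have oW: "openin (prod_topology ?N ?I) W"
      unfolding W_def by (rule openin_continuous_map_preimage[OF S V])
    have "\<exists>T. openin ?N T \<and> z \<in> T \<and> T \<subseteq> {z \<in> U. \<forall>t\<in>K. S (z, t) \<in> V}"
      if z: "z \<in> {z \<in> U. \<forall>t\<in>K. S (z, t) \<in> V}" for z
    proof -
      have "\<exists>T L. openin ?N T \<and> openin ?I L \<and> z \<in> T \<and> K \<subseteq> L \<and> T \<times> L \<subseteq> W"
      proof (rule tube_lemma_right[OF oW])
        show "compactin ?I K" using K by (simp add: compactin_subtopology)
        show "z \<in> topspace ?N" using z tN by auto
        show "{z} \<times> K \<subseteq> W" using z K(1) tN by (auto simp: W_def)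
      qed
      then obtain T L where T: "openin ?N T" "z \<in> T" "K \<subseteq> L" "T \<times> L \<subseteq> W" by blast
      have "T \<subseteq> {z \<in> U. \<forall>t\<in>K. S (z, t) \<in> V}"
      proof
        fix y assume y: "y \<in> T"
        then have "y \<in> U" using openin_subset[OF T(1)] tN by auto
        moreover have "S (y, t) \<in> V" if "t \<in> K" for t
          using T(3,4) y that by (auto simp: W_def)
        ultimately show "y \<in> {z \<in> U. \<forall>t\<in>K. S (z, t) \<in> V}" by simp
      qed
      with T show ?thesis by blast
    qed
    then have "openin ?N {z \<in> U. \<forall>t\<in>K. S (z, t) \<in> V}"
      by (subst openin_subopen) blast
    then show "openin ?N (s -` O' \<inter> topspace ?N)" unfolding eq .
  next
    have "s ` topspace ?N \<subseteq> paths X" unfolding tN using paths by auto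
    moreover have "\<Union>{{\<sigma> \<in> paths X. \<sigma> ` K \<subseteq> V} | K V. K \<subseteq> {0..1} \<and> compact K \<and> openin X V} = paths X"
      using topspace_path_space[of X] unfolding path_space_def topology_generated_by_topspace .
    ultimately show "s ` topspace ?N \<subseteq> \<Union>{{\<sigma> \<in> paths X. \<sigma> ` K \<subseteq> V} | K V. K \<subseteq> {0..1} \<and> compact K \<and> openin X V}"
      by simp
  qed
  moreover have ends: "s z 0 = fst z \<and> s z 1 = snd z" if "z \<in> U" for z
    using S0[OF that] S1[OF that] by (simp add: s_def)
  ultimately have "continuous_map ?N (path_space_over X A) s"
    unfolding path_space_over_def continuous_map_in_subtopology using tN U(1) by auto
  then show ?thesis
    unfolding has_motion_planner_def using ends by (intro exI[of _ s]) auto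
qed

text \<open>The path runs from the first point to \<open>x0\<close> along \<open>h\<close> and then
  along \<open>k\<close> in reverse to the second point, each at double speed.\<close>

lemma homotopy_of_nullhomotopies:
  fixes X :: "'a topology" and h k :: "'a \<times> real \<Rightarrow> 'a"
  assumes h: "continuous_map (prod_topology (subtopology X V1) (top_of_set {0..1})) X h"
    and h0: "\<And>x. x \<in> V1 \<Longrightarrow> h (x, 0) = x" and h1: "\<And>x. x \<in> V1 \<Longrightarrow> h (x, 1) = x0"
    and k: "continuous_map (prod_topology (subtopology X V2) (top_of_set {0..1})) X k"
    and k0: "\<And>x. x \<in> V2 \<Longrightarrow> k (x, 0) = x" and k1: "\<And>x. x \<in> V2 \<Longrightarrow> k (x, 1) = x0"
    and W: "W \<subseteq> V1 \<times> V2"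
  obtains S where "continuous_map (prod_topology (subtopology (prod_topology X X) W) (top_of_set {0..1::real})) X S"
    "\<And>z. z \<in> W \<Longrightarrow> S (z, 0) = fst z" "\<And>z. z \<in> W \<Longrightarrow> S (z, 1) = snd z"
proof -
  let ?I = "top_of_set {0..1::real}"
  let ?N = "prod_topology (subtopology (prod_topology X X) W) ?I"
  have c1: "continuous_map ?N X (\<lambda>w. fst (fst w))"
    by (rule continuous_map_compose[OF continuous_map_fst, unfolded o_def]) (rule continuous_map_subtopology_fst)
  have c2: "continuous_map ?N X (\<lambda>w. snd (fst w))"
    by (rule continuous_map_compose[OF continuous_map_fst, unfolded o_def]) (rule continuous_map_subtopology_snd)
  have cs: "continuous_map ?N euclideanreal snd"
    using continuous_map_snd[of "subtopology (prod_topology X X) W" ?I] by (simp add: continuous_map_in_subtopology)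
  have cs1: "continuous_map ?N euclideanreal (\<lambda>w. 2 * snd w)" and cs2: "continuous_map ?N euclideanreal (\<lambda>w. 2 - 2 * snd w)"
    by (intro continuous_map_real_mult continuous_map_diff continuous_map_const[THEN iffD2] cs; simp)+
  define S where "S w = (if snd w \<le> 1/2 then h (fst (fst w), 2 * snd w) else k (snd (fst w), 2 - 2 * snd w))" for w
  have "continuous_map ?N X S"
    unfolding S_def
  proof (rule continuous_map_cases_le)
    show "continuous_map ?N euclideanreal snd" by (rule cs)
    show "continuous_map ?N euclideanreal (\<lambda>w. 1/2)" by simp
    let ?M = "subtopology ?N {w \<in> topspace ?N. snd w \<le> 1/2}"
    have 1: "continuous_map ?M (prod_topology (subtopology X V1) ?I) (\<lambda>w. (fst (fst w), 2 * snd w))"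
    proof (rule continuous_map_pairedI)
      show "continuous_map ?M (subtopology X V1) (\<lambda>w. fst (fst w))"
        using continuous_map_from_subtopology[OF c1] W by (auto simp: continuous_map_in_subtopology)
      show "continuous_map ?M ?I (\<lambda>w. 2 * snd w)"
        using continuous_map_from_subtopology[OF cs1] by (auto simp: continuous_map_in_subtopology)
    qed
    from continuous_map_compose[OF this h]
    show "continuous_map ?M X (\<lambda>w. h (fst (fst w), 2 * snd w))" by (simp add: o_def)
    let ?M = "subtopology ?N {w \<in> topspace ?N. 1/2 \<le> snd w}"
    have "continuous_map ?M (prod_topology (subtopology X V2) ?I) (\<lambda>w. (snd (fst w), 2 - 2 * snd w))"
    proof (rule continuous_map_pairedI)
      show "continuous_map ?M (subtopology X V2) (\<lambda>w. snd (fst w))"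
        using continuous_map_from_subtopology[OF c2] W by (auto simp: continuous_map_in_subtopology)
      show "continuous_map ?M ?I (\<lambda>w. 2 - 2 * snd w)"
        using continuous_map_from_subtopology[OF cs2] by (auto simp: continuous_map_in_subtopology)
    qed
    from continuous_map_compose[OF this k]
    show "continuous_map ?M X (\<lambda>w. k (snd (fst w), 2 - 2 * snd w))" by (simp add: o_def)
    show "h (fst (fst w), 2 * snd w) = k (snd (fst w), 2 - 2 * snd w)" if "w \<in> topspace ?N" "snd w = 1/2" for w
    proof -
      have "fst (fst w) \<in> V1" "snd (fst w) \<in> V2" using that(1) W by auto
      then show ?thesis using h1 k1 by (simp add: that(2))
    qed
  qed
  moreover have "S (z, 0) = fst z" "S (z, 1) = snd z" if "z \<in> W" for z
    using that W h0 k0 by (auto simp: S_def)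
  ultimately show thesis by (rule that)
qed

text \<open>Over disjoint open sets the planners need not match. They are pasted as homotopies,
  before the passage to path space.\<close>

lemma has_motion_planner_disjoint_Union:
  assumes W: "\<And>R. R \<in> \<R> \<Longrightarrow> openin (subtopology (prod_topology X X) A) (W R)" and A: "A \<subseteq> topspace X \<times> topspace X"
    and dis: "\<And>R R'. R \<in> \<R> \<Longrightarrow> R' \<in> \<R> \<Longrightarrow> R \<noteq> R' \<Longrightarrow> W R \<inter> W R' = {}"
    and S: "\<And>R. R \<in> \<R> \<Longrightarrow> continuous_map (prod_topology (subtopology (prod_topology X X) (W R)) (top_of_set {0..1::real})) X (S R)"
    and S0: "\<And>R z. R \<in> \<R> \<Longrightarrow> z \<in> W R \<Longrightarrow> S R (z, 0) = fst z" and S1: "\<And>R z. R \<in> \<R> \<Longrightarrow> z \<in> W R \<Longrightarrow> S R (z, 1) = snd z"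
  shows "has_motion_planner X A (\<Union>R\<in>\<R>. W R)"
proof -
  let ?U = "\<Union>R\<in>\<R>. W R"
  let ?N = "prod_topology (subtopology (prod_topology X X) ?U) (top_of_set {0..1::real})"
  have WA: "W R \<subseteq> A" if "R \<in> \<R>" for R using openin_subset[OF W[OF that]] by auto
  have tN: "topspace ?N = ?U \<times> {0..1}" using WA A by auto
  obtain G where G: "continuous_map ?N X G"
    and GS: "\<And>w R. R \<in> \<R> \<Longrightarrow> w \<in> topspace ?N \<inter> W R \<times> {0..1} \<Longrightarrow> G w = S R w"
  proof (rule pasting_lemma_exists[where X = ?N and Y = X and I = \<R> and T = "\<lambda>R. W R \<times> {0..1}" and f = S])
    show "topspace ?N \<subseteq> (\<Union>R\<in>\<R>. W R \<times> {0..1})" unfolding tN by auto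
    show "openin ?N (W R \<times> {0..1})" if R: "R \<in> \<R>" for R
    proof -
      have "openin (subtopology (prod_topology X X) ?U) (W R)"
      proof -
        obtain T where "openin (prod_topology X X) T" "W R = T \<inter> A" using W[OF R] by (auto simp: openin_subtopology)
        moreover from this have "W R = T \<inter> ?U" using R WA by blast
        ultimately show ?thesis by (auto simp: openin_subtopology)
      qed
      then show ?thesis by (simp add: openin_prod_Times_iff)
    qed
    show "continuous_map (subtopology ?N (W R \<times> {0..1})) X (S R)" if R: "R \<in> \<R>" for R
    proof -
      have "?U \<inter> W R = W R" using R by auto
      then have "subtopology ?N (W R \<times> {0..1}) = prod_topology (subtopology (prod_topology X X) (W R)) (top_of_set {0..1})"
        by (simp add: subtopology_Times subtopology_subtopology)
      then show ?thesis using S[OF R] by simp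
    qed
    show "S R w = S R' w" if "R \<in> \<R>" "R' \<in> \<R>" "w \<in> topspace ?N \<inter> W R \<times> {0..1} \<inter> W R' \<times> {0..1}" for R R' w
    proof -
      have "R = R'" using dis[OF that(1,2)] that(3) by blast
      then show ?thesis by simp
    qed
  qed (rule that)
  have ends: "G (z, t) = S R (z, t)" if "R \<in> \<R>" "z \<in> W R" "t \<in> {0..1}" for R z t
    by (rule GS[OF that(1)]) (use that tN in auto)
  show ?thesis
  proof (rule has_motion_planner_of_homotopy[OF G])
    show "?U \<subseteq> A" using WA by auto
    then show "?U \<subseteq> topspace X \<times> topspace X" using A by auto
    show "G (z, 0) = fst z" "G (z, 1) = snd z" if "z \<in> ?U" for z
    proof -
      obtain R where "R \<in> \<R>" "z \<in> W R" using \<open>z \<in> ?U\<close> by blast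
      then show "G (z, 0) = fst z" "G (z, 1) = snd z" using ends S0 S1 by simp_all
    qed
  qed
qed

section \<open>Sorting the points of the product by their dominant indices\<close>

lemma openin_conj:
  assumes "openin P {z \<in> topspace P. A z}" "openin P {z \<in> topspace P. B z}"
  shows "openin P {z \<in> topspace P. A z \<and> B z}"
proof -
  have "{z \<in> topspace P. A z \<and> B z} = {z \<in> topspace P. A z} \<inter> {z \<in> topspace P. B z}" by auto
  then show ?thesis using assms by (simp add: openin_Int)
qed

lemma openin_finite_Ball:
  assumes "finite J" "\<And>j. j \<in> J \<Longrightarrow> openin P {z \<in> topspace P. Q j z}"
  shows "openin P {z \<in> topspace P. \<forall>j\<in>J. Q j z}"
  using assms by (induction J rule: finite_induct) (auto intro: openin_conj)

lemma TC_le_of_null_covers: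
  fixes X :: "'a topology"
  assumes Y: "Y1 \<subseteq> topspace X" "Y2 \<subseteq> topspace X"
    and n1: "null_cover k1 (subtopology X Y1) X (\<lambda>y. y) x0 f H"
    and n2: "null_cover k2 (subtopology X Y2) X (\<lambda>y. y) x0 g K"
  shows "TC X (Y1 \<times> Y2) \<le> enat (k1 + k2 - 1)"
proof -
  define P where "P = subtopology (prod_topology X X) (Y1 \<times> Y2)"
  have tP: "topspace P = Y1 \<times> Y2" using Y by (auto simp: P_def)
  define h where "h l z = (if l < k1 then f l (fst z) else g (l - k1) (snd z))" for l and z :: "'a \<times> 'a"
  let ?L = "{..<k1 + k2}"
  have tY: "topspace (subtopology X Y1) = Y1" "topspace (subtopology X Y2) = Y2" using Y by auto
  have ch: "continuous_map P euclideanreal (h l)" if "l \<in> ?L" for l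
  proof (cases "l < k1")
    case True
    have "continuous_map P (subtopology X Y1) fst"
      unfolding P_def by (auto simp: continuous_map_in_subtopology continuous_map_subtopology_fst)
    from continuous_map_compose[OF this, of euclideanreal "f l"] n1 True show ?thesis
      by (simp add: null_cover_def h_def[abs_def] o_def)
  next
    case False
    have "continuous_map P (subtopology X Y2) snd"
      unfolding P_def by (auto simp: continuous_map_in_subtopology continuous_map_subtopology_snd)
    moreover have "l - k1 < k2" using False that by auto
    ultimately show ?thesis
      using continuous_map_compose[of P "subtopology X Y2" snd euclideanreal "g (l - k1)"] n2 False
      by (simp add: null_cover_def h_def[abs_def] o_def)
  qed
  \<comment> \<open>Members of \<open>R\<close> are positive and beat all other indices. Distinct
    sets \<open>R\<close> and \<open>R'\<close> of equal size each own an index that the other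
    lacks, and at a common point these two indices would have to beat one another.\<close>
  define W where "W R = {z \<in> Y1 \<times> Y2. (\<forall>a\<in>R. 0 < h a z \<and> (\<forall>b\<in>?L - R. h b z < h a z))}" for R
  have oW: "openin P (W R)" if R: "R \<subseteq> ?L" for R
  proof -
    have fin: "finite R" using R finite_subset by blast
    have pos: "openin P {z \<in> topspace P. 0 < h a z}" if "a \<in> R" for a
      using openin_continuous_map_preimage[OF ch, of a "{0<..}"] that R by auto
    have less: "openin P {z \<in> topspace P. h b z < h a z}" if "a \<in> R" "b \<in> ?L - R" for a b
    proof -
      have "continuous_map P euclideanreal (\<lambda>z. h a z - h b z)"
        using that R by (intro continuous_map_diff ch) auto
      from openin_continuous_map_preimage[OF this, of "{0<..}"] show ?thesis by simp
    qed
    have "openin P {z \<in> topspace P. \<forall>a\<in>R. 0 < h a z \<and> (\<forall>b\<in>?L - R. h b z < h a z)}"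
      by (intro openin_finite_Ball openin_conj fin pos less) auto
    then show ?thesis unfolding tP W_def .
  qed
  have dis: "W R \<inter> W R' = {}" if R: "R \<subseteq> ?L" "R' \<subseteq> ?L" "card R = card R'" "R \<noteq> R'" for R R'
  proof -
    have fin: "finite R" "finite R'" using R finite_subset by blast+
    have "\<not> R \<subseteq> R'" "\<not> R' \<subseteq> R" using R(3,4) fin card_subset_eq by metis+
    then obtain a b where ab: "a \<in> R" "a \<notin> R'" "b \<in> R'" "b \<notin> R" by blast
    then have "a \<in> ?L - R'" "b \<in> ?L - R" using R by auto
    then have "h b z < h a z" "h a z < h b z" if "z \<in> W R \<inter> W R'" for z
      using that ab unfolding W_def by blast+
    then show ?thesis by fastforce
  qed
  \<comment> \<open>An index from each list provides null-homotopies of both coordinates, which make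
    up a planner. The shift by \<open>2\<close> lets the sizes from \<open>2\<close> to
    \<open>k1 + k2\<close> correspond to \<open>m < k1 + k2 - 1\<close>.\<close>
  define good where "good m = {R. R \<subseteq> ?L \<and> card R = m + 2 \<and> (\<exists>i\<in>R. i < k1) \<and> (\<exists>j\<in>R. k1 \<le> j)}" for m
  have plan: "has_motion_planner X (Y1 \<times> Y2) (\<Union>R\<in>good m. W R)" for m
  proof -
    define ok where "ok R S \<longleftrightarrow> continuous_map (prod_topology (subtopology (prod_topology X X) (W R)) (top_of_set {0..1::real})) X S \<and>
      (\<forall>z\<in>W R. S (z, 0) = fst z) \<and> (\<forall>z\<in>W R. S (z, 1) = snd z)" for R S
    have "\<exists>S. ok R S" if R: "R \<in> good m" for R
    proof -
      obtain i j where i: "i \<in> R" "i < k1" and j: "j \<in> R" "k1 \<le> j" and RL: "R \<subseteq> ?L"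
        using R by (auto simp: good_def)
      have j2: "j - k1 < k2" using j RL by auto
      define V1 where "V1 = {x \<in> Y1. 0 < f i x}"
      define V2 where "V2 = {x \<in> Y2. 0 < g (j - k1) x}"
      have WV: "W R \<subseteq> V1 \<times> V2"
      proof
        fix z assume z: "z \<in> W R"
        then have "0 < h i z" "0 < h j z" "z \<in> Y1 \<times> Y2" using i j by (auto simp: W_def)
        then show "z \<in> V1 \<times> V2" using i(2) j(2) by (auto simp: h_def V1_def V2_def)
      qed
      have e1: "subtopology (subtopology X Y1) {x. 0 < f i x} = subtopology X V1"
        and e2: "subtopology (subtopology X Y2) {x. 0 < g (j - k1) x} = subtopology X V2"
        unfolding subtopology_subtopology V1_def V2_def by (simp_all add: Int_def)
      obtain S where "continuous_map (prod_topology (subtopology (prod_topology X X) (W R)) (top_of_set {0..1::real})) X S"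
        "\<And>z. z \<in> W R \<Longrightarrow> S (z, 0) = fst z" "\<And>z. z \<in> W R \<Longrightarrow> S (z, 1) = snd z"
      proof (rule homotopy_of_nullhomotopies[where h = "H i" and k = "K (j - k1)" and ?x0.0 = x0])
        show "continuous_map (prod_topology (subtopology X V1) (top_of_set {0..1})) X (H i)"
          using n1 i(2) unfolding null_cover_def e1[symmetric] by blast
        show "continuous_map (prod_topology (subtopology X V2) (top_of_set {0..1})) X (K (j - k1))"
          using n2 j2 unfolding null_cover_def e2[symmetric] by blast
        show "H i (x, 0) = x" "H i (x, 1) = x0" if "x \<in> V1" for x
          using n1 i(2) that unfolding null_cover_def tY by (auto simp: V1_def)
        show "K (j - k1) (x, 0) = x" "K (j - k1) (x, 1) = x0" if "x \<in> V2" for x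
          using n2 j2 that unfolding null_cover_def tY by (auto simp: V2_def)
      qed (use WV in auto)
      then have "ok R S" by (simp add: ok_def)
      then show ?thesis by blast
    qed
    then obtain S where S: "\<And>R. R \<in> good m \<Longrightarrow> ok R (S R)" by metis
    show ?thesis
    proof (rule has_motion_planner_disjoint_Union[where S = S])
      show "openin (subtopology (prod_topology X X) (Y1 \<times> Y2)) (W R)" if "R \<in> good m" for R
        using oW[of R] that by (simp add: good_def P_def)
      show "Y1 \<times> Y2 \<subseteq> topspace X \<times> topspace X" using Y by auto
      show "W R \<inter> W R' = {}" if "R \<in> good m" "R' \<in> good m" "R \<noteq> R'" for R R'
        using that by (intro dis) (auto simp: good_def)
    qed (use S in \<open>auto simp: ok_def\<close>)
  qed
  have cover: "(\<Union>m<k1 + k2 - 1. \<Union>R\<in>good m. W R) = Y1 \<times> Y2"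
  proof
    show "(\<Union>m<k1 + k2 - 1. \<Union>R\<in>good m. W R) \<subseteq> Y1 \<times> Y2" by (auto simp: W_def)
    show "Y1 \<times> Y2 \<subseteq> (\<Union>m<k1 + k2 - 1. \<Union>R\<in>good m. W R)"
    proof
      fix z assume z: "z \<in> Y1 \<times> Y2"
      \<comment> \<open>Both lists have maximum \<open>1\<close> at the point, so \<open>R\<close>
        contains an index of each; all other values are below \<open>1\<close>, which puts the point
        into \<open>W R\<close>.\<close>
      define R where "R = {l \<in> ?L. h l z = 1}"
      obtain i where i: "i < k1" "f i (fst z) = 1" using n1 z unfolding null_cover_def tY by force
      obtain j where j: "j < k2" "g j (snd z) = 1" using n2 z unfolding null_cover_def tY by force
      have iR: "i \<in> R" and jR: "k1 + j \<in> R" using i j by (auto simp: R_def h_def)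
      have fin: "finite R" by (simp add: R_def)
      have "card {i, k1 + j} \<le> card R" using iR jR fin by (intro card_mono) auto
      moreover have "card R \<le> card ?L" by (rule card_mono) (auto simp: R_def)
      ultimately have cR: "2 \<le> card R" "card R \<le> k1 + k2" using i by auto
      have le1: "h l z \<le> 1" if "l \<in> ?L" for l
      proof (cases "l < k1")
        case True
        then show ?thesis using n1 z unfolding null_cover_def tY by (force simp: h_def)
      next
        case False
        then have "l - k1 < k2" using that by auto
        then show ?thesis using n2 z False unfolding null_cover_def tY by (force simp: h_def)
      qed
      have "h b z < 1" if "b \<in> ?L - R" for b
        using le1[of b] that by (auto simp: R_def)
      then have "z \<in> W R" using z by (auto simp: W_def) (auto simp: R_def)
      moreover have "R \<in> good (card R - 2)"
        unfolding good_def
      proof (intro CollectI conjI)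
        show "R \<subseteq> ?L" by (auto simp: R_def)
        show "card R = card R - 2 + 2" using cR by simp
        show "\<exists>i\<in>R. i < k1" "\<exists>j\<in>R. k1 \<le> j"
          using i(1) by (auto intro: bexI[OF _ iR] bexI[OF _ jR])
      qed
      moreover have "card R - 2 < k1 + k2 - 1" using cR by linarith
      ultimately show "z \<in> (\<Union>m<k1 + k2 - 1. \<Union>R\<in>good m. W R)" by blast
    qed
  qed
  have "openin P (\<Union>R\<in>good m. W R)" for m
    using oW by (intro openin_Union) (auto simp: good_def)
  then show ?thesis
    unfolding TC_def using plan cover
    by (intro Inf_lower CollectI exI[of _ "k1 + k2 - 1"] conjI refl exI[of _ "\<lambda>m. \<Union>R\<in>good m. W R"])
       (auto simp: P_def)
qed

theorem theorem2p9:
  fixes X :: "'a topology" and Y1 Y2 :: "'a set" and C1 C2 :: "'a cw_data" and s :: nat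
  assumes "Y1 \<subseteq> topspace X" and "Y2 \<subseteq> topspace X"
    and "cw_complex (subtopology X Y1) C1" and "cw_complex (subtopology X Y2) C2"
    and "cw_dim C1 \<noteq> \<infinity>" and "cw_dim C2 \<noteq> \<infinity>"
    and "\<forall>j\<le>s. homotopy_group_vanishes j X"
  shows "ereal_of_enat (TC X (Y1 \<times> Y2))
    < (ereal_of_enat (cw_dim C1) + ereal_of_enat (cw_dim C2) + 1) / ereal (real (s + 1)) + 1"
proof -
  obtain d1 d2 where d: "cw_dim C1 = enat d1" "cw_dim C2 = enat d2" using assms(5,6) by auto
  \<comment> \<open>The least \<open>k\<close> with \<open>d1 < k * Suc s\<close>, the condition
    under which null covers extend over all cells of dimension at most \<open>d1\<close>.\<close>
  define k1 where "k1 = d1 div Suc s + 1"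
  define k2 where "k2 = d2 div Suc s + 1"
  have TC: "TC X (Y1 \<times> Y2) \<le> enat (k1 + k2 - 1)"
  \<comment> \<open>An empty space offers no base point, but then the product is empty and is
    covered by no sets at all.\<close>
  proof (cases "topspace X = {}")
    case True
    then have "Y1 \<times> Y2 = {}" using assms(1) by auto
    then have "TC X (Y1 \<times> Y2) \<le> enat 0"
      unfolding TC_def by (intro Inf_lower) auto
    then show ?thesis by (metis enat_ord_simps(1) le0 order_trans)
  next
    case False
    then obtain x0 where x0: "x0 \<in> topspace X" by blast
    have fill: "fills_cubes j X" if "j \<le> Suc s" for j
      using fills_cubes_of_connected[OF False _ that] assms(7) by blast
    have cover: "\<exists>f H. null_cover (n div Suc s + 1) (subtopology X Y) X (\<lambda>y. y) x0 f H"
      if cwY: "cw_complex (subtopology X Y) C" and n: "cw_dim C = enat n" for Y C n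
    proof -
      interpret cw "subtopology X Y" C by unfold_locales (rule cwY)
      have "cell_dim C e \<le> n" if "e \<in> cells C" for e
        using SUP_upper[OF that, of "\<lambda>e. enat (cell_dim C e)"] n by (simp add: cw_dim_def)
      moreover have "n < (n div Suc s + 1) * Suc s"
        using dividend_less_div_times[of "Suc s" n] by (simp add: algebra_simps)
      moreover have "continuous_map (subtopology X Y) X (\<lambda>y. y)" by simp
      ultimately show ?thesis using null_cover_of_finite_dim[OF fill x0] by metis
    qed
    show ?thesis
      using cover[OF assms(3) d(1)] cover[OF assms(4) d(2)] TC_le_of_null_covers[OF assms(1,2)]
      unfolding k1_def k2_def by blast
  qed
  \<comment> \<open>Rounding down loses nothing in the wrong direction: the two quotients times
    \<open>Suc s\<close> give at most \<open>d1 + d2\<close>, and the summand \<open>1\<close> in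
    the numerator makes the estimate strict.\<close>
  have "real (d1 div Suc s + d2 div Suc s) * real (Suc s) < real d1 + real d2 + 1"
  proof -
    have "(d1 div Suc s + d2 div Suc s) * Suc s \<le> d1 + d2"
      using div_times_less_eq_dividend[of d1 "Suc s"] div_times_less_eq_dividend[of d2 "Suc s"]
      by (simp only: add_mult_distrib add_mono)
    then have "real ((d1 div Suc s + d2 div Suc s) * Suc s) \<le> real (d1 + d2)" by (rule of_nat_mono)
    then show ?thesis by (simp only: of_nat_mult of_nat_add)
  qed
  then have "real (d1 div Suc s + d2 div Suc s) < (real d1 + real d2 + 1) / real (s + 1)"
    by (simp add: less_divide_eq)
  then have "real (k1 + k2 - 1) < (real d1 + real d2 + 1) / real (s + 1) + 1"
    by (simp add: k1_def k2_def)
  moreover have "(ereal_of_enat (cw_dim C1) + ereal_of_enat (cw_dim C2) + 1) / ereal (real (s + 1)) + 1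
      = ereal ((real d1 + real d2 + 1) / real (s + 1) + 1)"
    unfolding d by (simp add: one_ereal_def)
  moreover have "ereal_of_enat (TC X (Y1 \<times> Y2)) \<le> ereal (real (k1 + k2 - 1))"
    using TC by (metis ereal_of_enat_le_iff ereal_of_enat_simps(1))
  ultimately show ?thesis by (metis ereal_less_eq(3) less_ereal.simps(1) order_le_less_trans)
qed

end
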